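(* Let $\gamma\in(0,1)$, $\sigma\in(0,\infty)$, $\kappa\in(0,1]$, and let $L:(0,\infty)\to(0,\infty)$ be slowly varying at zero. Let $l:[0,\infty)\to\mathbb{R}$ be given by $l(0)=1$ and $$l(u)=\tfrac12\Bigl(1+(1+u)^{2\gamma}-\bigl(u^{\kappa}L(u)\bigr)^2\Bigr),\qquad u>0.$$ Let $X=(X_t)_{t\ge 0}$ be a centered Gaussian process with sample paths in $D[0,\infty)$, with $X_0\equiv 0$, and with covariance function $$\operatorname{E}X_sX_t=\sigma^2(s\wedge t)^{2\gamma}\,l\!\left(\frac{|s-t|}{s\wedge t}\right),\qquad s\wedge t>0 .$$ For $t,u\in(0,\infty)$ define the process $Z^{t,u}=(Z^{t,u}_\tau)_{\tau\ge0}$ by $$Z^{t,u}_\tau=\frac{X_t-X_{t+u\tau}}{u^{\kappa}L(u)},\qquad \tau\ge 0.$$ Then for every $t\in(0,\infty)$, as $u\to0^+$, $Z^{t,u}$ converges weakly in $D[0,\infty)$ to $c_tB^{\kappa}$, where $c_t=\sigma t^{\gamma-\kappa}$.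
   Context: $D[0,\infty)$ is the space of real-valued functions on $[0,\infty)$ that are right-continuous and have left limits, with the Skorohod metric (Skorohod topology on $[0,\infty)$) and its Borel $\sigma$-field. Weak convergence in $D[0,\infty)$ means convergence of expectations of bounded continuous functionals on $D[0,\infty)$. For $H\in(0,1)$, $B^H=(B^H_t)_{t\ge0}$ is the (continuous) fractional Brownian motion, i.e. the centered Gaussian process with covariance $\frac12(s^{2H}+t^{2H}-|t-s|^{2H})$. For $H=1$, $B^1_t=tZ$, $t\ge 0$, with $Z\sim\mathcal N(0,1)$. A measurable function $L:(0,\infty)\to(0,\infty)$ is slowly varying at zero if $L(\lambda u)/L(u)\to1$ as $u\to0^+$ for every fixed $\lambda>0$. *)

theory Defs
  imports "HOL-Probability.Probability"
begin

definition cadlag :: "(real \<Rightarrow> real) \<Rightarrow> bool" where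
  "cadlag x \<longleftrightarrow> (\<forall>t\<ge>0. (x \<longlongrightarrow> x t) (at_right t)) \<and> (\<forall>t>0. \<exists>l. (x \<longlongrightarrow> l) (at_left t))"

text \<open>A function on $[0,\infty)$ is represented by its extension by \<open>0\<close> to the negative half-line,
  so that equality in the type is equality on $[0,\infty)$.\<close>

typedef skorohod = "{x. cadlag x \<and> (\<forall>t<0. x t = 0)}"
  morphisms D_path Abs_skorohod
  by (rule exI[of _ "\<lambda>_. 0"]) (auto simp: cadlag_def)

text \<open>The element of the space given by the restriction of \<open>x\<close> to $[0,\infty)$; meaningful only if
  \<^term>\<open>cadlag x\<close>.\<close>

definition to_D :: "(real \<Rightarrow> real) \<Rightarrow> skorohod" where
  "to_D x = Abs_skorohod (\<lambda>t. if t < 0 then 0 else x t)"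

definition time_changes :: "real \<Rightarrow> (real \<Rightarrow> real) set" where
  "time_changes T = {h. strict_mono_on {0..T} h \<and> continuous_on {0..T} h \<and> h ` {0..T} = {0..T}}"

text \<open>The Skorohod metric on $D[0,T]$, and its extension to $D[0,\infty)$ as in Billingsley,
  \<^emph>\<open>Convergence of Probability Measures\<close>, Sections 12 and 16: the paths are first multiplied by the
  continuous cutoff \<open>cutoff m\<close>, which is \<open>1\<close> on $[0,m-1]$ and \<open>0\<close> on $[m,\infty)$.  Billingsley's
  complete variant of the metric induces the same topology.\<close>

definition skorohod_near :: "real \<Rightarrow> (real \<Rightarrow> real) \<Rightarrow> (real \<Rightarrow> real) \<Rightarrow> real \<Rightarrow> bool" where
  "skorohod_near T x y e \<longleftrightarrow>
     (\<exists>h\<in>time_changes T. \<forall>t\<in>{0..T}. \<bar>h t - t\<bar> \<le> e \<and> \<bar>x t - y (h t)\<bar> \<le> e)"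

definition skorohod_dist :: "real \<Rightarrow> (real \<Rightarrow> real) \<Rightarrow> (real \<Rightarrow> real) \<Rightarrow> real" where
  "skorohod_dist T x y = Inf {e. e > 0 \<and> skorohod_near T x y e}"

definition cutoff :: "nat \<Rightarrow> real \<Rightarrow> real" where
  "cutoff m t = max 0 (min 1 (real m - t))"

definition skorohod_dist_m :: "nat \<Rightarrow> (real \<Rightarrow> real) \<Rightarrow> (real \<Rightarrow> real) \<Rightarrow> real" where
  "skorohod_dist_m m x y =
     skorohod_dist (real m) (\<lambda>t. cutoff m t * x t) (\<lambda>t. cutoff m t * y t)"

lemma path_cadlag: "cadlag (D_path x)" and path_neg: "t < 0 \<Longrightarrow> D_path x t = 0"
  using D_path[of x] by auto

lemma path_to_D:
  assumes "cadlag x" "t \<ge> 0"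
  shows "D_path (to_D x) t = x t"
proof -
  let ?y = "\<lambda>t. if t < 0 then 0 else x t"
  have "cadlag ?y"
    unfolding cadlag_def
  proof (intro conjI allI impI)
    fix t :: real assume t: "t \<ge> 0"
    have "eventually (\<lambda>s. x s = ?y s) (at_right t)"
      using t by (auto simp: eventually_at_filter)
    moreover have "(x \<longlongrightarrow> ?y t) (at_right t)" using assms t by (simp add: cadlag_def)
    ultimately show "(?y \<longlongrightarrow> ?y t) (at_right t)" by (rule Lim_transform_eventually[rotated])
  next
    fix t :: real assume t: "t > 0"
    have "eventually (\<lambda>s. s \<in> {0<..<t}) (at_left t)"
      using t eventually_at_left_real by blast
    then have "eventually (\<lambda>s. x s = ?y s) (at_left t)"
      by eventually_elim auto
    moreover obtain l where "(x \<longlongrightarrow> l) (at_left t)" using assms t unfolding cadlag_def by blast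
    ultimately have "(?y \<longlongrightarrow> l) (at_left t)" by (rule Lim_transform_eventually[rotated])
    then show "\<exists>l. (?y \<longlongrightarrow> l) (at_left t)" ..
  qed
  then show ?thesis using assms(2) by (simp add: to_D_def Abs_skorohod_inverse)
qed

lemma path_bounded:
  assumes "T \<ge> 0"
  shows "\<exists>K. \<forall>t\<in>{0..T}. \<bar>D_path x t\<bar> \<le> K"
  using assms
proof (induction rule: Bolzano)
  case (trans a b c)
  then obtain K K' where "\<forall>t\<in>{a..b}. \<bar>D_path x t\<bar> \<le> K" "\<forall>t\<in>{b..c}. \<bar>D_path x t\<bar> \<le> K'" by blast
  then have "\<forall>t\<in>{a..c}. \<bar>D_path x t\<bar> \<le> max K K'"
    by (metis atLeastAtMost_iff le_max_iff_disj linorder_le_cases)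
  then show ?case by blast
next
  case (local s)
  have c: "cadlag (D_path x)" by (rule path_cadlag)
  have "(D_path x \<longlongrightarrow> D_path x s) (at_right s)" using c local by (auto simp: cadlag_def)
  from tendstoD[OF this, of 1] obtain d1 where d1: "d1 > s"
    "\<And>r. s < r \<Longrightarrow> r < d1 \<Longrightarrow> dist (D_path x r) (D_path x s) < 1"
    unfolding eventually_at_right_field by auto
  obtain l where "(D_path x \<longlongrightarrow> l) (at_left s)"
  proof (cases "s > 0")
    case True then show ?thesis using c that unfolding cadlag_def by blast
  next
    case False
    then have "s = 0" using local by simp
    have "((\<lambda>_::real. 0) \<longlongrightarrow> (0::real)) (at_left s)" by simp
    moreover have "eventually (\<lambda>r. 0 = D_path x r) (at_left s)"
      using \<open>s = 0\<close> path_neg by (auto simp: eventually_at_filter)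
    ultimately have "(D_path x \<longlongrightarrow> 0) (at_left s)" by (rule Lim_transform_eventually)
    then show ?thesis by (rule that)
  qed
  from tendstoD[OF this, of 1] obtain d2 where d2: "d2 < s"
    "\<And>r. d2 < r \<Longrightarrow> r < s \<Longrightarrow> dist (D_path x r) l < 1"
    unfolding eventually_at_left_field by auto
  define d where "d = min (d1 - s) (s - d2)"
  have "d > 0" using d1 d2 by (simp add: d_def)
  moreover have "\<bar>D_path x r\<bar> \<le> \<bar>D_path x s\<bar> + \<bar>l\<bar> + 1"
    if "a \<le> s \<and> s \<le> b \<and> b - a < d" "r \<in> {a..b}" for a b r
  proof -
    have "r < d1" "d2 < r"
      using that unfolding d_def atLeastAtMost_iff by linarith+
    then consider "r = s" | "s < r" "r < d1" | "d2 < r" "r < s"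
      by fastforce
    then show ?thesis
    proof cases
      case 1 then show ?thesis by simp
    next
      case 2 from d1(2)[OF 2] show ?thesis unfolding dist_real_def by linarith
    next
      case 3 from d2(2)[OF 3] show ?thesis unfolding dist_real_def by linarith
    qed
  qed
  ultimately show ?case by blast
qed

lemma time_changes_id: "id \<in> time_changes T"
  by (auto simp: time_changes_def strict_mono_on_def)

lemma time_changes_comp:
  assumes "h \<in> time_changes T" "k \<in> time_changes T"
  shows "k \<circ> h \<in> time_changes T"
  unfolding time_changes_def
proof (intro CollectI conjI)
  have h: "strict_mono_on {0..T} h" "continuous_on {0..T} h" "h ` {0..T} = {0..T}"
    and k: "strict_mono_on {0..T} k" "continuous_on {0..T} k" "k ` {0..T} = {0..T}"
    using assms by (auto simp: time_changes_def)
  show "strict_mono_on {0..T} (k \<circ> h)"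
  proof (rule strict_mono_onI)
    fix r s assume rs: "r \<in> {0..T}" "s \<in> {0..T}" "r < s"
    then have "h r < h s" "h r \<in> {0..T}" "h s \<in> {0..T}"
      using strict_mono_onD[OF h(1)] h(3) by blast+
    then show "(k \<circ> h) r < (k \<circ> h) s" using strict_mono_onD[OF k(1)] by auto
  qed
  show "continuous_on {0..T} (k \<circ> h)" using h k by (intro continuous_on_compose) simp_all
  show "(k \<circ> h) ` {0..T} = {0..T}" using h k by (metis image_comp)
qed

lemma time_changes_inv:
  assumes "h \<in> time_changes T"
  shows "inv_into {0..T} h \<in> time_changes T"
  unfolding time_changes_def
proof (intro CollectI conjI)
  have h: "strict_mono_on {0..T} h" "continuous_on {0..T} h" "h ` {0..T} = {0..T}"
    using assms by (auto simp: time_changes_def)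
  have inj: "inj_on h {0..T}" using h(1) strict_mono_on_imp_inj_on by blast
  show "strict_mono_on {0..T} (inv_into {0..T} h)"
  proof (rule strict_mono_onI, rule ccontr)
    fix r s assume rs: "r \<in> {0..T}" "s \<in> {0..T}" "r < s"
      and "\<not> inv_into {0..T} h r < inv_into {0..T} h s"
    moreover have "inv_into {0..T} h r \<in> {0..T}" "inv_into {0..T} h s \<in> {0..T}"
      using rs h(3) by (metis inv_into_into)+
    ultimately have "h (inv_into {0..T} h s) \<le> h (inv_into {0..T} h r)"
      using strict_mono_onD[OF h(1)] by (metis linorder_not_less order_le_less)
    then show False using rs h(3) by (simp add: f_inv_into_f)
  qed
  show "continuous_on {0..T} (inv_into {0..T} h)"
    using continuous_on_inv[OF h(2) compact_Icc, of "inv_into {0..T} h"] inj h(3)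
    by simp
  show "inv_into {0..T} h ` {0..T} = {0..T}"
    using inj h(3) by (metis inv_into_image_cancel order_refl)
qed

lemma time_changes_endpoint:
  assumes "h \<in> time_changes T" "T \<ge> 0"
  shows "h T = T"
proof -
  have h: "strict_mono_on {0..T} h" "h ` {0..T} = {0..T}"
    using assms by (auto simp: time_changes_def)
  obtain s where s: "s \<in> {0..T}" "h s = T" using h(2) assms(2)
    by (metis atLeastAtMost_iff imageE order_refl)
  have "h T \<in> {0..T}" using h(2) assms(2) by auto
  moreover have "h s \<le> h T"
    using s assms(2) strict_mono_onD[OF h(1), of s T] by (cases "s = T") auto
  ultimately show ?thesis using s by auto
qed

lemma skorohod_near_mono:
  assumes "skorohod_near T x y d" "d \<le> e"
  shows "skorohod_near T x y e"
proof -
  obtain h where h: "h \<in> time_changes T"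
    "\<And>t. t \<in> {0..T} \<Longrightarrow> \<bar>h t - t\<bar> \<le> d \<and> \<bar>x t - y (h t)\<bar> \<le> d"
    using assms unfolding skorohod_near_def by blast
  have "\<bar>h t - t\<bar> \<le> e \<and> \<bar>x t - y (h t)\<bar> \<le> e" if "t \<in> {0..T}" for t
    using h(2)[OF that] assms(2) by linarith
  then show ?thesis using h(1) unfolding skorohod_near_def by blast
qed

lemma skorohod_near_sym:
  assumes "skorohod_near T x y e"
  shows "skorohod_near T y x e"
proof -
  obtain h where h: "h \<in> time_changes T"
    "\<And>t. t \<in> {0..T} \<Longrightarrow> \<bar>h t - t\<bar> \<le> e \<and> \<bar>x t - y (h t)\<bar> \<le> e"
    using assms by (auto simp: skorohod_near_def)
  have im: "h ` {0..T} = {0..T}" using h(1) by (auto simp: time_changes_def)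
  have "\<bar>inv_into {0..T} h t - t\<bar> \<le> e \<and> \<bar>y t - x (inv_into {0..T} h t)\<bar> \<le> e"
    if "t \<in> {0..T}" for t
  proof -
    have "inv_into {0..T} h t \<in> {0..T}" "h (inv_into {0..T} h t) = t"
      using that im by (metis inv_into_into, metis f_inv_into_f)
    then show ?thesis using h(2)[of "inv_into {0..T} h t"] by (auto simp: abs_minus_commute)
  qed
  then show ?thesis using time_changes_inv[OF h(1)] unfolding skorohod_near_def by blast
qed

lemma skorohod_near_trans:
  assumes "skorohod_near T x y d" "skorohod_near T y z e"
  shows "skorohod_near T x z (d + e)"
proof -
  obtain h where h: "h \<in> time_changes T"
    "\<And>t. t \<in> {0..T} \<Longrightarrow> \<bar>h t - t\<bar> \<le> d \<and> \<bar>x t - y (h t)\<bar> \<le> d"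
    using assms by (auto simp: skorohod_near_def)
  obtain k where k: "k \<in> time_changes T"
    "\<And>t. t \<in> {0..T} \<Longrightarrow> \<bar>k t - t\<bar> \<le> e \<and> \<bar>y t - z (k t)\<bar> \<le> e"
    using assms by (auto simp: skorohod_near_def)
  have "\<bar>(k \<circ> h) t - t\<bar> \<le> d + e \<and> \<bar>x t - z ((k \<circ> h) t)\<bar> \<le> d + e" if "t \<in> {0..T}" for t
  proof -
    have "h t \<in> {0..T}" using that h(1) by (auto simp: time_changes_def)
    from k(2)[OF this] h(2)[OF that] show ?thesis unfolding o_apply by linarith
  qed
  then show ?thesis using time_changes_comp[OF h(1) k(1)] unfolding skorohod_near_def by blast
qed

lemma skorohod_near_eq:
  assumes near: "\<And>e. e > 0 \<Longrightarrow> skorohod_near T x y e" and t: "0 \<le> t" "t \<le> T"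
    and x: "(x \<longlongrightarrow> x t) (at_right t)" and y: "(y \<longlongrightarrow> y t) (at_right t)"
  shows "x t = y t"
proof -
  have "\<bar>x t - y t\<bar> \<le> 3 * e" if e: "e > 0" for e
  proof (cases "t = T")
    case True
    from near[OF e] obtain h where "h \<in> time_changes T" "\<bar>x T - y (h T)\<bar> \<le> e"
      using t by (auto simp: skorohod_near_def)
    then show ?thesis using time_changes_endpoint[of h T] t True e by simp
  next
    case False
    from tendstoD[OF x e] obtain b where b: "b > t"
      "\<And>s. t < s \<Longrightarrow> s < b \<Longrightarrow> \<bar>x s - x t\<bar> < e"
      unfolding eventually_at_right_field dist_real_def by auto
    from tendstoD[OF y e] obtain c where c: "c > t"
      "\<And>s. t < s \<Longrightarrow> s < c \<Longrightarrow> \<bar>y s - y t\<bar> < e"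
      unfolding eventually_at_right_field dist_real_def by auto
    define r where "r = (min (min b c) T - t) / 3"
    have r: "r > 0" "t + 2 * r < b" "t + 2 * r < c" "t + r < T"
      using b(1) c(1) t False by (auto simp: r_def min_def field_simps)
    have "min e (r / 2) > 0" using e r by simp
    from near[OF this] obtain h where
      "\<And>s. s \<in> {0..T} \<Longrightarrow> \<bar>h s - s\<bar> \<le> min e (r / 2) \<and> \<bar>x s - y (h s)\<bar> \<le> min e (r / 2)"
      unfolding skorohod_near_def by blast
    from this[of "t + r"] have
      h: "\<bar>h (t + r) - (t + r)\<bar> \<le> r / 2" "\<bar>x (t + r) - y (h (t + r))\<bar> \<le> e"
      using t r by auto
    have hr: "t < h (t + r)" "h (t + r) < t + 2 * r" using h(1) r(1) by linarith+
    have "\<bar>x (t + r) - x t\<bar> < e" "\<bar>y (h (t + r)) - y t\<bar> < e"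
      using b(2)[of "t + r"] c(2)[of "h (t + r)"] r hr by linarith+
    then show ?thesis using h(2) by linarith
  qed
  from this[of "\<bar>x t - y t\<bar> / 6"] show ?thesis by (cases "x t = y t") auto
qed

lemma cutoff_bounds: "0 \<le> cutoff m t" "cutoff m t \<le> 1"
  by (auto simp: cutoff_def)

definition near_set :: "nat \<Rightarrow> skorohod \<Rightarrow> skorohod \<Rightarrow> real set" where
  "near_set m x y = {e. e > 0 \<and>
     skorohod_near (real m) (\<lambda>t. cutoff m t * D_path x t) (\<lambda>t. cutoff m t * D_path y t) e}"

lemma skorohod_dist_m_eq: "skorohod_dist_m m (D_path x) (D_path y) = Inf (near_set m x y)"
  by (simp add: skorohod_dist_m_def skorohod_dist_def near_set_def)

lemma near_set_bdd: "bdd_below (near_set m x y)"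
  by (rule bdd_belowI[of _ 0]) (auto simp: near_set_def)

lemma near_set_uniform:
  assumes "e > 0" "\<And>t. 0 \<le> t \<Longrightarrow> t \<le> real m \<Longrightarrow> \<bar>D_path x t - D_path y t\<bar> \<le> e"
  shows "e \<in> near_set m x y"
proof -
  have "\<bar>cutoff m t * D_path x t - cutoff m t * D_path y t\<bar> \<le> e" if "0 \<le> t" "t \<le> real m" for t
  proof -
    have "\<bar>cutoff m t * D_path x t - cutoff m t * D_path y t\<bar> = cutoff m t * \<bar>D_path x t - D_path y t\<bar>"
      using cutoff_bounds(1)[of m t] by (simp add: abs_mult flip: right_diff_distrib)
    also have "\<dots> \<le> 1 * e"
      using cutoff_bounds[of m t] assms(2)[OF that] by (intro mult_mono) auto
    finally show ?thesis by simp
  qed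
  then have "\<forall>t\<in>{0..real m}. \<bar>id t - t\<bar> \<le> e \<and>
      \<bar>cutoff m t * D_path x t - cutoff m (id t) * D_path y (id t)\<bar> \<le> e"
    using assms(1) by simp
  then show ?thesis using assms(1) time_changes_id[of "real m"]
    unfolding near_set_def skorohod_near_def by blast
qed

lemma near_set_nonempty: "near_set m x y \<noteq> {}"
proof -
  obtain K where K: "\<forall>t\<in>{0..real m}. \<bar>D_path x t\<bar> \<le> K"
    using path_bounded[of "real m" x] by auto
  obtain K' where K': "\<forall>t\<in>{0..real m}. \<bar>D_path y t\<bar> \<le> K'"
    using path_bounded[of "real m" y] by auto
  have "\<bar>D_path x t - D_path y t\<bar> \<le> max 1 (K + K')" if "0 \<le> t" "t \<le> real m" for t
  proof -
    have "\<bar>D_path x t\<bar> \<le> K" "\<bar>D_path y t\<bar> \<le> K'" using K K' that by auto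
    then show ?thesis by linarith
  qed
  then have "max 1 (K + K') \<in> near_set m x y" by (intro near_set_uniform) auto
  then show ?thesis by blast
qed

lemma skorohod_dist_m_nonneg: "0 \<le> skorohod_dist_m m (D_path x) (D_path y)"
  unfolding skorohod_dist_m_eq
  by (rule cInf_greatest[OF near_set_nonempty]) (auto simp: near_set_def)

lemma skorohod_dist_m_commute:
  "skorohod_dist_m m (D_path x) (D_path y) = skorohod_dist_m m (D_path y) (D_path x)"
proof -
  have "near_set m x y = near_set m y x"
    unfolding near_set_def by (rule Collect_cong) (rule conj_cong[OF refl], rule iffI; erule skorohod_near_sym)
  then show ?thesis by (simp add: skorohod_dist_m_eq)
qed

lemma skorohod_dist_m_triangle:
  "skorohod_dist_m m (D_path x) (D_path z)
     \<le> skorohod_dist_m m (D_path x) (D_path y) + skorohod_dist_m m (D_path y) (D_path z)"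
proof (rule field_le_epsilon)
  fix e :: real assume e: "e > 0"
  have "Inf (near_set m x y) < Inf (near_set m x y) + e / 2"
    "Inf (near_set m y z) < Inf (near_set m y z) + e / 2" using e by auto
  then obtain a b where ab: "a \<in> near_set m x y" "a < Inf (near_set m x y) + e / 2"
    "b \<in> near_set m y z" "b < Inf (near_set m y z) + e / 2"
    unfolding cInf_less_iff[OF near_set_nonempty near_set_bdd] by blast
  then have "a + b \<in> near_set m x z" unfolding near_set_def mem_Collect_eq
    by (elim conjE) (rule conjI[OF add_pos_pos skorohod_near_trans])
  then have "Inf (near_set m x z) \<le> a + b" using near_set_bdd by (rule cInf_lower)
  then show "skorohod_dist_m m (D_path x) (D_path z)
      \<le> skorohod_dist_m m (D_path x) (D_path y) + skorohod_dist_m m (D_path y) (D_path z) + e"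
    unfolding skorohod_dist_m_eq using ab by linarith
qed

lemma skorohod_dist_m_self: "skorohod_dist_m m (D_path x) (D_path x) = 0"
proof (rule antisym[OF _ skorohod_dist_m_nonneg], rule field_le_epsilon)
  fix e :: real assume "e > 0"
  then have "e \<in> near_set m x x" by (intro near_set_uniform) auto
  then show "skorohod_dist_m m (D_path x) (D_path x) \<le> 0 + e"
    unfolding skorohod_dist_m_eq using near_set_bdd by (simp add: cInf_lower)
qed

lemma skorohod_dist_m_zero:
  assumes d: "skorohod_dist_m m (D_path x) (D_path y) = 0" and t: "0 \<le> t" "t \<le> real m - 1"
  shows "D_path x t = D_path y t"
proof -
  have near: "skorohod_near (real m) (\<lambda>t. cutoff m t * D_path x t) (\<lambda>t. cutoff m t * D_path y t) e"
    if "e > 0" for e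
  proof -
    have "Inf (near_set m x y) < e" using d that by (simp add: skorohod_dist_m_eq)
    then obtain a where a: "a \<in> near_set m x y" "a < e"
      unfolding cInf_less_iff[OF near_set_nonempty near_set_bdd] by blast
    then show ?thesis
      by (intro skorohod_near_mono[of "real m" _ _ a e]) (simp_all add: near_set_def)
  qed
  have cont: "((\<lambda>t. cutoff m t * D_path z t) \<longlongrightarrow> cutoff m t * D_path z t) (at_right t)" for z
  proof (rule tendsto_mult)
    show "(cutoff m \<longlongrightarrow> cutoff m t) (at_right t)"
      unfolding cutoff_def by (intro tendsto_intros)
    show "(D_path z \<longlongrightarrow> D_path z t) (at_right t)" using path_cadlag[of z] t by (auto simp: cadlag_def)
  qed
  have "cutoff m t * D_path x t = cutoff m t * D_path y t"
    by (rule skorohod_near_eq[where T = "real m", OF near _ _ cont cont]) (use t in auto)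
  moreover have "cutoff m t = 1" using t by (simp add: cutoff_def)
  ultimately show ?thesis by simp
qed

instantiation skorohod :: metric_space
begin

definition dist_skorohod :: "skorohod \<Rightarrow> skorohod \<Rightarrow> real" where
  "dist_skorohod x y =
     (\<Sum>n. (1/2) ^ Suc n * min 1 (skorohod_dist_m (Suc n) (D_path x) (D_path y)))"

definition uniformity_skorohod :: "(skorohod \<times> skorohod) filter" where
  "uniformity_skorohod = (INF e\<in>{0<..}. principal {(x, y). dist x y < e})"

definition open_skorohod :: "skorohod set \<Rightarrow> bool" where
  "open_skorohod U \<longleftrightarrow> (\<forall>x\<in>U. eventually (\<lambda>(x', y). x' = x \<longrightarrow> y \<in> U) uniformity)"

instance
proof
  let ?f = "\<lambda>x y n. (1/2::real) ^ Suc n * min 1 (skorohod_dist_m (Suc n) (D_path x) (D_path y))"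
  have nonneg: "?f x y n \<ge> 0" for x y n using skorohod_dist_m_nonneg by simp
  have sum: "summable (?f x y)" for x y
  proof (rule summable_comparison_test')
    show "summable (\<lambda>n. (1/2::real) ^ Suc n)" by (simp add: summable_geometric summable_mult)
    show "norm (?f x y n) \<le> (1/2) ^ Suc n" if "n \<ge> 0" for n
      using skorohod_dist_m_nonneg[of "Suc n" x y] by (auto simp: abs_mult min_def)
  qed
  show "dist x y = 0 \<longleftrightarrow> x = y" for x y :: skorohod
  proof
    assume "dist x y = 0"
    then have "?f x y n = 0" for n
      using suminf_eq_zero_iff[OF sum nonneg] by (simp add: dist_skorohod_def)
    then have "min 1 (skorohod_dist_m (Suc n) (D_path x) (D_path y)) = 0" for n
      by simp
    then have d: "skorohod_dist_m (Suc n) (D_path x) (D_path y) = 0" for n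
      by (metis min_def zero_neq_one)
    have "D_path x t = D_path y t" for t
    proof (cases "t < 0")
      case True then show ?thesis by (simp add: path_neg)
    next
      case False
      obtain n where "t \<le> real n" using real_arch_simple by blast
      then show ?thesis using skorohod_dist_m_zero[OF d[of n], of t] False by simp
    qed
    then show "x = y" using D_path_inject by blast
  next
    assume "x = y" then show "dist x y = 0" by (simp add: dist_skorohod_def skorohod_dist_m_self)
  qed
  show "dist x y \<le> dist x z + dist y z" for x y z :: skorohod
  proof -
    have "?f x y n \<le> ?f x z n + ?f y z n" for n
    proof -
      let ?d = "\<lambda>x y. skorohod_dist_m (Suc n) (D_path x) (D_path y)"
      have "min 1 (?d x y) \<le> min 1 (?d x z) + min 1 (?d y z)"
        using skorohod_dist_m_triangle[of "Suc n" x y z] skorohod_dist_m_commute[of "Suc n" y z]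
          skorohod_dist_m_nonneg[of "Suc n" x z] skorohod_dist_m_nonneg[of "Suc n" y z]
        by linarith
      then show ?thesis by (simp flip: distrib_left)
    qed
    then have "suminf (?f x y) \<le> (\<Sum>n. ?f x z n + ?f y z n)"
      by (intro suminf_le sum summable_add)
    also have "\<dots> = suminf (?f x z) + suminf (?f y z)" by (rule suminf_add[OF sum sum, symmetric])
    finally show ?thesis by (simp only: dist_skorohod_def)
  qed
qed (simp_all only: uniformity_skorohod_def open_skorohod_def)

end

text \<open>Weak convergence of random elements, indexed along a filter.  The measurability
  requirements ensure that the expectations are genuine (a Bochner integral of a non-measurable
  function is \<open>0\<close>); they hold for random elements by definition.\<close>

definition converges_weakly ::
  "'a measure \<Rightarrow> ('i \<Rightarrow> 'a \<Rightarrow> 'd::topological_space) \<Rightarrow> 'i filter \<Rightarrow>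
   'b measure \<Rightarrow> ('b \<Rightarrow> 'd) \<Rightarrow> bool" where
  "converges_weakly M Z F N Y \<longleftrightarrow>
     (\<forall>\<^sub>F i in F. Z i \<in> borel_measurable M) \<and> Y \<in> borel_measurable N \<and>
     (\<forall>f :: 'd \<Rightarrow> real. continuous_on UNIV f \<and> bounded (range f) \<longrightarrow>
        ((\<lambda>i. \<integral>\<omega>. f (Z i \<omega>) \<partial>M) \<longlongrightarrow> (\<integral>\<omega>. f (Y \<omega>) \<partial>N)) F)"

text \<open>Degenerate (almost surely constant) variables count as Gaussian.\<close>

definition gaussian_rv :: "'a measure \<Rightarrow> ('a \<Rightarrow> real) \<Rightarrow> bool" where
  "gaussian_rv M Y \<longleftrightarrow> Y \<in> borel_measurable M \<and>
     ((\<exists>\<mu>. AE \<omega> in M. Y \<omega> = \<mu>) \<or> (\<exists>\<mu> s. s > 0 \<and> distributed M lborel Y (normal_density \<mu> s)))"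

text \<open>Only the variables with time index in $[0,\infty)$ matter.\<close>

definition centered_gaussian_process :: "'a measure \<Rightarrow> (real \<Rightarrow> 'a \<Rightarrow> real) \<Rightarrow> bool" where
  "centered_gaussian_process M X \<longleftrightarrow>
     prob_space M \<and>
     (\<forall>I a. finite I \<and> I \<subseteq> {0..} \<longrightarrow> gaussian_rv M (\<lambda>\<omega>. \<Sum>t\<in>I. a t * X t \<omega>)) \<and>
     (\<forall>t\<ge>0. (\<integral>\<omega>. X t \<omega> \<partial>M) = 0)"

definition is_fBm :: "'a measure \<Rightarrow> real \<Rightarrow> (real \<Rightarrow> 'a \<Rightarrow> real) \<Rightarrow> bool" where
  "is_fBm N H B \<longleftrightarrow>
     prob_space N \<and>
     (if H = 1 then
        \<exists>\<xi>. distributed N lborel \<xi> std_normal_density \<and>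
            (\<forall>t\<ge>0. \<forall>\<omega>\<in>space N. B t \<omega> = t * \<xi> \<omega>)
      else
        0 < H \<and> H < 1 \<and>
        centered_gaussian_process N B \<and>
        (\<forall>s\<ge>0. \<forall>t\<ge>0. (\<integral>\<omega>. B s \<omega> * B t \<omega> \<partial>N)
           = (s powr (2*H) + t powr (2*H) - \<bar>t - s\<bar> powr (2*H)) / 2) \<and>
        (\<forall>\<omega>\<in>space N. continuous_on {0..} (\<lambda>t. B t \<omega>)))"

definition slowly_varying_at_0 :: "(real \<Rightarrow> real) \<Rightarrow> bool" where
  "slowly_varying_at_0 L \<longleftrightarrow>
     L \<in> borel_measurable (restrict_space borel {0<..}) \<and> (\<forall>u>0. L u > 0) \<and>
     (\<forall>c>0. ((\<lambda>u. L (c * u) / L u) \<longlongrightarrow> 1) (at_right 0))"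

end

theory Submission imports Defs begin

text \<open>Write \<open>\<psi> u = u powr \<kappa> * L u\<close>.  The function \<open>l\<close> is made so that
\<open>E (X s - X r)^2 = \<sigma>^2 * s powr (2*\<gamma>) * \<psi> ((r - s) / s)^2\<close> for \<open>0 < s < r\<close>.  Hence the
increment of the rescaled process over \<open>[a, b]\<close> has variance
\<open>\<sigma>^2 * s powr (2*\<gamma>) * (\<psi> (q * u) / \<psi> u)^2\<close> with \<open>s = t + u * a\<close> and \<open>q = (b - a) / s\<close>.  As
\<open>u\<close> tends to \<open>0\<close>, \<open>q\<close> tends to \<open>(b - a) / t\<close>, and regular variation of \<open>\<psi>\<close> gives the limit
\<open>c^2 * (b - a) powr (2*\<kappa>)\<close> with \<open>c = \<sigma> * t powr (\<gamma> - \<kappa>)\<close>, the variance of an increment of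
\<open>c * B\<close>.  The argument \<open>q\<close> moves with \<open>u\<close>, so pointwise slow variation is not enough; the
uniform statement needed is \<open>slowly_varying_log_bound\<close>, a form of the uniform convergence
theorem that also contains Potter's bound.  Potter's bound dominates all these variances by a
constant times \<open>\<bar>a - b\<bar> powr \<kappa>\<close>, uniformly in small \<open>u\<close> and \<open>a\<close>, \<open>b\<close> in a bounded interval.

These two facts are the hypotheses of \<open>gaussian_process_converges_weakly\<close>: centered Gaussian
processes with cadlag paths converge weakly in the Skorohod space if their covariances
converge and their increments satisfy a uniform Hoelder bound in mean square.  Its proof avoids
compactness in the Skorohod space.  By \<open>converges_weakly_lipschitzI\<close> it is enough to test
with bounded Lipschitz functionals.  Such a functional changes little when the path is
replaced by the step function \<open>discretize n\<close> that samples it at the dyadic points of level \<open>n\<close>: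
for the approximating processes, a chaining argument bounds the expected change uniformly
(\<open>expectation_discretization_error\<close>); for the limit it is dominated convergence, because
\<open>discretize n x\<close> converges to \<open>x\<close> for every cadlag \<open>x\<close> (\<open>discretize_tendsto\<close>).  The
discretized functional depends on finitely many coordinates, and there the covariances
determine the limit.

The step from covariances to expectations of Lipschitz functions of finitely many coordinates
(\<open>tendsto_expectation_of_characteristic\<close>) goes as follows.  If \<open>x k\<close> is replaced by
\<open>R * sin (x k / R)\<close>, a continuous function becomes one on a compact cube, which
by the Stone-Weierstrass theorem is a uniform limit of polynomials in the
\<open>sin (x k / R)\<close>, that is of trigonometric polynomials in \<open>x\<close>.  Their expectations are explicit
in the covariances, and the replacement costs at most a multiple of second moments divided
by \<open>R\<close>.

The same convergence \<open>discretize n x \<longlonglongrightarrow> x\<close> shows that a process with cadlag paths is a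
Borel random element of the Skorohod space: each discretization is a continuous function of
a sequence of real random variables.\<close>

section \<open>Dyadic discretization in the Skorohod space\<close>

lemma dist_skorohod_le:
  "dist x y \<le> (\<Sum>m<k. (1/2) ^ Suc m * skorohod_dist_m (Suc m) (D_path x) (D_path y)) + (1/2) ^ k"
proof -
  let ?f = "\<lambda>n. (1/2::real) ^ Suc n * min 1 (skorohod_dist_m (Suc n) (D_path x) (D_path y))"
  have half: "(\<lambda>n. (1/2::real) ^ Suc n) sums 1" by (rule power_half_series)
  have nn: "?f n \<ge> 0" for n using skorohod_dist_m_nonneg by simp
  have le: "?f n \<le> (1/2) ^ Suc n" for n by (simp add: mult_left_le)
  have sum: "summable ?f"
    by (rule summable_comparison_test'[OF sums_summable[OF half], of 0]) (use nn le in \<open>simp add: abs_of_nonneg\<close>)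
  have tail: "(\<lambda>n. (1/2::real) ^ k * (1/2) ^ Suc n) sums ((1/2) ^ k * 1)"
    by (rule sums_mult[OF half])
  have "dist x y = suminf ?f" by (simp only: dist_skorohod_def)
  also have "\<dots> = (\<Sum>n. ?f (n + k)) + sum ?f {..<k}"
    by (rule suminf_split_initial_segment[OF sum])
  also have "(\<Sum>n. ?f (n + k)) \<le> (\<Sum>n. (1/2::real) ^ k * (1/2) ^ Suc n)"
  proof (rule suminf_le)
    show "?f (n + k) \<le> (1/2::real) ^ k * (1/2) ^ Suc n" for n
      using le[of "n + k"] by (simp add: power_add mult_ac)
    show "summable (\<lambda>n. ?f (n + k))" using sum by (rule summable_ignore_initial_segment)
  qed (rule sums_summable[OF tail])
  also have "\<dots> = (1/2) ^ k" using sums_unique[OF tail] by simp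
  also have "sum ?f {..<k} \<le> (\<Sum>m<k. (1/2) ^ Suc m * skorohod_dist_m (Suc m) (D_path x) (D_path y))"
    by (intro sum_mono mult_left_mono) auto
  finally show ?thesis by simp
qed

lemma skorohod_dist_m_le_uniform:
  assumes "e \<ge> 0" "\<And>t. 0 \<le> t \<Longrightarrow> t \<le> real m \<Longrightarrow> \<bar>D_path x t - D_path y t\<bar> \<le> e"
  shows "skorohod_dist_m m (D_path x) (D_path y) \<le> e"
proof (rule field_le_epsilon)
  fix d :: real assume "d > 0"
  then have "e + d \<in> near_set m x y"
    using assms by (intro near_set_uniform) (auto intro: order_trans[OF assms(2)])
  then show "skorohod_dist_m m (D_path x) (D_path y) \<le> e + d"
    unfolding skorohod_dist_m_eq using near_set_bdd by (rule cInf_lower)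
qed

text \<open>The metric of uniform convergence on compact sets dominates the Skorohod metric; the
time interval beyond \<open>k\<close> contributes at most \<open>(1/2) ^ k\<close>.\<close>

lemma dist_skorohod_le_uniform:
  assumes "e \<ge> 0" "\<And>t. 0 \<le> t \<Longrightarrow> t \<le> real k \<Longrightarrow> \<bar>D_path x t - D_path y t\<bar> \<le> e"
  shows "dist x y \<le> e + (1/2) ^ k"
proof -
  have "(\<Sum>m<k. (1/2) ^ Suc m * skorohod_dist_m (Suc m) (D_path x) (D_path y)) \<le> (\<Sum>m<k. (1/2) ^ Suc m * e)"
    using assms by (intro sum_mono mult_left_mono skorohod_dist_m_le_uniform) auto
  also have "\<dots> = e * (\<Sum>m<k. (1/2) ^ Suc m)" by (simp add: sum_distrib_left mult_ac)
  also have "\<dots> \<le> e * 1"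
  proof (intro mult_left_mono assms)
    have "(\<Sum>m<k. (1/2::real) ^ Suc m) = 1 - (1/2) ^ k"
      by (induction k) (auto simp: field_simps)
    then show "(\<Sum>m<k. (1/2::real) ^ Suc m) \<le> 1" by simp
  qed
  finally show ?thesis using dist_skorohod_le[of x y k] by simp
qed

lemma dist_skorohod_le_uniform_UNIV:
  assumes "e \<ge> 0" "\<And>t. 0 \<le> t \<Longrightarrow> \<bar>D_path x t - D_path y t\<bar> \<le> e"
  shows "dist x y \<le> e"
proof (rule tendsto_lowerbound)
  have "((\<lambda>k. e + (1/2) ^ k) \<longlongrightarrow> e + 0) sequentially"
    by (intro tendsto_intros) auto
  then show "((\<lambda>k. e + (1/2) ^ k) \<longlongrightarrow> e) sequentially" by simp
  show "\<forall>\<^sub>F k in sequentially. dist x y \<le> e + (1/2) ^ k"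
    using dist_skorohod_le_uniform[of e _ x y] assms by auto
qed auto

lemma tendsto_skorohodI:
  assumes "\<And>m. ((\<lambda>n. skorohod_dist_m (Suc m) (D_path (x n)) (D_path y)) \<longlongrightarrow> 0) F"
  shows "(x \<longlongrightarrow> y) F"
proof (rule tendstoI)
  fix e :: real assume e: "e > 0"
  obtain k where k: "(1/2::real) ^ k < e / 2"
    using real_arch_pow_inv[of "e/2" "1/2"] e by auto
  have "((\<lambda>n. \<Sum>m<k. (1/2) ^ Suc m * skorohod_dist_m (Suc m) (D_path (x n)) (D_path y))
      \<longlongrightarrow> (\<Sum>m<k. (1/2) ^ Suc m * 0)) F"
    by (intro tendsto_intros assms)
  then have "\<forall>\<^sub>F n in F. (\<Sum>m<k. (1/2) ^ Suc m * skorohod_dist_m (Suc m) (D_path (x n)) (D_path y)) < e/2"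
    using e by (intro order_tendstoD) auto
  then show "\<forall>\<^sub>F n in F. dist (x n) y < e"
    by eventually_elim (use dist_skorohod_le[of _ y k] k in \<open>fastforce intro: le_less_trans\<close>)
qed

definition dyadic_floor :: "nat \<Rightarrow> real \<Rightarrow> real" where
  "dyadic_floor n t = of_int \<lfloor>2 ^ n * t\<rfloor> / 2 ^ n"

definition dyadic_ceil :: "nat \<Rightarrow> real \<Rightarrow> real" where
  "dyadic_ceil n t = of_int \<lceil>2 ^ n * t\<rceil> / 2 ^ n"

text \<open>Rounding down is adjoint to rounding up.  Consequently the rounded-down time
lies in \<open>[a, b)\<close> exactly when the time itself lies between the rounded-up endpoints.  This is the
reason why the time changes below carry \<open>dyadic_ceil n a\<close> to \<open>a\<close>.\<close>

lemma dyadic_galois: "a \<le> dyadic_floor n t \<longleftrightarrow> dyadic_ceil n a \<le> t"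
proof -
  have "a \<le> dyadic_floor n t \<longleftrightarrow> 2 ^ n * a \<le> of_int \<lfloor>2 ^ n * t\<rfloor>"
    by (simp add: dyadic_floor_def field_simps)
  also have "\<dots> \<longleftrightarrow> of_int \<lceil>2 ^ n * a\<rceil> \<le> 2 ^ n * t"
    by (metis ceiling_le_iff le_floor_iff)
  also have "\<dots> \<longleftrightarrow> dyadic_ceil n a \<le> t"
    by (simp add: dyadic_ceil_def field_simps)
  finally show ?thesis .
qed

lemma dyadic_ceil_bounds: "a \<le> dyadic_ceil n a" "dyadic_ceil n a \<le> a + (1/2) ^ n"
proof -
  show "a \<le> dyadic_ceil n a" by (simp add: dyadic_ceil_def field_simps)
  have "of_int \<lceil>2 ^ n * a\<rceil> \<le> 2 ^ n * a + 1" by linarith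
  then show "dyadic_ceil n a \<le> a + (1/2) ^ n"
    by (simp add: dyadic_ceil_def field_simps power_one_over)
qed

lemma dyadic_ceil_of_nat [simp]: "dyadic_ceil n (real m) = real m" "dyadic_ceil n 0 = 0"
proof -
  have "2 ^ n * real m = of_int (2 ^ n * int m)" by simp
  then show "dyadic_ceil n (real m) = real m"
    unfolding dyadic_ceil_def by (metis ceiling_of_int nonzero_mult_div_cancel_left power_eq_0_iff zero_neq_numeral)
qed (simp add: dyadic_ceil_def)

lemma dyadic_floor_of_nat [simp]: "dyadic_floor n (real m) = real m"
proof -
  have "2 ^ n * real m = of_int (2 ^ n * int m)" by simp
  then show "dyadic_floor n (real m) = real m"
    unfolding dyadic_floor_def by (metis floor_of_int nonzero_mult_div_cancel_left power_eq_0_iff zero_neq_numeral)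
qed

lemma dyadic_ceil_mono: "a \<le> b \<Longrightarrow> dyadic_ceil n a \<le> dyadic_ceil n b"
  by (simp add: dyadic_ceil_def divide_right_mono ceiling_mono)

text \<open>A time change between the rounded-up interval and \<open>[a, b]\<close> that displaces time by at most one
mesh width and matches the path sampled at dyadic points with the path itself up to \<open>e\<close>.  The
right endpoint is left out of the comparison, because it belongs to the next interval; this is
what makes aligned intervals composable.\<close>

definition aligned :: "(real \<Rightarrow> real) \<Rightarrow> real \<Rightarrow> nat \<Rightarrow> real \<Rightarrow> real \<Rightarrow> (real \<Rightarrow> real) \<Rightarrow> bool" where
  "aligned x e n a b h \<longleftrightarrow>
     strict_mono_on {dyadic_ceil n a..dyadic_ceil n b} h \<and>
     continuous_on {dyadic_ceil n a..dyadic_ceil n b} h \<and>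
     h ` {dyadic_ceil n a..dyadic_ceil n b} = {a..b} \<and>
     (\<forall>t\<in>{dyadic_ceil n a..dyadic_ceil n b}. \<bar>h t - t\<bar> \<le> (1/2) ^ n \<and>
        (t < dyadic_ceil n b \<longrightarrow> \<bar>x (dyadic_floor n t) - x (h t)\<bar> \<le> e))"

lemma eventually_dyadic_ceil_less:
  assumes "a < b"
  shows "\<forall>\<^sub>F n in sequentially. dyadic_ceil n a < dyadic_ceil n b"
proof -
  have "((\<lambda>n. (1/2::real) ^ n) \<longlongrightarrow> 0) sequentially" by (rule LIMSEQ_power_zero) simp
  then have "\<forall>\<^sub>F n in sequentially. (1/2::real) ^ n < b - a"
    using assms by (intro order_tendstoD) auto
  then show ?thesis
  proof eventually_elim
    case (elim n)
    show ?case using dyadic_ceil_bounds[where a=a and n=n] dyadic_ceil_bounds[where a=b and n=n] elim by linarith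
  qed
qed

text \<open>On a half-open interval where the path oscillates by at most \<open>e\<close>, the affine time change works,
because both the rounded-down time and the changed time stay in that interval.\<close>

lemma aligned_affine:
  assumes ab: "a \<le> b" and osc: "\<And>r s. a \<le> r \<Longrightarrow> r < b \<Longrightarrow> a \<le> s \<Longrightarrow> s < b \<Longrightarrow> \<bar>x r - x s\<bar> \<le> e"
  shows "\<forall>\<^sub>F n in sequentially. \<exists>h. aligned x e n a b h"
proof (cases "a = b")
  case True
  have "aligned x e n a b (\<lambda>_. a)" for n
    using dyadic_ceil_bounds[where a=a and n=n] True by (auto simp: aligned_def strict_mono_on_def)
  then show ?thesis by (intro always_eventually) blast
next
  case False
  then have "a < b" using ab by simp
  from eventually_dyadic_ceil_less[OF this] show ?thesis
  proof eventually_elim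
    case (elim n)
    define a' b' where "a' = dyadic_ceil n a" and "b' = dyadic_ceil n b"
    have ab': "a' < b'" using elim by (simp add: a'_def b'_def)
    define c where "c = (b - a) / (b' - a')"
    have c: "c > 0" using \<open>a < b\<close> ab' by (simp add: c_def)
    define h where "h = (\<lambda>t. c * t + (a - c * a'))"
    have ha: "h a' = a" by (simp add: h_def)
    have "c * (b' - a') = b - a" using ab' by (simp add: c_def)
    then have hb: "h b' = b" by (simp add: h_def algebra_simps)
    have mono: "h r < h s" if "r < s" for r s using that c by (simp add: h_def)
    have im: "h ` {a'..b'} = {a..b}"
      using image_affinity_atLeastAtMost[of c "a - c * a'" a' b'] ab' c ha hb
      unfolding h_def by simp
    \<comment> \<open>The displacement is affine in time, hence a convex combination of those at the endpoints.\<close>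
    have dist: "\<bar>h t - t\<bar> \<le> (1/2) ^ n" if t: "t \<in> {a'..b'}" for t
    proof -
      define w where "w = (t - a') / (b' - a')"
      have w: "0 \<le> w" "w \<le> 1" using t ab' by (auto simp: w_def)
      have "t = a' + w * (b' - a')" using ab' by (simp add: w_def)
      moreover have "h t = a + w * (b - a)"
        by (simp add: h_def w_def c_def diff_divide_distrib algebra_simps)
      ultimately have "t - h t = (1 - w) * (a' - a) + w * (b' - b)" by (simp add: algebra_simps)
      moreover have "(1 - w) * (a' - a) \<le> (1 - w) * (1/2) ^ n" "w * (b' - b) \<le> w * (1/2) ^ n"
        using w dyadic_ceil_bounds[where a=a and n=n] dyadic_ceil_bounds[where a=b and n=n]
        by (intro mult_left_mono; simp add: a'_def b'_def)+
      moreover have "(1 - w) * (a' - a) \<ge> 0" "w * (b' - b) \<ge> 0"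
        using w dyadic_ceil_bounds[where a=a and n=n] dyadic_ceil_bounds[where a=b and n=n] by (auto simp: a'_def b'_def)
      ultimately show ?thesis by (simp add: algebra_simps abs_if)
    qed
    have "\<bar>x (dyadic_floor n t) - x (h t)\<bar> \<le> e" if t: "t \<in> {a'..b'}" "t < b'" for t
    proof (rule osc)
      show "a \<le> dyadic_floor n t" using t by (simp add: dyadic_galois a'_def)
      show "dyadic_floor n t < b" using t dyadic_galois[of b n t] by (simp add: b'_def not_le)
      show "a \<le> h t" using t mono[of a' t] ha by (cases "t = a'") auto
      show "h t < b" using mono[OF t(2)] hb by simp
    qed
    moreover have "continuous_on {a'..b'} h" unfolding h_def by (intro continuous_intros)
    ultimately have "aligned x e n a b h"
      using dist im mono by (simp add: aligned_def strict_mono_on_def flip: a'_def b'_def)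
    then show ?case by blast
  qed
qed

lemma aligned_glue:
  assumes h: "aligned x e n a b h" and k: "aligned x e n b c k" and abc: "a \<le> b" "b \<le> c"
  shows "\<exists>g. aligned x e n a c g"
proof -
  define a' b' c' where "a' = dyadic_ceil n a" and "b' = dyadic_ceil n b" and "c' = dyadic_ceil n c"
  have le: "a' \<le> b'" "b' \<le> c'" using abc by (auto simp: a'_def b'_def c'_def intro: dyadic_ceil_mono)
  have h: "strict_mono_on {a'..b'} h" "continuous_on {a'..b'} h" "h ` {a'..b'} = {a..b}"
    "\<And>t. t \<in> {a'..b'} \<Longrightarrow> \<bar>h t - t\<bar> \<le> (1/2) ^ n"
    "\<And>t. t \<in> {a'..b'} \<Longrightarrow> t < b' \<Longrightarrow> \<bar>x (dyadic_floor n t) - x (h t)\<bar> \<le> e"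
    using h by (auto simp: aligned_def a'_def b'_def)
  have k: "strict_mono_on {b'..c'} k" "continuous_on {b'..c'} k" "k ` {b'..c'} = {b..c}"
    "\<And>t. t \<in> {b'..c'} \<Longrightarrow> \<bar>k t - t\<bar> \<le> (1/2) ^ n"
    "\<And>t. t \<in> {b'..c'} \<Longrightarrow> t < c' \<Longrightarrow> \<bar>x (dyadic_floor n t) - x (k t)\<bar> \<le> e"
    using k by (auto simp: aligned_def c'_def b'_def)
  have hb: "h b' = b"
  proof -
    obtain r where r: "r \<in> {a'..b'}" "h r = b" using h(3) abc by (metis atLeastAtMost_iff imageE order_refl)
    have "h r \<le> h b'" using r strict_mono_onD[OF h(1), of r b'] by (cases "r = b'") auto
    moreover have "h b' \<in> {a..b}" using h(3) le by auto
    ultimately show ?thesis using r by auto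
  qed
  have kb: "k b' = b"
  proof -
    obtain r where r: "r \<in> {b'..c'}" "k r = b" using k(3) abc by (metis atLeastAtMost_iff imageE order_refl)
    have "k b' \<le> k r" using r strict_mono_onD[OF k(1), of b' r] by (cases "r = b'") auto
    moreover have "k b' \<in> {b..c}" using k(3) le by auto
    ultimately show ?thesis using r by auto
  qed
  define g where "g = (\<lambda>t. if t \<le> b' then h t else k t)"
  have gk: "g t = k t" if "t \<ge> b'" for t using that hb kb by (auto simp: g_def)
  have un: "{a'..c'} = {a'..b'} \<union> {b'..c'}" using le by auto
  have gh: "g t = h t" if "t \<le> b'" for t using that by (simp add: g_def)
  have "g ` {a'..c'} = h ` {a'..b'} \<union> k ` {b'..c'}"
    unfolding un image_Un by (intro arg_cong2[where f="(\<union>)"] image_cong) (auto simp: gk gh)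
  then have im: "g ` {a'..c'} = {a..c}" using h(3) k(3) abc by auto
  have cont: "continuous_on {a'..c'} g"
    unfolding un
  proof (rule continuous_on_closed_Un)
    show "continuous_on {a'..b'} g" using h(2) by (rule continuous_on_eq) (auto simp: gh)
    show "continuous_on {b'..c'} g" using k(2) by (rule continuous_on_eq) (auto simp: gk)
  qed auto
  have mono: "strict_mono_on {a'..c'} g"
  proof (rule strict_mono_onI)
    fix r s assume rs: "r \<in> {a'..c'}" "s \<in> {a'..c'}" "r < s"
    consider "s \<le> b'" | "b' \<le> r" | "r < b'" "b' < s" by linarith
    then show "g r < g s"
    proof cases
      case 1 then show ?thesis using rs strict_mono_onD[OF h(1), of r s] by (simp add: gh)
    next
      case 2 then show ?thesis using rs strict_mono_onD[OF k(1), of r s] by (simp add: gk)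
    next
      case 3
      then have "h r < h b'" "k b' < k s"
        using rs strict_mono_onD[OF h(1), of r b'] strict_mono_onD[OF k(1), of b' s] by auto
      then show ?thesis using 3 hb kb by (simp add: gh gk)
    qed
  qed
  have "\<bar>g t - t\<bar> \<le> (1/2) ^ n \<and> (t < c' \<longrightarrow> \<bar>x (dyadic_floor n t) - x (g t)\<bar> \<le> e)" if "t \<in> {a'..c'}" for t
  proof (cases "t < b'")
    case True then show ?thesis using that h(4,5)[of t] by (simp add: gh)
  next
    case False then show ?thesis using that k(4,5)[of t] by (simp add: gk)
  qed
  then have "aligned x e n a c g"
    using mono cont im by (simp add: aligned_def flip: a'_def c'_def)
  then show ?thesis by blast
qed

lemma path_left_limit:
  assumes "s \<ge> 0"
  shows "\<exists>l. (D_path x \<longlongrightarrow> l) (at_left s)"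
proof (cases "s > 0")
  case True then show ?thesis using path_cadlag[of x] unfolding cadlag_def by blast
next
  case False
  then have "s = 0" using assms by simp
  have "((\<lambda>_::real. 0) \<longlongrightarrow> (0::real)) (at_left s)" by simp
  moreover have "eventually (\<lambda>r. 0 = D_path x r) (at_left s)"
    using \<open>s = 0\<close> path_neg by (auto simp: eventually_at_filter)
  ultimately have "(D_path x \<longlongrightarrow> 0) (at_left s)" by (rule Lim_transform_eventually)
  then show ?thesis ..
qed

text \<open>Bisection replaces the usual partition of \<open>[0, T]\<close> into intervals of small oscillation: around
each point the path is within \<open>e/2\<close> of its left limit before it and of its value after it, so the
two affine pieces glue at that point, and gluing is transitive.\<close>

lemma eventually_aligned:
  assumes "T \<ge> 0" "e > 0"
  shows "\<forall>\<^sub>F n in sequentially. \<exists>h. aligned (D_path x) e n 0 T h"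
  using assms(1)
proof (induction rule: Bolzano)
  case (trans a b c)
  from trans(1,2) show ?case
    by eventually_elim (use aligned_glue trans(3,4) in blast)
next
  case (local s)
  let ?x = "D_path x"
  have e2: "e / 2 > 0" using assms by simp
  obtain l where "(?x \<longlongrightarrow> l) (at_left s)" using path_left_limit local by blast
  from tendstoD[OF this e2] obtain d2 where d2: "d2 < s"
    "\<And>r. d2 < r \<Longrightarrow> r < s \<Longrightarrow> dist (?x r) l < e/2"
    unfolding eventually_at_left_field by auto
  have "(?x \<longlongrightarrow> ?x s) (at_right s)" using path_cadlag[of x] local by (auto simp: cadlag_def)
  from tendstoD[OF this e2] obtain d1 where d1: "d1 > s"
    "\<And>r. s < r \<Longrightarrow> r < d1 \<Longrightarrow> dist (?x r) (?x s) < e/2"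
    unfolding eventually_at_right_field by auto
  have d1': "dist (?x r) (?x s) < e/2" if "s \<le> r" "r < d1" for r
    using that d1(2)[of r] e2 by (cases "r = s") auto
  define d where "d = min (d1 - s) (s - d2)"
  have "d > 0" using d1 d2 by (simp add: d_def)
  moreover have "\<forall>\<^sub>F n in sequentially. \<exists>h. aligned ?x e n a b h"
    if "a \<le> s \<and> s \<le> b \<and> b - a < d" for a b
  proof -
    have ab: "a \<le> s" "s \<le> b" "d2 < a" "b < d1"
      using that unfolding d_def by linarith+
    have "\<forall>\<^sub>F n in sequentially. \<exists>h. aligned ?x e n a s h"
    proof (rule aligned_affine[OF ab(1)])
      fix r q assume "a \<le> r" "r < s" "a \<le> q" "q < s"
      then have "dist (?x r) l < e/2" "dist (?x q) l < e/2" using d2(2) ab by auto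
      then show "\<bar>?x r - ?x q\<bar> \<le> e" unfolding dist_real_def by linarith
    qed
    moreover have "\<forall>\<^sub>F n in sequentially. \<exists>h. aligned ?x e n s b h"
    proof (rule aligned_affine[OF ab(2)])
      fix r q assume "s \<le> r" "r < b" "s \<le> q" "q < b"
      then have "dist (?x r) (?x s) < e/2" "dist (?x q) (?x s) < e/2" using d1' ab by auto
      then show "\<bar>?x r - ?x q\<bar> \<le> e" unfolding dist_real_def by linarith
    qed
    ultimately show ?thesis by eventually_elim (use aligned_glue ab(1,2) in blast)
  qed
  ultimately show ?case by blast
qed

lemma cutoff_lipschitz: "\<bar>cutoff m s - cutoff m t\<bar> \<le> \<bar>s - t\<bar>"
  by (auto simp: cutoff_def max_def min_def abs_if)

text \<open>The index is capped at \<open>n * 2 ^ n\<close>, that is at time \<open>n\<close>, so that the path depends on finitely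
many entries of the sequence.\<close>

definition step_path :: "nat \<Rightarrow> (nat \<Rightarrow> real) \<Rightarrow> skorohod" where
  "step_path n a = to_D (\<lambda>t. a (min (nat \<lfloor>2 ^ n * t\<rfloor>) (n * 2 ^ n)))"

lemma cadlag_floor:
  fixes b :: "int \<Rightarrow> real"
  assumes "c > 0"
  shows "cadlag (\<lambda>t. b \<lfloor>c * t\<rfloor>)"
  unfolding cadlag_def
proof (intro conjI allI impI)
  fix t :: real
  have "c * t < of_int \<lfloor>c * t\<rfloor> + 1" by linarith
  then have "t < (of_int \<lfloor>c * t\<rfloor> + 1) / c" using assms by (simp add: field_simps)
  moreover have "\<lfloor>c * s\<rfloor> = \<lfloor>c * t\<rfloor>" if "t < s" "s < (of_int \<lfloor>c * t\<rfloor> + 1) / c" for s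
  proof (rule floor_unique)
    have "of_int \<lfloor>c * t\<rfloor> \<le> c * t" by simp
    also have "\<dots> \<le> c * s" using that assms by simp
    finally show "of_int \<lfloor>c * t\<rfloor> \<le> c * s" .
    show "c * s < of_int \<lfloor>c * t\<rfloor> + 1" using that assms by (simp add: field_simps)
  qed
  ultimately have "\<forall>\<^sub>F s in at_right t. b \<lfloor>c * t\<rfloor> = b \<lfloor>c * s\<rfloor>"
    unfolding eventually_at_right_field by auto
  then show "((\<lambda>t. b \<lfloor>c * t\<rfloor>) \<longlongrightarrow> b \<lfloor>c * t\<rfloor>) (at_right t)"
    by (rule Lim_transform_eventually[OF tendsto_const])
next
  fix t :: real
  define z where "z = \<lceil>c * t\<rceil> - 1"
  have z: "of_int z < c * t" "c * t \<le> of_int z + 1" unfolding z_def by linarith+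
  have "of_int z / c < t" using assms z by (simp add: field_simps)
  moreover have "\<lfloor>c * s\<rfloor> = z" if "of_int z / c < s" "s < t" for s
  proof (rule floor_unique)
    show "of_int z \<le> c * s" using that assms by (simp add: field_simps)
    have "c * s < c * t" using that assms by simp
    then show "c * s < of_int z + 1" using z by simp
  qed
  ultimately have "\<forall>\<^sub>F s in at_left t. b z = b \<lfloor>c * s\<rfloor>"
    unfolding eventually_at_left_field by auto
  then have "((\<lambda>t. b \<lfloor>c * t\<rfloor>) \<longlongrightarrow> b z) (at_left t)"
    by (rule Lim_transform_eventually[OF tendsto_const])
  then show "\<exists>l. ((\<lambda>t. b \<lfloor>c * t\<rfloor>) \<longlongrightarrow> l) (at_left t)" ..
qed

lemma path_step_path:
  assumes "t \<ge> 0"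
  shows "D_path (step_path n a) t = a (min (nat \<lfloor>2 ^ n * t\<rfloor>) (n * 2 ^ n))"
  unfolding step_path_def
  by (rule path_to_D[OF cadlag_floor[of "2 ^ n" "\<lambda>z. a (min (nat z) (n * 2 ^ n))"] assms]) simp

lemma step_path_lipschitz: "dist (step_path n a) (step_path n b) \<le> (\<Sum>k\<le>n * 2 ^ n. \<bar>a k - b k\<bar>)"
proof (rule dist_skorohod_le_uniform_UNIV)
  fix t :: real assume t: "t \<ge> 0"
  show "\<bar>D_path (step_path n a) t - D_path (step_path n b) t\<bar> \<le> (\<Sum>k\<le>n * 2 ^ n. \<bar>a k - b k\<bar>)"
    unfolding path_step_path[OF t]
    by (rule member_le_sum[where f="\<lambda>k. \<bar>a k - b k\<bar>"]) auto
qed (auto intro: sum_nonneg)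

definition discretize :: "nat \<Rightarrow> (real \<Rightarrow> real) \<Rightarrow> skorohod" where
  "discretize n x = step_path n (\<lambda>k. x (real k / 2 ^ n))"

lemma path_discretize:
  assumes "0 \<le> t" "t \<le> real n"
  shows "D_path (discretize n x) t = x (dyadic_floor n t)"
proof -
  have le: "2 ^ n * t \<le> real_of_int (int (n * 2 ^ n))" using assms by simp
  have "\<lfloor>2 ^ n * t\<rfloor> \<le> int (n * 2 ^ n)"
    using floor_mono[OF le] by (simp only: floor_of_int)
  then have "nat \<lfloor>2 ^ n * t\<rfloor> \<le> n * 2 ^ n" by (simp only: nat_le_iff)
  then have "min (nat \<lfloor>2 ^ n * t\<rfloor>) (n * 2 ^ n) = nat \<lfloor>2 ^ n * t\<rfloor>" by simp
  moreover have "real (nat \<lfloor>2 ^ n * t\<rfloor>) = of_int \<lfloor>2 ^ n * t\<rfloor>" using assms by simp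
  ultimately show ?thesis
    using path_step_path[OF assms(1)] by (simp add: discretize_def dyadic_floor_def)
qed

text \<open>The time change of \<open>eventually_aligned\<close> matches the sampled path with the path itself.  The cutoff
function is evaluated at the displaced time; it is 1-Lipschitz, and so costs at most the mesh
width times a bound for the path.\<close>

lemma discretize_tendsto: "(\<lambda>n. discretize n (D_path x)) \<longlonglongrightarrow> x"
proof (rule tendsto_skorohodI)
  fix m'
  define m where "m = Suc m'"
  show "(\<lambda>n. skorohod_dist_m (Suc m') (D_path (discretize n (D_path x))) (D_path x)) \<longlonglongrightarrow> 0"
    unfolding m_def[symmetric]
  proof (rule tendstoI)
    fix e :: real assume e: "e > 0"
    obtain K where K: "\<forall>t\<in>{0..real m}. \<bar>D_path x t\<bar> \<le> K"
      using path_bounded[of "real m" x] by auto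
    have "K \<ge> 0" using K by (metis abs_ge_zero atLeastAtMost_iff of_nat_0_le_iff order_refl order_trans)
    have lim: "((\<lambda>n. (1/2::real) ^ n) \<longlongrightarrow> 0) sequentially" by (rule LIMSEQ_power_zero) simp
    have lim': "((\<lambda>n. (1/2::real) ^ n * K) \<longlongrightarrow> 0 * K) sequentially" by (intro tendsto_intros lim)
    have "\<forall>\<^sub>F n in sequentially. (1/2::real) ^ n < e/2" using e by (intro order_tendstoD[OF lim]) auto
    moreover have "\<forall>\<^sub>F n in sequentially. (1/2::real) ^ n * K < e/4" using e by (intro order_tendstoD[OF lim']) auto
    moreover have "\<forall>\<^sub>F n in sequentially. \<exists>h. aligned (D_path x) (e/4) n 0 (real m) h"
      using e by (intro eventually_aligned) auto
    moreover have "\<forall>\<^sub>F n in sequentially. n \<ge> m" by (rule eventually_ge_at_top)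
    ultimately show "\<forall>\<^sub>F n in sequentially.
        dist (skorohod_dist_m m (D_path (discretize n (D_path x))) (D_path x)) 0 < e"
    proof eventually_elim
      case (elim n)
      let ?x = "D_path x"
      obtain h where "aligned ?x (e/4) n 0 (real m) h" using elim by blast
      then have h: "strict_mono_on {0..real m} h" "continuous_on {0..real m} h" "h ` {0..real m} = {0..real m}"
        "\<And>t. t \<in> {0..real m} \<Longrightarrow> \<bar>h t - t\<bar> \<le> (1/2) ^ n"
        "\<And>t. t \<in> {0..real m} \<Longrightarrow> t < real m \<Longrightarrow> \<bar>?x (dyadic_floor n t) - ?x (h t)\<bar> \<le> e/4"
        by (auto simp: aligned_def)
      have tc: "h \<in> time_changes (real m)" using h by (auto simp: time_changes_def)
      then have hm: "h (real m) = real m" by (intro time_changes_endpoint) auto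
      have "\<bar>cutoff m t * D_path (discretize n ?x) t - cutoff m (h t) * ?x (h t)\<bar> \<le> e/2"
        if t: "t \<in> {0..real m}" for t
      proof -
        have 1: "\<bar>?x (dyadic_floor n t) - ?x (h t)\<bar> \<le> e/4"
          using h(5)[OF t] t e hm by (cases "t < real m") auto
        have ht: "h t \<in> {0..real m}" using h(3) t by blast
        have 2: "\<bar>cutoff m t - cutoff m (h t)\<bar> \<le> (1/2) ^ n"
          using cutoff_lipschitz[of m t "h t"] h(4)[OF t] by (simp add: abs_minus_commute)
        have "cutoff m t * ?x (dyadic_floor n t) - cutoff m (h t) * ?x (h t)
            = cutoff m t * (?x (dyadic_floor n t) - ?x (h t)) + (cutoff m t - cutoff m (h t)) * ?x (h t)"
          by (simp add: algebra_simps)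
        also have "\<bar>\<dots>\<bar> \<le> cutoff m t * \<bar>?x (dyadic_floor n t) - ?x (h t)\<bar> + \<bar>cutoff m t - cutoff m (h t)\<bar> * \<bar>?x (h t)\<bar>"
          using cutoff_bounds[of m t] by (intro order_trans[OF abs_triangle_ineq]) (simp add: abs_mult)
        also have "\<dots> \<le> 1 * (e/4) + (1/2) ^ n * K"
          using cutoff_bounds[of m t] 1 2 K ht \<open>K \<ge> 0\<close> by (intro add_mono mult_mono) auto
        also have "\<dots> \<le> e/2" using elim by simp
        finally have "\<bar>cutoff m t * ?x (dyadic_floor n t) - cutoff m (h t) * ?x (h t)\<bar> \<le> e/2" .
        moreover have "D_path (discretize n ?x) t = ?x (dyadic_floor n t)"
          using t elim by (intro path_discretize) auto
        ultimately show ?thesis by simp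
      qed
      moreover have "\<bar>h t - t\<bar> \<le> e/2" if "t \<in> {0..real m}" for t
        using h(4)[OF that] elim by linarith
      ultimately have "e/2 \<in> near_set m (discretize n ?x) x"
        using e tc unfolding near_set_def skorohod_near_def by (intro CollectI conjI bexI[of _ h] ballI) auto
      then have "skorohod_dist_m m (D_path (discretize n ?x)) ?x \<le> e/2"
        unfolding skorohod_dist_m_eq using near_set_bdd by (rule cInf_lower)
      then show ?case using e skorohod_dist_m_nonneg[of m "discretize n ?x" x] by simp
    qed
  qed
qed

lemma discretize_cong:
  assumes "\<And>t. t \<ge> 0 \<Longrightarrow> x t = y t"
  shows "discretize n x = discretize n y"
  using assms by (simp add: discretize_def)

lemma discretize_to_D_tendsto:
  assumes "cadlag x"
  shows "(\<lambda>n. discretize n x) \<longlonglongrightarrow> to_D x"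
proof -
  have "discretize n (D_path (to_D x)) = discretize n x" for n
    by (rule discretize_cong) (simp add: path_to_D assms)
  then show ?thesis using discretize_tendsto[of "to_D x"] by simp
qed

lemma continuous_on_finitely_many_coordinates:
  fixes f :: "(nat \<Rightarrow> real) \<Rightarrow> 'd::metric_space"
  assumes "\<And>a b. dist (f a) (f b) \<le> C * (\<Sum>k\<le>n. \<bar>a k - b k\<bar>)"
  shows "continuous_on UNIV f"
  unfolding continuous_on_sequentially
proof (intro allI ballI impI)
  fix a :: "nat \<Rightarrow> nat \<Rightarrow> real" and b
  assume ab: "b \<in> UNIV" "(\<forall>n. a n \<in> UNIV) \<and> a \<longlonglongrightarrow> b"
  have lim: "(\<lambda>i. a i k) \<longlonglongrightarrow> b k" for k
  proof -
    have "continuous_on UNIV (\<lambda>a::nat \<Rightarrow> real. a k)" by (rule continuous_on_product_coordinates)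
    then have "isCont (\<lambda>a::nat \<Rightarrow> real. a k) b"
      using continuous_on_eq_continuous_at[OF open_UNIV] by blast
    from isCont_tendsto_compose[OF this] ab show ?thesis by blast
  qed
  have "(\<lambda>i. dist (f (a i)) (f b)) \<longlonglongrightarrow> 0"
  proof (rule tendsto_sandwich[OF _ _ tendsto_const])
    have "(\<lambda>i. C * (\<Sum>k\<le>n. \<bar>a i k - b k\<bar>)) \<longlonglongrightarrow> C * (\<Sum>k\<le>n. \<bar>b k - b k\<bar>)"
      by (intro tendsto_intros lim)
    then show "(\<lambda>i. C * (\<Sum>k\<le>n. \<bar>a i k - b k\<bar>)) \<longlonglongrightarrow> 0" by simp
  qed (auto intro: always_eventually assms)
  then show "(f \<circ> a) \<longlonglongrightarrow> f b" unfolding o_def by (subst tendsto_dist_iff)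
qed

lemma continuous_step_path: "continuous_on UNIV (step_path n)"
  by (rule continuous_on_finitely_many_coordinates[where C=1 and n="n * 2 ^ n"]) (simp add: step_path_lipschitz)

lemma measurable_discretize:
  assumes "\<And>t. t \<ge> 0 \<Longrightarrow> X t \<in> borel_measurable M"
  shows "(\<lambda>\<omega>. discretize n (\<lambda>t. X t \<omega>)) \<in> borel_measurable M"
proof -
  have "(\<lambda>\<omega> k. X (real k / 2 ^ n) \<omega>) \<in> borel_measurable M"
    by (rule measurable_coordinatewise_then_product) (simp add: assms)
  then show ?thesis unfolding discretize_def
    by (rule borel_measurable_continuous_on[OF continuous_step_path])
qed

text \<open>Discretizations are measurable, and pointwise limits of measurable maps into a metric space are
measurable; this replaces a description of the Borel sets by coordinates.\<close>

lemma measurable_to_D: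
  assumes "\<And>t. t \<ge> 0 \<Longrightarrow> X t \<in> borel_measurable M" "\<And>\<omega>. \<omega> \<in> space M \<Longrightarrow> cadlag (\<lambda>t. X t \<omega>)"
  shows "(\<lambda>\<omega>. to_D (\<lambda>t. X t \<omega>)) \<in> borel_measurable M"
  by (rule borel_measurable_LIMSEQ_metric[OF measurable_discretize[OF assms(1)]
        discretize_to_D_tendsto[OF assms(2)]])

section \<open>Weak convergence through Lipschitz functionals\<close>

text \<open>The infimal convolution of \<open>f\<close> with \<open>k\<close> times the metric: the largest \<open>k\<close>-Lipschitz function
below a bounded \<open>f\<close>.\<close>

definition lipschitz_envelope :: "('d::metric_space \<Rightarrow> real) \<Rightarrow> nat \<Rightarrow> 'd \<Rightarrow> real" where
  "lipschitz_envelope f k x = (INF y. f y + real k * dist x y)"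

context
  fixes f :: "'d::metric_space \<Rightarrow> real" and K :: real
  assumes f_bound: "\<And>x. \<bar>f x\<bar> \<le> K"
begin

lemma lipschitz_envelope_bdd: "bdd_below (range (\<lambda>y. f y + real k * dist x y))"
proof (rule bdd_belowI2)
  show "- K \<le> f y + real k * dist x y" for y
    using f_bound[of y] mult_nonneg_nonneg[OF of_nat_0_le_iff zero_le_dist, of k x y] by linarith
qed

lemma lipschitz_envelope_le: "lipschitz_envelope f k x \<le> f y + real k * dist x y"
  unfolding lipschitz_envelope_def by (rule cINF_lower[OF lipschitz_envelope_bdd]) simp

lemma lipschitz_envelope_le_self: "lipschitz_envelope f k x \<le> f x"
  using lipschitz_envelope_le[of k x x] by simp

lemma lipschitz_envelope_abs: "\<bar>lipschitz_envelope f k x\<bar> \<le> K"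
proof -
  have "- K \<le> lipschitz_envelope f k x"
    unfolding lipschitz_envelope_def
  proof (rule cINF_greatest)
    show "- K \<le> f y + real k * dist x y" for y
      using f_bound[of y] mult_nonneg_nonneg[OF of_nat_0_le_iff zero_le_dist, of k x y] by linarith
  qed simp
  then show ?thesis using lipschitz_envelope_le_self[of k x] f_bound[of x] by linarith
qed

lemma lipschitz_envelope_lipschitz:
  "\<bar>lipschitz_envelope f k x - lipschitz_envelope f k y\<bar> \<le> real k * dist x y"
proof -
  have *: "lipschitz_envelope f k x - real k * dist x y \<le> lipschitz_envelope f k y" for x y
    unfolding lipschitz_envelope_def[of f k y]
  proof (rule cINF_greatest)
    fix z
    have "real k * dist x z \<le> real k * dist x y + real k * dist y z"
      using dist_triangle[of x z y] by (simp add: mult_left_mono flip: distrib_left)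
    then show "lipschitz_envelope f k x - real k * dist x y \<le> f z + real k * dist y z"
      using lipschitz_envelope_le[of k x z] by linarith
  qed simp
  show ?thesis using *[of x y] *[of y x] by (simp add: dist_commute abs_le_iff)
qed

lemma lipschitz_envelope_tendsto:
  assumes "continuous_on UNIV f"
  shows "(\<lambda>k. lipschitz_envelope f k x) \<longlonglongrightarrow> f x"
proof (rule LIMSEQ_I)
  fix e :: real assume e: "e > 0"
  have "isCont f x" using assms continuous_on_eq_continuous_at[OF open_UNIV] by blast
  from this[unfolded continuous_at_eps_delta, rule_format, of "e/2"] e
  obtain d where d: "d > 0" "\<And>y. dist y x < d \<Longrightarrow> dist (f y) (f x) < e/2"
    by auto
  obtain N :: nat where N: "real N > 2 * K / d" using reals_Archimedean2 by blast
  have "norm (lipschitz_envelope f k x - f x) < e" if "k \<ge> N" for k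
  proof -
    have "f x - e/2 \<le> lipschitz_envelope f k x"
      unfolding lipschitz_envelope_def
    proof (rule cINF_greatest)
      fix y
      show "f x - e/2 \<le> f y + real k * dist x y"
      proof (cases "dist y x < d")
        case True
        have "0 \<le> real k * dist x y" by simp
        then show ?thesis using d(2)[OF True] unfolding dist_real_def by linarith
      next
        case False
        \<comment> \<open>Far points cannot compete: the penalty exceeds the oscillation of \<open>f\<close>.\<close>
        have "2 * K \<le> real N * d" using N d by (simp add: field_simps)
        also have "\<dots> \<le> real k * dist x y"
          using False that d by (intro mult_mono) (auto simp: dist_commute)
        finally show ?thesis using f_bound[of x] f_bound[of y] e by linarith
      qed
    qed simp
    then show ?thesis using lipschitz_envelope_le_self[of k x] e by simp
  qed
  then show "\<exists>N. \<forall>k\<ge>N. norm (lipschitz_envelope f k x - f x) < e" by blast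
qed

end

lemma borel_measurable_lipschitz:
  fixes f :: "'d::metric_space \<Rightarrow> real"
  assumes "\<And>x y. \<bar>f x - f y\<bar> \<le> C * dist x y"
  shows "f \<in> borel_measurable borel"
proof -
  have "\<bar>f x - f y\<bar> \<le> max 0 C * dist x y" for x y
    using assms[of x y] mult_right_mono[of C "max 0 C" "dist x y"] by simp
  then have "(max 0 C)-lipschitz_on UNIV f"
    by (auto simp: lipschitz_on_def dist_real_def)
  then show ?thesis
    by (intro borel_measurable_continuous_onI lipschitz_on_continuous_on)
qed

lemma (in prob_space) integrable_bounded_comp:
  fixes f :: "'d::topological_space \<Rightarrow> real"
  assumes "Z \<in> borel_measurable M" "f \<in> borel_measurable borel" "\<And>x. \<bar>f x\<bar> \<le> K"
  shows "integrable M (\<lambda>\<omega>. f (Z \<omega>))"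
  by (rule integrable_const_bound[of _ K]) (use assms in auto)

text \<open>Half of the portmanteau theorem.  Under the limit law the expectations of the envelopes tend to
that of \<open>f\<close>, so some envelope already has expectation above \<open>a\<close>; under the approximating laws
its expectation is at most that of \<open>f\<close>.\<close>

lemma eventually_integral_gt:
  fixes Z :: "'i \<Rightarrow> 'a \<Rightarrow> 'd::metric_space" and f :: "'d \<Rightarrow> real"
  assumes M: "prob_space M" and N: "prob_space N"
    and Z: "\<forall>\<^sub>F i in F. Z i \<in> borel_measurable M" and Y: "Y \<in> borel_measurable N"
    and lip: "\<And>(f :: 'd \<Rightarrow> real) C K. (\<And>x y. \<bar>f x - f y\<bar> \<le> C * dist x y) \<Longrightarrow> (\<And>x. \<bar>f x\<bar> \<le> K) \<Longrightarrow>
        ((\<lambda>i. \<integral>\<omega>. f (Z i \<omega>) \<partial>M) \<longlongrightarrow> (\<integral>\<omega>. f (Y \<omega>) \<partial>N)) F"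
    and f: "continuous_on UNIV f" "\<And>x. \<bar>f x\<bar> \<le> K" and a: "a < (\<integral>\<omega>. f (Y \<omega>) \<partial>N)"
  shows "\<forall>\<^sub>F i in F. a < (\<integral>\<omega>. f (Z i \<omega>) \<partial>M)"
proof -
  interpret M: prob_space M by (rule M)
  interpret N: prob_space N by (rule N)
  let ?f = "lipschitz_envelope f"
  have fm: "f \<in> borel_measurable borel" using f(1) by (rule borel_measurable_continuous_onI)
  have em: "?f k \<in> borel_measurable borel" for k
    by (rule borel_measurable_lipschitz[OF lipschitz_envelope_lipschitz[OF f(2)]])
  have "(\<lambda>k. \<integral>\<omega>. ?f k (Y \<omega>) \<partial>N) \<longlonglongrightarrow> (\<integral>\<omega>. f (Y \<omega>) \<partial>N)"
  proof (rule integral_dominated_convergence[where w="\<lambda>_. K"])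
    show "(\<lambda>\<omega>. f (Y \<omega>)) \<in> borel_measurable N" by (rule measurable_compose[OF Y fm])
    show "(\<lambda>\<omega>. ?f k (Y \<omega>)) \<in> borel_measurable N" for k by (rule measurable_compose[OF Y em])
    show "AE \<omega> in N. (\<lambda>k. ?f k (Y \<omega>)) \<longlonglongrightarrow> f (Y \<omega>)"
      by (rule AE_I2) (rule lipschitz_envelope_tendsto[OF f(2,1)])
    show "AE \<omega> in N. norm (?f k (Y \<omega>)) \<le> K" for k
      unfolding real_norm_def by (rule AE_I2) (rule lipschitz_envelope_abs[OF f(2)])
  qed simp
  then have "\<forall>\<^sub>F k in sequentially. a < (\<integral>\<omega>. ?f k (Y \<omega>) \<partial>N)"
    using a by (rule order_tendstoD)
  then obtain k where k: "a < (\<integral>\<omega>. ?f k (Y \<omega>) \<partial>N)"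
    unfolding eventually_sequentially by blast
  have "((\<lambda>i. \<integral>\<omega>. ?f k (Z i \<omega>) \<partial>M) \<longlongrightarrow> (\<integral>\<omega>. ?f k (Y \<omega>) \<partial>N)) F"
    by (rule lip[OF lipschitz_envelope_lipschitz[OF f(2)] lipschitz_envelope_abs[OF f(2)]])
  then have "\<forall>\<^sub>F i in F. a < (\<integral>\<omega>. ?f k (Z i \<omega>) \<partial>M)" using k by (rule order_tendstoD)
  with Z show ?thesis
  proof eventually_elim
    case (elim i)
    have "(\<integral>\<omega>. ?f k (Z i \<omega>) \<partial>M) \<le> (\<integral>\<omega>. f (Z i \<omega>) \<partial>M)"
      by (intro integral_mono M.integrable_bounded_comp[where K=K] elim fm em f
          lipschitz_envelope_abs[OF f(2)] lipschitz_envelope_le_self[OF f(2)])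
    then show ?case using elim by simp
  qed
qed

lemma converges_weakly_lipschitzI:
  fixes Z :: "'i \<Rightarrow> 'a \<Rightarrow> 'd::metric_space"
  assumes M: "prob_space M" and N: "prob_space N"
    and Z: "\<forall>\<^sub>F i in F. Z i \<in> borel_measurable M" and Y: "Y \<in> borel_measurable N"
    and lip: "\<And>(f :: 'd \<Rightarrow> real) C K. (\<And>x y. \<bar>f x - f y\<bar> \<le> C * dist x y) \<Longrightarrow> (\<And>x. \<bar>f x\<bar> \<le> K) \<Longrightarrow>
        ((\<lambda>i. \<integral>\<omega>. f (Z i \<omega>) \<partial>M) \<longlongrightarrow> (\<integral>\<omega>. f (Y \<omega>) \<partial>N)) F"
  shows "converges_weakly M Z F N Y"
  unfolding converges_weakly_def
proof (intro conjI Z Y allI impI order_tendstoI)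
  fix f :: "'d \<Rightarrow> real" and a
  assume f: "continuous_on UNIV f \<and> bounded (range f)"
  then obtain K where K: "\<And>x. \<bar>f x\<bar> \<le> K" unfolding bounded_iff by auto
  show "\<forall>\<^sub>F i in F. a < (\<integral>\<omega>. f (Z i \<omega>) \<partial>M)" if "a < (\<integral>\<omega>. f (Y \<omega>) \<partial>N)"
  proof (rule eventually_integral_gt[OF M N Z Y _ _ K that])
    show "continuous_on UNIV f" using f by blast
  qed (rule lip)
  \<comment> \<open>The upper bound is the lower bound for \<open>- f\<close>.\<close>
  assume a: "a > (\<integral>\<omega>. f (Y \<omega>) \<partial>N)"
  have "\<forall>\<^sub>F i in F. - a < (\<integral>\<omega>. - f (Z i \<omega>) \<partial>M)"
  proof (rule eventually_integral_gt[OF M N Z Y])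
    show "continuous_on UNIV (\<lambda>x. - f x)" using f by (intro continuous_on_minus) blast
    show "\<bar>- f x\<bar> \<le> K" for x using K[of x] by simp
    show "- a < (\<integral>\<omega>. - f (Y \<omega>) \<partial>N)" using a by simp
  qed (rule lip)
  then show "\<forall>\<^sub>F i in F. (\<integral>\<omega>. f (Z i \<omega>) \<partial>M) < a" by simp
qed

section \<open>Finite-dimensional convergence from trigonometric expectations\<close>

inductive trig_poly :: "((nat \<Rightarrow> real) \<Rightarrow> real) \<Rightarrow> bool" where
  trig_monomial: "trig_poly (\<lambda>x. c * cos ((\<Sum>k<n. \<xi> k * x k) + \<theta>))"
| trig_add: "trig_poly f \<Longrightarrow> trig_poly g \<Longrightarrow> trig_poly (\<lambda>x. f x + g x)"

lemma trig_poly_const: "trig_poly (\<lambda>_. c)"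
  using trig_monomial[of c _ 0 0] by simp

lemma trig_poly_sin: "trig_poly (\<lambda>x. sin (b * x k))"
proof -
  have "cos ((\<Sum>j<Suc k. (if j = k then b else 0) * x j) + - (pi / 2)) = sin (b * x k)" for x :: "nat \<Rightarrow> real"
    by (simp add: cos_diff)
  then show ?thesis using trig_monomial[of 1 "\<lambda>j. if j = k then b else 0" "Suc k" "- (pi/2)"] by simp
qed

lemma trig_poly_monomial_mult:
  "trig_poly (\<lambda>x. (c * cos ((\<Sum>k<n. \<xi> k * x k) + \<theta>)) * (d * cos ((\<Sum>k<m. \<eta> k * x k) + \<phi>)))"
proof -
  define \<xi>' where "\<xi>' k = (if k < n then \<xi> k else 0)" for k
  define \<eta>' where "\<eta>' k = (if k < m then \<eta> k else 0)" for k
  have x: "(\<Sum>k<n. \<xi> k * x k) = (\<Sum>k<n+m. \<xi>' k * x k)" for x :: "nat \<Rightarrow> real"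
    by (rule sum.mono_neutral_cong_left) (auto simp: \<xi>'_def)
  have e: "(\<Sum>k<m. \<eta> k * x k) = (\<Sum>k<n+m. \<eta>' k * x k)" for x :: "nat \<Rightarrow> real"
    by (rule sum.mono_neutral_cong_left) (auto simp: \<eta>'_def)
  have s: "(\<Sum>k<n+m. (\<xi>' k + \<eta>' k) * x k) = (\<Sum>k<n+m. \<xi>' k * x k) + (\<Sum>k<n+m. \<eta>' k * x k)"
    and d: "(\<Sum>k<n+m. (\<xi>' k - \<eta>' k) * x k) = (\<Sum>k<n+m. \<xi>' k * x k) - (\<Sum>k<n+m. \<eta>' k * x k)" for x
    by (simp_all add: algebra_simps sum.distrib sum_subtractf)
  have eq: "(c * cos ((\<Sum>k<n. \<xi> k * x k) + \<theta>)) * (d * cos ((\<Sum>k<m. \<eta> k * x k) + \<phi>)) =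
      c * d / 2 * cos ((\<Sum>k<n+m. (\<xi>' k - \<eta>' k) * x k) + (\<theta> - \<phi>))
      + c * d / 2 * cos ((\<Sum>k<n+m. (\<xi>' k + \<eta>' k) * x k) + (\<theta> + \<phi>))" for x
  proof -
    define A B where "A = (\<Sum>k<n+m. \<xi>' k * x k)" and "B = (\<Sum>k<n+m. \<eta>' k * x k)"
    have "cos (A + \<theta>) * cos (B + \<phi>) = (cos (A - B + (\<theta> - \<phi>)) + cos (A + B + (\<theta> + \<phi>))) / 2"
      unfolding cos_times_cos by (simp add: algebra_simps)
    then show ?thesis unfolding x e s d A_def[symmetric] B_def[symmetric] by (simp add: field_simps)
  qed
  show ?thesis unfolding eq by (intro trig_add trig_monomial)
qed

lemma trig_poly_mult:
  assumes "trig_poly f" "trig_poly g"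
  shows "trig_poly (\<lambda>x. f x * g x)"
  using assms(1)
proof induction
  case (trig_monomial c \<xi> n \<theta>)
  show ?case using assms(2)
  proof induction
    case (trig_monomial d \<eta> m \<phi>)
    show ?case by (rule trig_poly_monomial_mult)
  next
    case (trig_add f g)
    then show ?case unfolding distrib_left by (intro trig_poly.trig_add)
  qed
next
  case (trig_add f g)
  then show ?case unfolding distrib_right by (intro trig_poly.trig_add)
qed

lemma trig_poly_measurable:
  assumes "trig_poly f" "\<And>k. V k \<in> borel_measurable M"
  shows "(\<lambda>\<omega>. f (\<lambda>k. V k \<omega>)) \<in> borel_measurable M"
  using assms(1) by induction (use assms(2) in measurable)

lemma trig_poly_bounded:
  assumes "trig_poly f"
  shows "\<exists>K. \<forall>x. \<bar>f x\<bar> \<le> K"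
  using assms
proof induction
  case (trig_monomial c \<xi> n \<theta>)
  have "\<bar>c * cos ((\<Sum>k<n. \<xi> k * x k) + \<theta>)\<bar> \<le> \<bar>c\<bar>" for x
    by (simp add: abs_mult mult_left_le)
  then show ?case by blast
next
  case (trig_add f g)
  then obtain K L where "\<forall>x. \<bar>f x\<bar> \<le> K" "\<forall>x. \<bar>g x\<bar> \<le> L" by blast
  then have "\<forall>x. \<bar>f x + g x\<bar> \<le> K + L" by (meson abs_triangle_ineq add_mono order_trans)
  then show ?case by blast
qed

lemma (in prob_space) trig_poly_integrable:
  assumes "trig_poly f" "\<And>k. V k \<in> borel_measurable M"
  shows "integrable M (\<lambda>\<omega>. f (\<lambda>k. V k \<omega>))"
proof -
  obtain K where "\<forall>x. \<bar>f x\<bar> \<le> K" using trig_poly_bounded[OF assms(1)] by blast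
  then show ?thesis
    by (intro integrable_const_bound[of _ K] trig_poly_measurable[OF assms]) auto
qed

text \<open>The points \<open>\<lambda>k. sin (b * x k)\<close> lie in a product of intervals \<open>[-1, 1]\<close>, which is compact by
Tychonoff's theorem; the continuous functions on this cube that become
trigonometric polynomials after this substitution form a point-separating algebra.\<close>

lemma trig_poly_approximation:
  fixes G :: "(nat \<Rightarrow> real) \<Rightarrow> real"
  assumes G: "continuous_on UNIV G" and e: "e > 0"
  shows "\<exists>p. trig_poly p \<and> (\<forall>x. \<bar>G (\<lambda>k. sin (b * x k)) - p x\<bar> < e)"
proof -
  let ?S = "PiE UNIV (\<lambda>_::nat. {-1..1::real})"
  let ?P = "\<lambda>\<phi>. continuous_on ?S \<phi> \<and> trig_poly (\<lambda>x. \<phi> (\<lambda>k. sin (b * x k)))"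
  have "compactin (product_topology (\<lambda>_. euclidean) UNIV) ?S"
    unfolding compactin_PiE by simp
  then have compact: "compact ?S" by (simp add: euclidean_product_topology)
  have "\<exists>g. ?P g \<and> (\<forall>x\<in>?S. \<bar>G x - g x\<bar> < e)"
  proof (rule Stone_Weierstrass_HOL[OF compact, where P = ?P])
    show "continuous_on ?S G" using G by (rule continuous_on_subset) simp
    show "\<exists>f. ?P f \<and> f x \<noteq> f y" if xy: "x \<in> ?S \<and> y \<in> ?S \<and> x \<noteq> y" for x y
    proof -
      obtain k where "x k \<noteq> y k" using xy by (meson ext)
      moreover have "continuous_on ?S (\<lambda>x. x k)"
        by (rule continuous_on_subset[OF continuous_on_product_coordinates]) simp
      then have "?P (\<lambda>x. x k)" by (simp add: trig_poly_sin)
      ultimately show ?thesis by blast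
    qed
  qed (use e in \<open>auto intro: trig_poly_const trig_add trig_poly_mult continuous_intros\<close>)
  then obtain g where g: "trig_poly (\<lambda>x. g (\<lambda>k. sin (b * x k)))" "\<And>x. x \<in> ?S \<Longrightarrow> \<bar>G x - g x\<bar> < e"
    by blast
  have "(\<lambda>k. sin (b * x k)) \<in> ?S" for x by (auto simp: abs_le_iff intro: sin_ge_minus_one)
  then have "\<bar>G (\<lambda>k. sin (b * x k)) - g (\<lambda>k. sin (b * x k))\<bar> < e" for x by (rule g(2))
  then show ?thesis using g(1) by blast
qed

lemma abs_scaled_sin_diff_le:
  fixes x R :: real
  assumes "R > 0"
  shows "\<bar>x - R * sin (1/R * x)\<bar> \<le> x\<^sup>2 / (2 * R)"
proof -
  have "\<bar>sin (x/R) - x/R\<bar> \<le> (x/R)\<^sup>2 / 2"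
    using Maclaurin_sin_bound[of "x/R" 2] by (simp add: sin_coeff_def numeral_2_eq_2)
  then have "R * \<bar>sin (x/R) - x/R\<bar> \<le> R * ((x/R)\<^sup>2 / 2)"
    using assms by (intro mult_left_mono) auto
  moreover have "R * \<bar>sin (x/R) - x/R\<bar> = \<bar>x - R * sin (1/R * x)\<bar>"
  proof -
    have "R * \<bar>sin (x/R) - x/R\<bar> = \<bar>R * (sin (x/R) - x/R)\<bar>" using assms by (simp add: abs_mult)
    also have "R * (sin (x/R) - x/R) = R * sin (1/R * x) - x" using assms by (simp add: right_diff_distrib)
    finally show ?thesis by (simp add: abs_minus_commute)
  qed
  moreover have "R * ((x/R)\<^sup>2 / 2) = x\<^sup>2 / (2 * R)" using assms by (simp add: power2_eq_square)
  ultimately show ?thesis by simp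
qed

text \<open>Replacing \<open>x k\<close> by \<open>R * sin (x k / R)\<close> moves it by at most \<open>(x k)^2 / (2 * R)\<close>, so second moments alone
control the error, and no truncation or tightness argument is needed.\<close>

lemma (in prob_space) expectation_sine_compression:
  fixes V :: "nat \<Rightarrow> 'a \<Rightarrow> real"
  assumes V: "\<And>k. V k \<in> borel_measurable M" and sq: "\<And>k. integrable M (\<lambda>\<omega>. (V k \<omega>)\<^sup>2)"
    and S: "(\<Sum>k\<le>n. \<integral>\<omega>. (V k \<omega>)\<^sup>2 \<partial>M) \<le> S"
    and g: "g \<in> borel_measurable borel" "\<And>a. \<bar>g a\<bar> \<le> K"
      "\<And>a b. \<bar>g a - g b\<bar> \<le> C * (\<Sum>k\<le>n. \<bar>a k - b k\<bar>)"
    and C: "C \<ge> 0" and R: "R > 0"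
    and p: "trig_poly p" "\<And>x. \<bar>g (\<lambda>k. R * sin (1/R * x k)) - p x\<bar> \<le> e"
  shows "\<bar>(\<integral>\<omega>. g (\<lambda>k. V k \<omega>) \<partial>M) - (\<integral>\<omega>. p (\<lambda>k. V k \<omega>) \<partial>M)\<bar> \<le> C * S / (2 * R) + e"
proof -
  have gi: "integrable M (\<lambda>\<omega>. g (\<lambda>k. V k \<omega>))"
    by (rule integrable_bounded_comp[OF measurable_coordinatewise_then_product[OF V] g(1,2)])
  have pi: "integrable M (\<lambda>\<omega>. p (\<lambda>k. V k \<omega>))" by (rule trig_poly_integrable[OF p(1) V])
  have ptw: "\<bar>g x - p x\<bar> \<le> C / (2 * R) * (\<Sum>k\<le>n. (x k)\<^sup>2) + e" for x
  proof -
    have "\<bar>g x - g (\<lambda>k. R * sin (1/R * x k))\<bar> \<le> C * (\<Sum>k\<le>n. \<bar>x k - R * sin (1/R * x k)\<bar>)"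
      by (rule g(3))
    also have "\<dots> \<le> C * (\<Sum>k\<le>n. (x k)\<^sup>2 / (2 * R))"
      by (intro mult_left_mono sum_mono abs_scaled_sin_diff_le R C)
    also have "\<dots> = C / (2 * R) * (\<Sum>k\<le>n. (x k)\<^sup>2)" by (simp flip: sum_divide_distrib)
    finally show ?thesis using p(2)[of x] by linarith
  qed
  have "\<bar>(\<integral>\<omega>. g (\<lambda>k. V k \<omega>) \<partial>M) - (\<integral>\<omega>. p (\<lambda>k. V k \<omega>) \<partial>M)\<bar>
      = \<bar>\<integral>\<omega>. g (\<lambda>k. V k \<omega>) - p (\<lambda>k. V k \<omega>) \<partial>M\<bar>"
    by (simp add: gi pi)
  also have "\<dots> \<le> (\<integral>\<omega>. \<bar>g (\<lambda>k. V k \<omega>) - p (\<lambda>k. V k \<omega>)\<bar> \<partial>M)"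
    by (rule integral_abs_bound)
  also have "\<dots> \<le> (\<integral>\<omega>. C / (2 * R) * (\<Sum>k\<le>n. (V k \<omega>)\<^sup>2) + e \<partial>M)"
    by (intro integral_mono integrable_abs Bochner_Integration.integrable_add integrable_mult_right
        Bochner_Integration.integrable_diff Bochner_Integration.integrable_sum gi pi sq ptw) simp_all
  also have "\<dots> = C / (2 * R) * (\<Sum>k\<le>n. \<integral>\<omega>. (V k \<omega>)\<^sup>2 \<partial>M) + e"
    using sq by (simp add: prob_space)
  also have "\<dots> \<le> C / (2 * R) * S + e" using C R S by (intro add_mono mult_left_mono) auto
  finally show ?thesis by simp
qed

lemma tendsto_expectation_of_trig:
  fixes V :: "'i \<Rightarrow> nat \<Rightarrow> 'a \<Rightarrow> real" and W :: "nat \<Rightarrow> 'b \<Rightarrow> real"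
  assumes M: "prob_space M" and N: "prob_space N"
    and V: "\<forall>\<^sub>F i in F. \<forall>k. V i k \<in> borel_measurable M" and W: "\<And>k. W k \<in> borel_measurable N"
    and conv: "\<And>n \<xi> \<theta>. ((\<lambda>i. \<integral>\<omega>. cos ((\<Sum>k<n. \<xi> k * V i k \<omega>) + \<theta>) \<partial>M) \<longlongrightarrow>
       (\<integral>\<omega>. cos ((\<Sum>k<n. \<xi> k * W k \<omega>) + \<theta>) \<partial>N)) F"
    and p: "trig_poly p"
  shows "((\<lambda>i. \<integral>\<omega>. p (\<lambda>k. V i k \<omega>) \<partial>M) \<longlongrightarrow> (\<integral>\<omega>. p (\<lambda>k. W k \<omega>) \<partial>N)) F"
  using p
proof induction
  case (trig_monomial c \<xi> n \<theta>)
  show ?case unfolding integral_mult_right_zero by (intro tendsto_mult tendsto_const conv)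
next
  case (trig_add f g)
  have "((\<lambda>i. (\<integral>\<omega>. f (\<lambda>k. V i k \<omega>) \<partial>M) + (\<integral>\<omega>. g (\<lambda>k. V i k \<omega>) \<partial>M)) \<longlongrightarrow>
      (\<integral>\<omega>. f (\<lambda>k. W k \<omega>) \<partial>N) + (\<integral>\<omega>. g (\<lambda>k. W k \<omega>) \<partial>N)) F"
    by (intro tendsto_add trig_add.IH)
  also have "(\<integral>\<omega>. f (\<lambda>k. W k \<omega>) \<partial>N) + (\<integral>\<omega>. g (\<lambda>k. W k \<omega>) \<partial>N) = (\<integral>\<omega>. f (\<lambda>k. W k \<omega>) + g (\<lambda>k. W k \<omega>) \<partial>N)"
    by (rule Bochner_Integration.integral_add[symmetric]; rule prob_space.trig_poly_integrable[OF N _ W]; fact trig_add.hyps)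
  finally show ?case
  proof (rule Lim_transform_eventually)
    show "\<forall>\<^sub>F i in F. (\<integral>\<omega>. f (\<lambda>k. V i k \<omega>) \<partial>M) + (\<integral>\<omega>. g (\<lambda>k. V i k \<omega>) \<partial>M)
        = (\<integral>\<omega>. f (\<lambda>k. V i k \<omega>) + g (\<lambda>k. V i k \<omega>) \<partial>M)"
      using V
    proof eventually_elim
      case (elim i)
      then have V: "V i k \<in> borel_measurable M" for k by blast
      show ?case
        by (rule Bochner_Integration.integral_add[symmetric];
            rule prob_space.trig_poly_integrable[OF M _ V]; fact trig_add.hyps)
    qed
  qed
qed

text \<open>A version of the continuity theorem for characteristic functions in several variables.  The phase
\<open>\<theta>\<close> in the hypothesis covers the real and the imaginary part at once.  The coordinates
are indexed by all natural numbers, although \<open>g\<close> involves only those up to \<open>n\<close>, because the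
approximating trigonometric polynomials may involve any of them.\<close>

lemma tendsto_expectation_of_characteristic:
  fixes V :: "'i \<Rightarrow> nat \<Rightarrow> 'a \<Rightarrow> real" and W :: "nat \<Rightarrow> 'b \<Rightarrow> real"
  assumes M: "prob_space M" and N: "prob_space N"
    and V: "\<forall>\<^sub>F i in F. \<forall>k. V i k \<in> borel_measurable M \<and> integrable M (\<lambda>\<omega>. (V i k \<omega>)\<^sup>2)"
    and W: "\<And>k. W k \<in> borel_measurable N" "\<And>k. integrable N (\<lambda>\<omega>. (W k \<omega>)\<^sup>2)"
    and conv: "\<And>n \<xi> \<theta>. ((\<lambda>i. \<integral>\<omega>. cos ((\<Sum>k<n. \<xi> k * V i k \<omega>) + \<theta>) \<partial>M) \<longlongrightarrow>
       (\<integral>\<omega>. cos ((\<Sum>k<n. \<xi> k * W k \<omega>) + \<theta>) \<partial>N)) F"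
    and sq: "\<And>k. ((\<lambda>i. \<integral>\<omega>. (V i k \<omega>)\<^sup>2 \<partial>M) \<longlongrightarrow> (\<integral>\<omega>. (W k \<omega>)\<^sup>2 \<partial>N)) F"
    and g: "\<And>a. \<bar>g a\<bar> \<le> K" "\<And>a b. \<bar>g a - g b\<bar> \<le> C * (\<Sum>k\<le>n. \<bar>a k - b k\<bar>)"
  shows "((\<lambda>i. \<integral>\<omega>. g (\<lambda>k. V i k \<omega>) \<partial>M) \<longlongrightarrow> (\<integral>\<omega>. g (\<lambda>k. W k \<omega>) \<partial>N)) F"
proof (rule tendstoI)
  fix e :: real assume e: "e > 0"
  define D where "D = max 1 C"
  have D: "D > 0" by (simp add: D_def)
  have gD: "\<bar>g a - g b\<bar> \<le> D * (\<Sum>k\<le>n. \<bar>a k - b k\<bar>)" for a b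
    using g(2)[of a b] mult_right_mono[of C D "\<Sum>k\<le>n. \<bar>a k - b k\<bar>"] by (auto simp: D_def sum_nonneg)
  have gc: "continuous_on UNIV g"
    by (rule continuous_on_finitely_many_coordinates[of g C n]) (simp add: dist_real_def g)
  then have gm: "g \<in> borel_measurable borel" by (rule borel_measurable_continuous_onI)
  define S where "S = (\<Sum>k\<le>n. \<integral>\<omega>. (W k \<omega>)\<^sup>2 \<partial>N) + 1"
  have S: "S > 0" by (auto simp: S_def intro!: add_nonneg_pos sum_nonneg)
  \<comment> \<open>This choice makes the cost \<open>D * S / (2 * R)\<close> of the sine substitution equal to \<open>e / 8\<close>.\<close>
  define R where "R = 4 * D * S / e"
  have R: "R > 0" using D S e by (simp add: R_def)
  have RS: "D * S / (2 * R) = e / 8" using D S e by (simp add: R_def)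
  have "continuous_on UNIV (\<lambda>a::nat \<Rightarrow> real. g (\<lambda>k. R * a k))"
    by (rule continuous_on_compose2[OF gc])
      (auto intro!: continuous_on_coordinatewise_then_product continuous_intros continuous_on_product_coordinates)
  from trig_poly_approximation[OF this, of "e/8" "1/R"] R e
  obtain p where p: "trig_poly p" "\<And>x. \<bar>g (\<lambda>k. R * sin (1/R * x k)) - p x\<bar> \<le> e/8"
    by (auto intro: less_imp_le)
  have Wb: "\<bar>(\<integral>\<omega>. g (\<lambda>k. W k \<omega>) \<partial>N) - (\<integral>\<omega>. p (\<lambda>k. W k \<omega>) \<partial>N)\<bar> \<le> D * S / (2 * R) + e/8"
    by (rule prob_space.expectation_sine_compression[OF N W _ gm g(1) gD _ R p])
      (use D in \<open>auto simp: S_def\<close>)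
  have "((\<lambda>i. \<Sum>k\<le>n. \<integral>\<omega>. (V i k \<omega>)\<^sup>2 \<partial>M) \<longlongrightarrow> (\<Sum>k\<le>n. \<integral>\<omega>. (W k \<omega>)\<^sup>2 \<partial>N)) F"
    by (intro tendsto_sum sq)
  then have "\<forall>\<^sub>F i in F. (\<Sum>k\<le>n. \<integral>\<omega>. (V i k \<omega>)\<^sup>2 \<partial>M) < S"
    by (rule order_tendstoD) (simp add: S_def)
  moreover have "((\<lambda>i. \<integral>\<omega>. p (\<lambda>k. V i k \<omega>) \<partial>M) \<longlongrightarrow> (\<integral>\<omega>. p (\<lambda>k. W k \<omega>) \<partial>N)) F"
    by (rule tendsto_expectation_of_trig[OF M N _ W(1) conv p(1)]) (use V in \<open>auto elim: eventually_mono\<close>)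
  then have "\<forall>\<^sub>F i in F. dist (\<integral>\<omega>. p (\<lambda>k. V i k \<omega>) \<partial>M) (\<integral>\<omega>. p (\<lambda>k. W k \<omega>) \<partial>N) < e/4"
    using e by (intro tendstoD) auto
  ultimately show "\<forall>\<^sub>F i in F. dist (\<integral>\<omega>. g (\<lambda>k. V i k \<omega>) \<partial>M) (\<integral>\<omega>. g (\<lambda>k. W k \<omega>) \<partial>N) < e"
    using V
  proof eventually_elim
    case (elim i)
    have "\<bar>(\<integral>\<omega>. g (\<lambda>k. V i k \<omega>) \<partial>M) - (\<integral>\<omega>. p (\<lambda>k. V i k \<omega>) \<partial>M)\<bar> \<le> D * S / (2 * R) + e/8"
      by (rule prob_space.expectation_sine_compression[OF M _ _ _ gm g(1) gD _ R p])
        (use D elim in auto)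
    then show ?case using Wb elim(2) e unfolding RS dist_real_def by linarith
  qed
qed

section \<open>Centered Gaussian processes\<close>

lemma gaussian_rv_cases:
  assumes M: "prob_space M" and Y: "gaussian_rv M Y" and mean: "(\<integral>\<omega>. Y \<omega> \<partial>M) = 0"
  obtains "AE \<omega> in M. Y \<omega> = 0" | s where "s > 0" "distributed M lborel Y (normal_density 0 s)"
proof -
  interpret prob_space M by (rule M)
  have meas: "Y \<in> borel_measurable M" using Y by (simp add: gaussian_rv_def)
  consider \<mu> where "AE \<omega> in M. Y \<omega> = \<mu>" | \<mu> s where "s > 0" "distributed M lborel Y (normal_density \<mu> s)"
    using Y by (auto simp: gaussian_rv_def)
  then show ?thesis
  proof cases
    case 1
    have "(\<integral>\<omega>. Y \<omega> \<partial>M) = (\<integral>\<omega>. \<mu> \<partial>M)"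
      by (rule integral_cong_AE) (use meas 1 in auto)
    then have "\<mu> = 0" using mean by (simp add: prob_space)
    then show ?thesis using 1 that(1) by simp
  next
    case 2
    have "(\<integral>x. normal_density \<mu> s x * x \<partial>lborel) = (\<integral>\<omega>. Y \<omega> \<partial>M)"
      by (rule distributed_integral[OF 2(2)]) auto
    then have "\<mu> = 0" using mean integral_normal_moment_nz_1[OF 2(1)] by simp
    then show ?thesis using 2 that(2) by simp
  qed
qed

lemma std_normal_cos_sin:
  "(\<integral>x. cos (s * x) \<partial>std_normal_distribution) = exp (- (s\<^sup>2) / 2)"
  "(\<integral>x. sin (s * x) \<partial>std_normal_distribution) = 0"
proof -
  interpret real_distribution std_normal_distribution by (rule real_dist_normal_dist)
  have int: "integrable std_normal_distribution (\<lambda>x. iexp (s * x))"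
    by (rule integrable_const_bound[of _ 1]) auto
  have eq: "(CLINT x|std_normal_distribution. iexp (s * x)) = complex_of_real (exp (- (s\<^sup>2) / 2))"
    using char_std_normal_distribution unfolding char_def by metis
  have "(\<integral>x. Re (iexp (s * x)) \<partial>std_normal_distribution) = exp (- (s\<^sup>2) / 2)"
    unfolding integral_Re[OF int] eq by simp
  then show "(\<integral>x. cos (s * x) \<partial>std_normal_distribution) = exp (- (s\<^sup>2) / 2)"
    by (simp add: Re_exp)
  have "(\<integral>x. Im (iexp (s * x)) \<partial>std_normal_distribution) = 0"
    unfolding integral_Im[OF int] eq by simp
  then show "(\<integral>x. sin (s * x) \<partial>std_normal_distribution) = 0"
    by (simp add: Im_exp)
qed

text \<open>Degenerate variables are included, because linear combinations of the values of a Gaussian process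
may vanish.\<close>

lemma gaussian_rv_moments:
  assumes M: "prob_space M" and Y: "gaussian_rv M Y" and mean: "(\<integral>\<omega>. Y \<omega> \<partial>M) = 0"
  shows gaussian_rv_integrable: "integrable M (\<lambda>\<omega>. Y \<omega> ^ (2 * q))"
    and gaussian_rv_even_moment:
      "(\<integral>\<omega>. Y \<omega> ^ (2 * q) \<partial>M) = fact (2 * q) / (2 ^ q * fact q) * (\<integral>\<omega>. (Y \<omega>)\<^sup>2 \<partial>M) ^ q"
    and gaussian_rv_cos:
      "(\<integral>\<omega>. cos (Y \<omega> + \<theta>) \<partial>M) = cos \<theta> * exp (- (\<integral>\<omega>. (Y \<omega>)\<^sup>2 \<partial>M) / 2)"
proof -
  interpret prob_space M by (rule M)
  have meas: "Y \<in> borel_measurable M" using Y by (simp add: gaussian_rv_def)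
  have "integrable M (\<lambda>\<omega>. Y \<omega> ^ (2 * q)) \<and>
    (\<integral>\<omega>. Y \<omega> ^ (2 * q) \<partial>M) = fact (2 * q) / (2 ^ q * fact q) * (\<integral>\<omega>. (Y \<omega>)\<^sup>2 \<partial>M) ^ q \<and>
    (\<integral>\<omega>. cos (Y \<omega> + \<theta>) \<partial>M) = cos \<theta> * exp (- (\<integral>\<omega>. (Y \<omega>)\<^sup>2 \<partial>M) / 2)"
  proof (cases rule: gaussian_rv_cases[OF M Y mean])
    case 1
    have *: "(\<integral>\<omega>. g (Y \<omega>) \<partial>M) = g 0" if "g \<in> borel_measurable borel" for g :: "real \<Rightarrow> real"
    proof -
      have "(\<integral>\<omega>. g (Y \<omega>) \<partial>M) = (\<integral>\<omega>. g 0 \<partial>M)"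
        by (rule integral_cong_AE) (use meas 1 that in \<open>auto elim: eventually_mono\<close>)
      then show ?thesis by (simp add: prob_space)
    qed
    have "AE \<omega> in M. norm (Y \<omega> ^ (2 * q)) \<le> 1"
      using 1 by eventually_elim (auto simp: power_0_left)
    then have "integrable M (\<lambda>\<omega>. Y \<omega> ^ (2 * q))"
      by (rule integrable_const_bound) (use meas in measurable)
    then show ?thesis
      using *[of "\<lambda>y. y ^ (2 * q)"] *[of "\<lambda>y. y\<^sup>2"] *[of "\<lambda>y. cos (y + \<theta>)"] by (cases q) auto
  next
    case (2 s)
    have mom: "integrable M (\<lambda>\<omega>. Y \<omega> ^ (2 * p)) \<and>
        (\<integral>\<omega>. Y \<omega> ^ (2 * p) \<partial>M) = fact (2 * p) / (2 ^ p * fact p) * (s\<^sup>2) ^ p" for p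
    proof -
      have hb: "has_bochner_integral lborel (\<lambda>x. normal_density 0 s x * x ^ (2 * p))
          (fact (2 * p) / ((2 / s\<^sup>2) ^ p * fact p))"
        using normal_moment_even[OF 2(1), of 0 p] by simp
      have "integrable lborel (\<lambda>x. normal_density 0 s x * x ^ (2 * p))"
        using hb by (rule integrable.intros)
      then have "integrable M (\<lambda>\<omega>. Y \<omega> ^ (2 * p))"
        by (subst (asm) distributed_integrable[OF 2(2)]) auto
      moreover have "(\<integral>x. normal_density 0 s x * x ^ (2 * p) \<partial>lborel) = (\<integral>\<omega>. Y \<omega> ^ (2 * p) \<partial>M)"
        by (rule distributed_integral[OF 2(2)]) auto
      ultimately show ?thesis
        using has_bochner_integral_integral_eq[OF hb] by (simp add: power_divide)
    qed
    have sq: "(\<integral>\<omega>. (Y \<omega>)\<^sup>2 \<partial>M) = s\<^sup>2" using mom[of 1] by simp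
    have dist: "distr M lborel (\<lambda>\<omega>. Y \<omega> / s) = std_normal_distribution"
      using 2 normal_standard_normal_convert[of s Y 0] by (simp add: distributed_distr_eq_density)
    have std: "(\<integral>\<omega>. g (Y \<omega> / s) \<partial>M) = (\<integral>x. g x \<partial>std_normal_distribution)"
      if "g \<in> borel_measurable borel" for g :: "real \<Rightarrow> real"
      unfolding dist[symmetric] by (rule integral_distr[symmetric]) (use that meas in auto)
    have "(\<integral>\<omega>. cos (Y \<omega> + \<theta>) \<partial>M) = (\<integral>\<omega>. cos \<theta> * cos (s * (Y \<omega> / s)) - sin \<theta> * sin (s * (Y \<omega> / s)) \<partial>M)"
      using 2(1) by (simp add: cos_add mult_ac)
    also have "\<dots> = cos \<theta> * (\<integral>\<omega>. cos (s * (Y \<omega> / s)) \<partial>M) - sin \<theta> * (\<integral>\<omega>. sin (s * (Y \<omega> / s)) \<partial>M)"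
    proof -
      have "integrable M (\<lambda>\<omega>. cos (s * (Y \<omega> / s)))" "integrable M (\<lambda>\<omega>. sin (s * (Y \<omega> / s)))"
        by (rule integrable_const_bound[of _ 1]; use meas in simp)+
      then show ?thesis by simp
    qed
    also have "\<dots> = cos \<theta> * exp (- (s\<^sup>2) / 2)"
      using std[of "\<lambda>x. cos (s * x)"] std[of "\<lambda>x. sin (s * x)"] by (simp add: std_normal_cos_sin)
    finally show ?thesis using mom[of q] sq by simp
  qed
  then show "integrable M (\<lambda>\<omega>. Y \<omega> ^ (2 * q))"
    "(\<integral>\<omega>. Y \<omega> ^ (2 * q) \<partial>M) = fact (2 * q) / (2 ^ q * fact q) * (\<integral>\<omega>. (Y \<omega>)\<^sup>2 \<partial>M) ^ q"
    "(\<integral>\<omega>. cos (Y \<omega> + \<theta>) \<partial>M) = cos \<theta> * exp (- (\<integral>\<omega>. (Y \<omega>)\<^sup>2 \<partial>M) / 2)" by blast+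
qed

context
  fixes M :: "'a measure" and X :: "real \<Rightarrow> 'a \<Rightarrow> real"
  assumes X: "centered_gaussian_process M X"
begin

lemma cgp_prob_space: "prob_space M"
  using X by (simp add: centered_gaussian_process_def)

lemma cgp_finite_combination:
  assumes "finite I" "I \<subseteq> {0..}"
  shows "gaussian_rv M (\<lambda>\<omega>. \<Sum>t\<in>I. a t * X t \<omega>)"
  using X assms by (simp add: centered_gaussian_process_def)

lemma cgp_gaussian:
  assumes "t \<ge> 0"
  shows "gaussian_rv M (X t)"
proof -
  have "gaussian_rv M (\<lambda>\<omega>. \<Sum>t\<in>{t}. 1 * X t \<omega>)"
    by (rule cgp_finite_combination) (use assms in auto)
  then show ?thesis by simp
qed

lemma cgp_measurable: "t \<ge> 0 \<Longrightarrow> X t \<in> borel_measurable M"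
  using cgp_gaussian by (simp add: gaussian_rv_def)

lemma cgp_mean: "t \<ge> 0 \<Longrightarrow> (\<integral>\<omega>. X t \<omega> \<partial>M) = 0"
  using X by (simp add: centered_gaussian_process_def)

lemma cgp_square_integrable: "t \<ge> 0 \<Longrightarrow> integrable M (\<lambda>\<omega>. (X t \<omega>)\<^sup>2)"
  using gaussian_rv_integrable[OF cgp_prob_space cgp_gaussian cgp_mean, of t 1] by simp

lemma cgp_integrable: "t \<ge> 0 \<Longrightarrow> integrable M (X t)"
proof -
  interpret prob_space M by (rule cgp_prob_space)
  show "t \<ge> 0 \<Longrightarrow> integrable M (X t)"
    by (rule square_integrable_imp_integrable[OF cgp_measurable cgp_square_integrable])
qed

lemma cgp_product_integrable:
  assumes "s \<ge> 0" "t \<ge> 0"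
  shows "integrable M (\<lambda>\<omega>. X s \<omega> * X t \<omega>)"
proof (rule Bochner_Integration.integrable_bound)
  show "integrable M (\<lambda>\<omega>. (X s \<omega>)\<^sup>2 + (X t \<omega>)\<^sup>2)"
    by (intro Bochner_Integration.integrable_add cgp_square_integrable assms)
  show "(\<lambda>\<omega>. X s \<omega> * X t \<omega>) \<in> borel_measurable M"
    by (intro borel_measurable_times cgp_measurable assms)
  have ab: "\<bar>a * b\<bar> \<le> a\<^sup>2 + b\<^sup>2" for a b :: real
  proof -
    have "2 * (\<bar>a\<bar> * \<bar>b\<bar>) \<le> a\<^sup>2 + b\<^sup>2" using sum_squares_bound[of "\<bar>a\<bar>" "\<bar>b\<bar>"] by simp
    moreover have "0 \<le> \<bar>a\<bar> * \<bar>b\<bar>" by simp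
    ultimately show ?thesis unfolding abs_mult by linarith
  qed
  show "AE \<omega> in M. norm (X s \<omega> * X t \<omega>) \<le> norm ((X s \<omega>)\<^sup>2 + (X t \<omega>)\<^sup>2)"
    unfolding real_norm_def by (rule AE_I2) (rule order_trans[OF ab abs_ge_self])
qed

text \<open>The definition of a Gaussian process speaks of sets of time points.  Here the time points \<open>r k\<close> may
repeat, so coefficients with the same time point are collected first.\<close>

lemma cgp_combination:
  assumes "finite A" "\<And>k. k \<in> A \<Longrightarrow> r k \<ge> 0"
  shows "gaussian_rv M (\<lambda>\<omega>. \<Sum>k\<in>A. c k * X (r k) \<omega>)"
    and "(\<integral>\<omega>. (\<Sum>k\<in>A. c k * X (r k) \<omega>) \<partial>M) = 0"
    and "(\<integral>\<omega>. (\<Sum>k\<in>A. c k * X (r k) \<omega>)\<^sup>2 \<partial>M) =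
      (\<Sum>j\<in>A. \<Sum>k\<in>A. c j * c k * (\<integral>\<omega>. X (r j) \<omega> * X (r k) \<omega> \<partial>M))"
proof -
  have "(\<Sum>k\<in>A. c k * X (r k) \<omega>) = (\<Sum>t\<in>r ` A. (\<Sum>k\<in>{k \<in> A. r k = t}. c k) * X t \<omega>)" for \<omega>
    unfolding sum.image_gen[OF assms(1), of _ r] sum_distrib_right by (intro sum.cong refl) auto
  then show "gaussian_rv M (\<lambda>\<omega>. \<Sum>k\<in>A. c k * X (r k) \<omega>)"
    using cgp_finite_combination[of "r ` A" "\<lambda>t. \<Sum>k\<in>{k \<in> A. r k = t}. c k"] assms by auto
  show "(\<integral>\<omega>. (\<Sum>k\<in>A. c k * X (r k) \<omega>) \<partial>M) = 0"
    by (subst Bochner_Integration.integral_sum) (use assms cgp_integrable cgp_mean in auto)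
  have "(\<Sum>k\<in>A. c k * X (r k) \<omega>)\<^sup>2 = (\<Sum>j\<in>A. \<Sum>k\<in>A. c j * c k * (X (r j) \<omega> * X (r k) \<omega>))" for \<omega>
    unfolding power2_eq_square sum_product by (simp add: mult_ac)
  then show "(\<integral>\<omega>. (\<Sum>k\<in>A. c k * X (r k) \<omega>)\<^sup>2 \<partial>M) =
      (\<Sum>j\<in>A. \<Sum>k\<in>A. c j * c k * (\<integral>\<omega>. X (r j) \<omega> * X (r k) \<omega> \<partial>M))"
    using assms cgp_product_integrable by (simp add: Bochner_Integration.integral_sum)
qed

lemma cgp_increment:
  assumes "s \<ge> 0" "t \<ge> 0"
  shows "gaussian_rv M (\<lambda>\<omega>. X s \<omega> - X t \<omega>)" "(\<integral>\<omega>. X s \<omega> - X t \<omega> \<partial>M) = 0"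
    "(\<integral>\<omega>. (X s \<omega> - X t \<omega>)\<^sup>2 \<partial>M) = (\<integral>\<omega>. (X s \<omega>)\<^sup>2 \<partial>M) + (\<integral>\<omega>. (X t \<omega>)\<^sup>2 \<partial>M) - 2 * (\<integral>\<omega>. X s \<omega> * X t \<omega> \<partial>M)"
proof -
  \<comment> \<open>The type \<open>bool\<close> serves as index set with two elements, which allows \<open>s = t\<close>.\<close>
  have eq: "(\<Sum>k::bool\<in>UNIV. (if k then 1 else -1) * X (if k then s else t) \<omega>) = X s \<omega> - X t \<omega>" for \<omega>
    by (simp add: UNIV_bool)
  show "gaussian_rv M (\<lambda>\<omega>. X s \<omega> - X t \<omega>)"
    using cgp_combination(1)[of UNIV "\<lambda>k. if k then s else t" "\<lambda>k. if k then 1 else -1"] assms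
    unfolding eq by simp
  show "(\<integral>\<omega>. X s \<omega> - X t \<omega> \<partial>M) = 0" using assms by (simp add: cgp_integrable cgp_mean)
  have "(\<integral>\<omega>. (X s \<omega> - X t \<omega>)\<^sup>2 \<partial>M) = (\<integral>\<omega>. (X s \<omega>)\<^sup>2 + (X t \<omega>)\<^sup>2 - 2 * (X s \<omega> * X t \<omega>) \<partial>M)"
    by (simp add: power2_diff mult.assoc)
  also have "\<dots> = (\<integral>\<omega>. (X s \<omega>)\<^sup>2 \<partial>M) + (\<integral>\<omega>. (X t \<omega>)\<^sup>2 \<partial>M) - 2 * (\<integral>\<omega>. X s \<omega> * X t \<omega> \<partial>M)"
    using assms cgp_product_integrable[of s t] by (simp add: cgp_square_integrable)
  finally show "(\<integral>\<omega>. (X s \<omega> - X t \<omega>)\<^sup>2 \<partial>M) = (\<integral>\<omega>. (X s \<omega>)\<^sup>2 \<partial>M) + (\<integral>\<omega>. (X t \<omega>)\<^sup>2 \<partial>M) - 2 * (\<integral>\<omega>. X s \<omega> * X t \<omega> \<partial>M)" .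
qed

lemma cgp_cos:
  assumes "finite A" "\<And>k. k \<in> A \<Longrightarrow> r k \<ge> 0"
  shows "(\<integral>\<omega>. cos ((\<Sum>k\<in>A. c k * X (r k) \<omega>) + \<theta>) \<partial>M) =
    cos \<theta> * exp (- (\<Sum>j\<in>A. \<Sum>k\<in>A. c j * c k * (\<integral>\<omega>. X (r j) \<omega> * X (r k) \<omega> \<partial>M)) / 2)"
  using gaussian_rv_cos[OF cgp_prob_space cgp_combination(1,2)[OF assms]] cgp_combination(3)[OF assms]
  by simp

end

text \<open>The trigonometric expectations of finitely many coordinates are continuous functions of the
covariance matrix, including where that matrix is singular.\<close>

lemma tendsto_expectation_gaussian_process:
  fixes r :: "nat \<Rightarrow> real"
  assumes M: "prob_space M" and Z: "\<forall>\<^sub>F i in F. centered_gaussian_process M (Z i)"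
    and Y: "centered_gaussian_process N Y"
    and cov: "\<And>s t. s \<ge> 0 \<Longrightarrow> t \<ge> 0 \<Longrightarrow>
      ((\<lambda>i. \<integral>\<omega>. Z i s \<omega> * Z i t \<omega> \<partial>M) \<longlongrightarrow> (\<integral>\<omega>. Y s \<omega> * Y t \<omega> \<partial>N)) F"
    and r: "\<And>k. r k \<ge> 0"
    and g: "\<And>a. \<bar>g a\<bar> \<le> K" "\<And>a b. \<bar>g a - g b\<bar> \<le> C * (\<Sum>k\<le>n. \<bar>a k - b k\<bar>)"
  shows "((\<lambda>i. \<integral>\<omega>. g (\<lambda>k. Z i (r k) \<omega>) \<partial>M) \<longlongrightarrow> (\<integral>\<omega>. g (\<lambda>k. Y (r k) \<omega>) \<partial>N)) F"
proof (rule tendsto_expectation_of_characteristic[where V="\<lambda>i k. Z i (r k)" and W="\<lambda>k. Y (r k)",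
      OF M cgp_prob_space[OF Y] _ _ _ _ _ g])
  show "\<forall>\<^sub>F i in F. \<forall>k. Z i (r k) \<in> borel_measurable M \<and> integrable M (\<lambda>\<omega>. (Z i (r k) \<omega>)\<^sup>2)"
    using Z by eventually_elim (use r in \<open>auto intro: cgp_measurable cgp_square_integrable\<close>)
  show "Y (r k) \<in> borel_measurable N" "integrable N (\<lambda>\<omega>. (Y (r k) \<omega>)\<^sup>2)" for k
    using r by (auto intro: cgp_measurable[OF Y] cgp_square_integrable[OF Y])
  show "((\<lambda>i. \<integral>\<omega>. (Z i (r k) \<omega>)\<^sup>2 \<partial>M) \<longlongrightarrow> (\<integral>\<omega>. (Y (r k) \<omega>)\<^sup>2 \<partial>N)) F" for k
    using cov[OF r r, of k k] by (simp add: power2_eq_square)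
  fix m :: nat and \<xi> :: "nat \<Rightarrow> real" and \<theta> :: real
  let ?\<phi> = "\<lambda>K. cos \<theta> * exp (- (\<Sum>j<m. \<Sum>k<m. \<xi> j * \<xi> k * K (r j) (r k)) / 2)"
  have "((\<lambda>i. ?\<phi> (\<lambda>s t. \<integral>\<omega>. Z i s \<omega> * Z i t \<omega> \<partial>M)) \<longlongrightarrow> ?\<phi> (\<lambda>s t. \<integral>\<omega>. Y s \<omega> * Y t \<omega> \<partial>N)) F"
    by (intro tendsto_mult tendsto_exp tendsto_divide tendsto_minus tendsto_sum tendsto_const cov r) simp
  also have "?\<phi> (\<lambda>s t. \<integral>\<omega>. Y s \<omega> * Y t \<omega> \<partial>N) = (\<integral>\<omega>. cos ((\<Sum>k<m. \<xi> k * Y (r k) \<omega>) + \<theta>) \<partial>N)"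
    by (rule cgp_cos[OF Y, symmetric]) (use r in auto)
  finally show "((\<lambda>i. \<integral>\<omega>. cos ((\<Sum>k<m. \<xi> k * Z i (r k) \<omega>) + \<theta>) \<partial>M) \<longlongrightarrow>
      (\<integral>\<omega>. cos ((\<Sum>k<m. \<xi> k * Y (r k) \<omega>) + \<theta>) \<partial>N)) F"
  proof (rule Lim_transform_eventually)
    show "\<forall>\<^sub>F i in F. ?\<phi> (\<lambda>s t. \<integral>\<omega>. Z i s \<omega> * Z i t \<omega> \<partial>M) =
        (\<integral>\<omega>. cos ((\<Sum>k<m. \<xi> k * Z i (r k) \<omega>) + \<theta>) \<partial>M)"
      using Z
    proof eventually_elim
      case (elim i)
      show ?case by (rule cgp_cos[OF elim, symmetric]) (use r in auto)
    qed
  qed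
qed

section \<open>Chaining and weak convergence of Gaussian processes\<close>

text \<open>The chain runs through the dyadic successors \<open>(\<lfloor>2 ^ m * t\<rfloor> + 1) / 2 ^ m\<close>, which decrease to \<open>t\<close>.  From
below a cadlag path would lead to its left limit instead of its value.  Two consecutive
successors are equal or neighbours on the finer grid.\<close>

lemma dyadic_chaining_aux:
  fixes z :: "real \<Rightarrow> real"
  assumes step: "\<And>m j. m \<ge> n \<Longrightarrow> j < k * 2 ^ m \<Longrightarrow> \<bar>z (real (Suc j) / 2 ^ m) - z (real j / 2 ^ m)\<bar> \<le> b m"
    and b: "\<And>m. m \<ge> n \<Longrightarrow> b m \<ge> 0" and t: "0 \<le> t" "t < real k"
  shows "\<bar>z (real (Suc (nat \<lfloor>2 ^ (n + i) * t\<rfloor>)) / 2 ^ (n + i)) - z (dyadic_floor n t)\<bar> \<le> (\<Sum>l<Suc i. b (n + l))"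
proof -
  define a where "a m = nat \<lfloor>2 ^ m * t\<rfloor>" for m
  have a: "real (a m) \<le> 2 ^ m * t" "2 ^ m * t < real (a m) + 1" for m
    using t by (auto simp: a_def)
  have lt: "a m < k * 2 ^ m" for m
  proof -
    have "real (a m) < real k * 2 ^ m" using a(1)[of m] t(2) by (smt (verit) mult.commute mult_strict_left_mono zero_less_power)
    then show ?thesis by (metis of_nat_less_iff of_nat_mult of_nat_numeral of_nat_power)
  qed
  have dy: "dyadic_floor n t = real (a n) / 2 ^ n" using t by (simp add: dyadic_floor_def a_def)
  have "\<bar>z (real (Suc (a (n + i))) / 2 ^ (n + i)) - z (real (a n) / 2 ^ n)\<bar> \<le> (\<Sum>l<Suc i. b (n + l))"
  proof (induction i)
    case 0
    show ?case using step[of n "a n"] lt by simp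
  next
    case (Suc i)
    define m where "m = n + i"
    have "2 * real (a m) \<le> 2 * (2 ^ m * t)" "2 * (2 ^ m * t) < 2 * real (a m) + 2" using a[of m] by auto
    then have "real (2 * a m) < real (a (Suc m) + 1)" "real (a (Suc m)) < real (2 * a m + 2)"
      using a[of "Suc m"] by (auto simp: mult.assoc)
    then have "2 * a m < a (Suc m) + 1" "a (Suc m) < 2 * a m + 2" by (simp_all only: of_nat_less_iff)
    then have cases: "a (Suc m) = 2 * a m \<or> a (Suc m) = 2 * a m + 1" by linarith
    have "\<bar>z (real (Suc (a m)) / 2 ^ m) - z (real (Suc (a (Suc m))) / 2 ^ Suc m)\<bar> \<le> b (Suc m)"
    proof (cases "a (Suc m) = 2 * a m")
      case True
      have "2 * a m + 1 < k * 2 ^ Suc m" using lt[of m] by simp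
      then have "\<bar>z (real (Suc (2 * a m + 1)) / 2 ^ Suc m) - z (real (2 * a m + 1) / 2 ^ Suc m)\<bar> \<le> b (Suc m)"
        by (intro step) (auto simp: m_def)
      moreover have "real (Suc (2 * a m + 1)) / 2 ^ Suc m = real (Suc (a m)) / 2 ^ m" by (simp add: field_simps)
      ultimately show ?thesis using True by simp
    next
      case False
      then have "a (Suc m) = 2 * a m + 1" using cases by simp
      then have "real (Suc (a (Suc m))) / 2 ^ Suc m = real (Suc (a m)) / 2 ^ m" by (simp add: field_simps)
      then show ?thesis using b[of "Suc m"] by (simp add: m_def)
    qed
    then show ?case using Suc.IH by (simp add: m_def)
  qed
  then show ?thesis by (simp add: dy a_def)
qed

lemma dyadic_chaining:
  fixes z :: "real \<Rightarrow> real"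
  assumes right: "\<And>t. t \<ge> 0 \<Longrightarrow> (z \<longlongrightarrow> z t) (at_right t)"
    and step: "\<And>m j. m \<ge> n \<Longrightarrow> j < k * 2 ^ m \<Longrightarrow> \<bar>z (real (Suc j) / 2 ^ m) - z (real j / 2 ^ m)\<bar> \<le> b m"
    and b: "\<And>m. m \<ge> n \<Longrightarrow> b m \<ge> 0" and sum: "summable (\<lambda>i. b (n + i))" and t: "0 \<le> t" "t \<le> real k"
  shows "\<bar>z t - z (dyadic_floor n t)\<bar> \<le> (\<Sum>i. b (n + i))"
proof (cases "t = real k")
  case True
  then show ?thesis using suminf_nonneg[OF sum] b by simp
next
  case False
  then have tk: "t < real k" using t by simp
  define u where "u i = real (Suc (nat \<lfloor>2 ^ (n + i) * t\<rfloor>)) / 2 ^ (n + i)" for i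
  have u: "t < u i" "u i \<le> t + (1/2) ^ i" for i
  proof -
    have "2 ^ (n + i) * t < real (Suc (nat \<lfloor>2 ^ (n + i) * t\<rfloor>))" using t by simp linarith
    then show "t < u i" by (simp add: u_def field_simps)
    have "real (Suc (nat \<lfloor>2 ^ (n + i) * t\<rfloor>)) \<le> 2 ^ (n + i) * t + 1" using t by simp
    then have "u i \<le> t + 1 / 2 ^ (n + i)" by (simp add: u_def field_simps)
    also have "\<dots> \<le> t + (1/2) ^ i" by (simp add: power_one_over power_increasing frac_le)
    finally show "u i \<le> t + (1/2) ^ i" .
  qed
  have "(\<lambda>i. t + (1/2) ^ i) \<longlonglongrightarrow> t + 0" by (intro tendsto_intros LIMSEQ_power_zero) simp
  then have "u \<longlonglongrightarrow> t"
    using tendsto_sandwich[OF always_eventually[of "\<lambda>i. t \<le> u i"] always_eventually[of "\<lambda>i. u i \<le> t + (1/2) ^ i"] tendsto_const]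
      u less_imp_le[OF u(1)] by simp
  then have "filterlim u (at_right t) sequentially"
    by (rule tendsto_imp_filterlim_at_right) (use u in auto)
  then have "(\<lambda>i. z (u i)) \<longlonglongrightarrow> z t" by (rule filterlim_compose[OF right[OF t(1)]])
  then have lim: "(\<lambda>i. \<bar>z (u i) - z (dyadic_floor n t)\<bar>) \<longlonglongrightarrow> \<bar>z t - z (dyadic_floor n t)\<bar>"
    by (intro tendsto_intros)
  show ?thesis
  proof (rule LIMSEQ_le_const2[OF lim], intro exI allI impI)
    fix i
    have "\<bar>z (u i) - z (dyadic_floor n t)\<bar> \<le> (\<Sum>l<Suc i. b (n + l))"
      unfolding u_def by (rule dyadic_chaining_aux[OF step b t(1) tk])
    also have "\<dots> \<le> (\<Sum>i. b (n + i))" using sum b by (intro sum_le_suminf) auto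
    finally show "\<bar>z (u i) - z (dyadic_floor n t)\<bar> \<le> (\<Sum>i. b (n + i))" .
  qed
qed

text \<open>This bounds a maximum of increments by a deterministic threshold plus a sum of high powers, which
has a computable expectation.\<close>

lemma abs_le_threshold_plus_power:
  fixes a d :: real
  assumes "a > 0" "q \<ge> 1"
  shows "\<bar>d\<bar> \<le> a + d ^ (2 * q) / a ^ (2 * q - 1)"
proof (cases "\<bar>d\<bar> \<le> a")
  case True
  have "0 \<le> d ^ (2 * q) / a ^ (2 * q - 1)" using assms by simp
  then show ?thesis using True by linarith
next
  case False
  have "\<bar>d\<bar> * a ^ (2 * q - 1) \<le> \<bar>d\<bar> * \<bar>d\<bar> ^ (2 * q - 1)"
    using False assms by (intro mult_left_mono power_mono) auto
  also have "\<dots> = \<bar>d\<bar> ^ Suc (2 * q - 1)" by simp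
  also have "Suc (2 * q - 1) = 2 * q" using assms by simp
  also have "\<bar>d\<bar> ^ (2 * q) = d ^ (2 * q)" by (simp add: power_even_abs)
  finally have "\<bar>d\<bar> \<le> d ^ (2 * q) / a ^ (2 * q - 1)" using assms by (simp add: field_simps)
  then show ?thesis using assms by simp
qed

text \<open>Kolmogorov's chaining bound.  At level \<open>m\<close> there are \<open>k * 2 ^ m\<close> increments, each with moment of order
\<open>2 * q\<close> at most \<open>C * 2 powr (- m * (1 + \<beta>))\<close>.  With the threshold \<open>\<rho> ^ m\<close> the choice
\<open>\<rho> ^ (2 * q) = 2 powr (- \<beta>)\<close> makes both contributions of level \<open>m\<close> multiples of \<open>\<rho> ^ m\<close>, and
the levels from \<open>n\<close> on form a geometric series.  The error is stated for \<open>f\<close> instead of the distance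
of the two random paths: measurability of that distance would need separability of the
Skorohod space.\<close>

lemma (in prob_space) expectation_discretization_error:
  fixes f :: "skorohod \<Rightarrow> real" and L K :: real and X :: "real \<Rightarrow> 'a \<Rightarrow> real" and k n q :: nat and \<beta> C :: real
  assumes meas: "\<And>t. t \<ge> 0 \<Longrightarrow> X t \<in> borel_measurable M"
    and cad: "\<And>\<omega>. \<omega> \<in> space M \<Longrightarrow> cadlag (\<lambda>t. X t \<omega>)"
    and q: "q \<ge> 1" and \<beta>: "\<beta> > 0" and C: "C \<ge> 0"
    and int: "\<And>s t. s \<in> {0..real k} \<Longrightarrow> t \<in> {0..real k} \<Longrightarrow> integrable M (\<lambda>\<omega>. (X s \<omega> - X t \<omega>) ^ (2 * q))"
    and mom: "\<And>s t. s \<in> {0..real k} \<Longrightarrow> t \<in> {0..real k} \<Longrightarrow>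
      (\<integral>\<omega>. (X s \<omega> - X t \<omega>) ^ (2 * q) \<partial>M) \<le> C * \<bar>s - t\<bar> powr (1 + \<beta>)"
    and kn: "k \<le> n"
    and L: "L > 0" and lip: "\<And>x y. \<bar>f x - f y\<bar> \<le> L * dist x y" and K: "\<And>x. \<bar>f x\<bar> \<le> K"
  defines "\<rho> \<equiv> 2 powr (- \<beta> / (2 * q))"
  shows "\<bar>(\<integral>\<omega>. f (to_D (\<lambda>t. X t \<omega>)) \<partial>M) - (\<integral>\<omega>. f (discretize n (\<lambda>t. X t \<omega>)) \<partial>M)\<bar>
    \<le> L * ((1/2) ^ k + (1 + real k * C) * \<rho> ^ n / (1 - \<rho>))"
proof -
  have \<rho>: "0 < \<rho>" "\<rho> < 1" using \<beta> q by (auto simp: \<rho>_def powr_less_one)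
  have \<rho>q: "\<rho> ^ (2 * q) = 2 powr (- \<beta>)"
  proof -
    have "\<rho> ^ (2 * q) = 2 powr (- \<beta> / (2 * q) * real (2 * q))"
      unfolding \<rho>_def by (simp add: powr_powr flip: powr_realpow)
    then show ?thesis using q by simp
  qed
  define \<Delta> where "\<Delta> m j \<omega> = X (real (Suc j) / 2 ^ m) \<omega> - X (real j / 2 ^ m) \<omega>" for m j \<omega>
  \<comment> \<open>A common bound for all increments of level \<open>m\<close>.\<close>
  define b where "b m \<omega> = \<rho> ^ m + (\<Sum>j<k * 2 ^ m. \<Delta> m j \<omega> ^ (2 * q)) / (\<rho> ^ m) ^ (2 * q - 1)" for m \<omega>
  have grid: "real j / 2 ^ m \<in> {0..real k}" if "j \<le> k * 2 ^ m" for j m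
  proof -
    have "real j \<le> real (k * 2 ^ m)" using that by (simp only: of_nat_le_iff)
    then show ?thesis by (simp add: field_simps)
  qed
  have b0: "b m \<omega> \<ge> 0" for m \<omega> using \<rho> by (auto simp: b_def intro!: add_nonneg_nonneg sum_nonneg divide_nonneg_nonneg)
  have \<Delta>b: "\<bar>\<Delta> m j \<omega>\<bar> \<le> b m \<omega>" if "j < k * 2 ^ m" for m j \<omega>
  proof -
    have "\<bar>\<Delta> m j \<omega>\<bar> \<le> \<rho> ^ m + \<Delta> m j \<omega> ^ (2 * q) / (\<rho> ^ m) ^ (2 * q - 1)"
      using \<rho> q by (intro abs_le_threshold_plus_power) auto
    also have "\<Delta> m j \<omega> ^ (2 * q) \<le> (\<Sum>j<k * 2 ^ m. \<Delta> m j \<omega> ^ (2 * q))"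
      by (rule member_le_sum) (use that in auto)
    finally show ?thesis using \<rho> unfolding b_def by (simp add: divide_right_mono)
  qed
  have \<Delta>int: "integrable M (\<lambda>\<omega>. \<Delta> m j \<omega> ^ (2 * q))" if "j < k * 2 ^ m" for m j
    unfolding \<Delta>_def using that by (intro int grid) auto
  have \<Delta>mom: "(\<integral>\<omega>. \<Delta> m j \<omega> ^ (2 * q) \<partial>M) \<le> C * (2 powr - real m) powr (1 + \<beta>)" if "j < k * 2 ^ m" for m j
  proof -
    have "(\<integral>\<omega>. \<Delta> m j \<omega> ^ (2 * q) \<partial>M) \<le> C * \<bar>real (Suc j) / 2 ^ m - real j / 2 ^ m\<bar> powr (1 + \<beta>)"
      unfolding \<Delta>_def using that by (intro mom grid) auto
    also have "real (Suc j) / 2 ^ m - real j / 2 ^ m = 1 / 2 ^ m" by (simp flip: diff_divide_distrib)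
    also have "\<bar>1 / 2 ^ m :: real\<bar> = 2 powr - real m" by (simp add: powr_minus powr_realpow divide_inverse)
    finally show ?thesis .
  qed
  have bint: "integrable M (b m)" for m
    unfolding b_def using \<Delta>int by (intro Bochner_Integration.integrable_add integrable_divide_zero Bochner_Integration.integrable_sum) auto
  have bm: "b m \<in> borel_measurable M" for m using bint by (rule borel_measurable_integrable)
  have bexp: "(\<integral>\<omega>. b m \<omega> \<partial>M) \<le> (1 + real k * C) * \<rho> ^ m" for m
  proof -
    have "(\<integral>\<omega>. b m \<omega> \<partial>M) = \<rho> ^ m + (\<Sum>j<k * 2 ^ m. \<integral>\<omega>. \<Delta> m j \<omega> ^ (2 * q) \<partial>M) / (\<rho> ^ m) ^ (2 * q - 1)"
    proof -
      have "integrable M (\<lambda>\<omega>. (\<Sum>j<k * 2 ^ m. \<Delta> m j \<omega> ^ (2 * q)) / (\<rho> ^ m) ^ (2 * q - 1))"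
        using \<Delta>int by (intro integrable_divide_zero Bochner_Integration.integrable_sum) auto
      then have "(\<integral>\<omega>. b m \<omega> \<partial>M) =
          \<rho> ^ m + (\<integral>\<omega>. (\<Sum>j<k * 2 ^ m. \<Delta> m j \<omega> ^ (2 * q)) / (\<rho> ^ m) ^ (2 * q - 1) \<partial>M)"
        unfolding b_def by (subst Bochner_Integration.integral_add) (auto simp: prob_space)
      also have "(\<integral>\<omega>. (\<Sum>j<k * 2 ^ m. \<Delta> m j \<omega> ^ (2 * q)) / (\<rho> ^ m) ^ (2 * q - 1) \<partial>M)
          = (\<integral>\<omega>. (\<Sum>j<k * 2 ^ m. \<Delta> m j \<omega> ^ (2 * q)) \<partial>M) / (\<rho> ^ m) ^ (2 * q - 1)"
        by (rule integral_divide_zero)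
      also have "(\<integral>\<omega>. (\<Sum>j<k * 2 ^ m. \<Delta> m j \<omega> ^ (2 * q)) \<partial>M) = (\<Sum>j<k * 2 ^ m. \<integral>\<omega>. \<Delta> m j \<omega> ^ (2 * q) \<partial>M)"
        by (rule Bochner_Integration.integral_sum) (use \<Delta>int in auto)
      finally show ?thesis .
    qed
    also have "\<dots> \<le> \<rho> ^ m + (\<Sum>j<k * 2 ^ m. C * (2 powr - real m) powr (1 + \<beta>)) / (\<rho> ^ m) ^ (2 * q - 1)"
      using \<rho> \<Delta>mom by (intro add_left_mono divide_right_mono sum_mono) auto
    also have "(\<Sum>j<k * 2 ^ m. C * (2 powr - real m) powr (1 + \<beta>)) = real k * C * (2 ^ m * (2 powr - real m) powr (1 + \<beta>))"
      by simp
    also have "2 ^ m * (2 powr - real m) powr (1 + \<beta>) = (2 powr (- \<beta>)) ^ m"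
    proof -
      have "2 ^ m * (2 powr - real m) powr (1 + \<beta>) = 2 powr real m * 2 powr (- real m * (1 + \<beta>))"
        by (simp add: powr_powr powr_realpow)
      also have "\<dots> = 2 powr (- \<beta> * real m)" by (simp add: algebra_simps flip: powr_add)
      also have "\<dots> = (2 powr (- \<beta>)) ^ m" by (simp add: powr_powr flip: powr_realpow)
      finally show ?thesis .
    qed
    also have "(2 powr (- \<beta>)) ^ m = \<rho> ^ m * (\<rho> ^ m) ^ (2 * q - 1)"
    proof -
      have "\<rho> ^ m * (\<rho> ^ m) ^ (2 * q - 1) = (\<rho> ^ m) ^ Suc (2 * q - 1)" by simp
      also have "Suc (2 * q - 1) = 2 * q" using q by simp
      also have "(\<rho> ^ m) ^ (2 * q) = (\<rho> ^ (2 * q)) ^ m" by (simp add: mult.commute flip: power_mult)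
      finally show ?thesis using \<rho>q by simp
    qed
    finally show ?thesis using \<rho> by (simp add: algebra_simps)
  qed
  let ?d = "\<lambda>\<omega>. dist (to_D (\<lambda>t. X t \<omega>)) (discretize n (\<lambda>t. X t \<omega>))"
  have dist: "ennreal (?d \<omega>) \<le> ennreal ((1/2) ^ k) + (\<Sum>i. ennreal (b (n + i) \<omega>))" if \<omega>: "\<omega> \<in> space M" for \<omega>
  proof (cases "(\<Sum>i. ennreal (b (n + i) \<omega>)) = \<top>")
    case True then show ?thesis by simp
  next
    case False
    then have sum: "summable (\<lambda>i. b (n + i) \<omega>)" using b0 by (intro summable_suminf_not_top) auto
    have "?d \<omega> \<le> (\<Sum>i. b (n + i) \<omega>) + (1/2) ^ k"
    proof (rule dist_skorohod_le_uniform)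
      show "(\<Sum>i. b (n + i) \<omega>) \<ge> 0" by (intro suminf_nonneg sum b0)
      fix t assume t: "0 \<le> t" "t \<le> real k"
      have "D_path (to_D (\<lambda>t. X t \<omega>)) t = X t \<omega>" using path_to_D[OF cad[OF \<omega>] t(1)] .
      moreover have "D_path (discretize n (\<lambda>t. X t \<omega>)) t = X (dyadic_floor n t) \<omega>"
        using t kn by (intro path_discretize) auto
      moreover have "\<bar>X t \<omega> - X (dyadic_floor n t) \<omega>\<bar> \<le> (\<Sum>i. b (n + i) \<omega>)"
        using dyadic_chaining[of "\<lambda>t. X t \<omega>" n k "\<lambda>m. b m \<omega>" t, OF _ _ b0 sum t] cad[OF \<omega>] \<Delta>b
        by (auto simp: cadlag_def \<Delta>_def)
      ultimately show "\<bar>D_path (to_D (\<lambda>t. X t \<omega>)) t - D_path (discretize n (\<lambda>t. X t \<omega>)) t\<bar> \<le> (\<Sum>i. b (n + i) \<omega>)"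
        by simp
    qed
    then have "ennreal (?d \<omega>) \<le> ennreal ((1/2) ^ k + (\<Sum>i. b (n + i) \<omega>))"
      by (intro ennreal_leI) linarith
    also have "\<dots> = ennreal ((1/2) ^ k) + ennreal (\<Sum>i. b (n + i) \<omega>)"
      by (intro ennreal_plus suminf_nonneg sum b0) simp
    also have "ennreal (\<Sum>i. b (n + i) \<omega>) = (\<Sum>i. ennreal (b (n + i) \<omega>))"
      by (rule suminf_ennreal2[symmetric, OF b0 sum])
    finally show ?thesis .
  qed
  let ?e = "\<lambda>\<omega>. f (to_D (\<lambda>t. X t \<omega>)) - f (discretize n (\<lambda>t. X t \<omega>))"
  have fm: "f \<in> borel_measurable borel" by (rule borel_measurable_lipschitz[OF lip])
  have fi: "integrable M (\<lambda>\<omega>. f (to_D (\<lambda>t. X t \<omega>)))"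
    by (rule integrable_bounded_comp[OF measurable_to_D[OF meas cad] fm K])
  have fi': "integrable M (\<lambda>\<omega>. f (discretize n (\<lambda>t. X t \<omega>)))"
    by (rule integrable_bounded_comp[OF measurable_discretize[OF meas] fm K])
  \<comment> \<open>The integrals are taken in the extended reals, since the series may diverge for some \<open>\<omega>\<close>.\<close>
  have err: "ennreal \<bar>?e \<omega>\<bar> \<le> ennreal L * (ennreal ((1/2) ^ k) + (\<Sum>i. ennreal (b (n + i) \<omega>)))" if "\<omega> \<in> space M" for \<omega>
  proof -
    have "ennreal \<bar>?e \<omega>\<bar> \<le> ennreal (L * ?d \<omega>)" by (intro ennreal_leI lip)
    also have "\<dots> = ennreal L * ennreal (?d \<omega>)" using L by (intro ennreal_mult) auto
    also have "\<dots> \<le> ennreal L * (ennreal ((1/2) ^ k) + (\<Sum>i. ennreal (b (n + i) \<omega>)))"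
      by (intro mult_left_mono dist that) simp
    finally show ?thesis .
  qed
  have geo: "(\<lambda>i. (1 + real k * C) * \<rho> ^ (n + i)) sums ((1 + real k * C) * \<rho> ^ n / (1 - \<rho>))"
    using sums_mult[OF geometric_sums[of \<rho>], of "(1 + real k * C) * \<rho> ^ n"] \<rho>
    by (simp add: power_add mult_ac)
  have "(\<integral>\<^sup>+\<omega>. (\<Sum>i. ennreal (b (n + i) \<omega>)) \<partial>M) = (\<Sum>i. \<integral>\<^sup>+\<omega>. ennreal (b (n + i) \<omega>) \<partial>M)"
    using bint by (intro nn_integral_suminf measurable_compose[OF _ measurable_ennreal]) auto
  also have "\<dots> = (\<Sum>i. ennreal (\<integral>\<omega>. b (n + i) \<omega> \<partial>M))"
    by (intro suminf_cong nn_integral_eq_integral bint) (simp add: b0)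
  also have "\<dots> \<le> (\<Sum>i. ennreal ((1 + real k * C) * \<rho> ^ (n + i)))"
    by (intro suminf_le ennreal_leI bexp) auto
  also have "\<dots> = ennreal (\<Sum>i. (1 + real k * C) * \<rho> ^ (n + i))"
    using \<rho>(1) C by (intro suminf_ennreal2[OF _ sums_summable[OF geo]] mult_nonneg_nonneg) auto
  also have "(\<Sum>i. (1 + real k * C) * \<rho> ^ (n + i)) = (1 + real k * C) * \<rho> ^ n / (1 - \<rho>)"
    by (rule sums_unique[OF geo, symmetric])
  finally have tail: "(\<integral>\<^sup>+\<omega>. (\<Sum>i. ennreal (b (n + i) \<omega>)) \<partial>M) \<le> ennreal ((1 + real k * C) * \<rho> ^ n / (1 - \<rho>))" .
  have "ennreal \<bar>\<integral>\<omega>. ?e \<omega> \<partial>M\<bar> \<le> ennreal (\<integral>\<omega>. \<bar>?e \<omega>\<bar> \<partial>M)"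
    by (intro ennreal_leI integral_abs_bound)
  also have "\<dots> = (\<integral>\<^sup>+\<omega>. ennreal \<bar>?e \<omega>\<bar> \<partial>M)"
    by (rule nn_integral_eq_integral[symmetric, OF integrable_abs[OF Bochner_Integration.integrable_diff[OF fi fi']]]) simp
  also have "\<dots> \<le> (\<integral>\<^sup>+\<omega>. ennreal L * (ennreal ((1/2) ^ k) + (\<Sum>i. ennreal (b (n + i) \<omega>))) \<partial>M)"
    by (rule nn_integral_mono) (rule err)
  also have "\<dots> = ennreal L * (\<integral>\<^sup>+\<omega>. ennreal ((1/2) ^ k) + (\<Sum>i. ennreal (b (n + i) \<omega>)) \<partial>M)"
    by (rule nn_integral_cmult) (use bm in measurable)
  also have "(\<integral>\<^sup>+\<omega>. ennreal ((1/2) ^ k) + (\<Sum>i. ennreal (b (n + i) \<omega>)) \<partial>M)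
      = (\<integral>\<^sup>+\<omega>. ennreal ((1/2) ^ k) \<partial>M) + (\<integral>\<^sup>+\<omega>. (\<Sum>i. ennreal (b (n + i) \<omega>)) \<partial>M)"
    by (rule nn_integral_add) (use bm in measurable)
  also have "ennreal L * ((\<integral>\<^sup>+\<omega>. ennreal ((1/2) ^ k) \<partial>M) + (\<integral>\<^sup>+\<omega>. (\<Sum>i. ennreal (b (n + i) \<omega>)) \<partial>M))
      \<le> ennreal L * (ennreal ((1/2) ^ k) + ennreal ((1 + real k * C) * \<rho> ^ n / (1 - \<rho>)))"
    by (intro mult_left_mono add_mono tail) (simp_all add: emeasure_space_1)
  also have "\<dots> = ennreal L * ennreal ((1/2) ^ k + (1 + real k * C) * \<rho> ^ n / (1 - \<rho>))"
    using \<rho> C by (subst ennreal_plus) auto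
  also have "\<dots> = ennreal (L * ((1/2) ^ k + (1 + real k * C) * \<rho> ^ n / (1 - \<rho>)))"
    using \<rho> C L by (intro ennreal_mult[symmetric] add_nonneg_nonneg divide_nonneg_nonneg mult_nonneg_nonneg) auto
  finally have "\<bar>\<integral>\<omega>. ?e \<omega> \<partial>M\<bar> \<le> L * ((1/2) ^ k + (1 + real k * C) * \<rho> ^ n / (1 - \<rho>))"
    using \<rho> C L by (subst (asm) ennreal_le_iff) auto
  then show ?thesis using fi fi' by simp
qed

text \<open>Gaussian moments turn the bound on mean squares into a bound on moments of order \<open>2 * q\<close> with
exponent \<open>\<alpha> * q\<close>, which exceeds \<open>1\<close> for large \<open>q\<close>; so every positive \<open>\<alpha>\<close> is good enough for chaining.\<close>

theorem gaussian_process_converges_weakly: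
  fixes Z :: "'i \<Rightarrow> real \<Rightarrow> 'a \<Rightarrow> real" and Y :: "real \<Rightarrow> 'b \<Rightarrow> real" and \<alpha> :: real
  assumes M: "prob_space M" and Z: "\<forall>\<^sub>F i in F. centered_gaussian_process M (Z i)"
    and Zc: "\<forall>\<^sub>F i in F. \<forall>\<omega>\<in>space M. cadlag (\<lambda>t. Z i t \<omega>)"
    and Y: "centered_gaussian_process N Y" and Yc: "\<And>\<omega>. \<omega> \<in> space N \<Longrightarrow> cadlag (\<lambda>t. Y t \<omega>)"
    and cov: "\<And>s t. s \<ge> 0 \<Longrightarrow> t \<ge> 0 \<Longrightarrow>
      ((\<lambda>i. \<integral>\<omega>. Z i s \<omega> * Z i t \<omega> \<partial>M) \<longlongrightarrow> (\<integral>\<omega>. Y s \<omega> * Y t \<omega> \<partial>N)) F"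
    and \<alpha>: "\<alpha> > 0"
    and tight: "\<And>k::nat. \<exists>C. \<forall>\<^sub>F i in F. \<forall>s\<in>{0..real k}. \<forall>t\<in>{0..real k}.
      (\<integral>\<omega>. (Z i s \<omega> - Z i t \<omega>)\<^sup>2 \<partial>M) \<le> C * \<bar>s - t\<bar> powr \<alpha>"
  shows "converges_weakly M (\<lambda>i \<omega>. to_D (\<lambda>t. Z i t \<omega>)) F N (\<lambda>\<omega>. to_D (\<lambda>t. Y t \<omega>))"
proof (rule converges_weakly_lipschitzI[OF M cgp_prob_space[OF Y]])
  interpret M: prob_space M by (rule M)
  interpret N: prob_space N by (rule cgp_prob_space[OF Y])
  have Zm: "\<forall>\<^sub>F i in F. (\<lambda>\<omega>. to_D (\<lambda>t. Z i t \<omega>)) \<in> borel_measurable M"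
    using Z Zc
  proof eventually_elim
    case (elim i)
    then show ?case by (intro measurable_to_D cgp_measurable[OF elim(1)]) auto
  qed
  then show "\<forall>\<^sub>F i in F. (\<lambda>\<omega>. to_D (\<lambda>t. Z i t \<omega>)) \<in> borel_measurable M" .
  show Ym: "(\<lambda>\<omega>. to_D (\<lambda>t. Y t \<omega>)) \<in> borel_measurable N"
    by (intro measurable_to_D cgp_measurable[OF Y] Yc)
  fix f :: "skorohod \<Rightarrow> real" and C0 K :: real
  assume lip0: "\<And>x y. \<bar>f x - f y\<bar> \<le> C0 * dist x y" and K: "\<And>x. \<bar>f x\<bar> \<le> K"
  define C where "C = max 1 C0"
  have C: "C > 0" by (simp add: C_def)
  have lip: "\<bar>f x - f y\<bar> \<le> C * dist x y" for x y
    using lip0[of x y] mult_right_mono[of C0 C "dist x y"] by (simp add: C_def)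
  have fm: "f \<in> borel_measurable borel" by (rule borel_measurable_lipschitz[OF lip])
  have fc: "isCont f x" for x
  proof -
    have "C-lipschitz_on UNIV f" using lip C by (auto simp: lipschitz_on_def dist_real_def)
    then show ?thesis using lipschitz_on_continuous_on continuous_on_eq_continuous_at[OF open_UNIV] by blast
  qed
  show "((\<lambda>i. \<integral>\<omega>. f (to_D (\<lambda>t. Z i t \<omega>)) \<partial>M) \<longlongrightarrow> (\<integral>\<omega>. f (to_D (\<lambda>t. Y t \<omega>)) \<partial>N)) F"
  proof (rule tendstoI)
    fix e :: real assume e: "e > 0"
    \<comment> \<open>The horizon \<open>k\<close> is chosen first, then the level \<open>n\<close>, and only then \<open>i\<close> runs along \<open>F\<close>.\<close>
    obtain k where k: "(1/2::real) ^ k < e / (4 * C)"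
      using real_arch_pow_inv[of "e / (4 * C)" "1/2"] e C by auto
    obtain D0 where D0: "\<forall>\<^sub>F i in F. \<forall>s\<in>{0..real k}. \<forall>t\<in>{0..real k}.
      (\<integral>\<omega>. (Z i s \<omega> - Z i t \<omega>)\<^sup>2 \<partial>M) \<le> D0 * \<bar>s - t\<bar> powr \<alpha>" using tight by blast
    define D where "D = max 0 D0"
    obtain q :: nat where q: "real q > 1 / \<alpha>" using reals_Archimedean2 by blast
    have q1: "q \<ge> 1" using q \<alpha> by (cases q) auto
    define \<beta> where "\<beta> = \<alpha> * real q - 1"
    have \<beta>: "\<beta> > 0" using q \<alpha> by (simp add: \<beta>_def field_simps)
    define E where "E = fact (2 * q) / (2 ^ q * fact q) * D ^ q"
    have E: "E \<ge> 0" by (simp add: E_def D_def)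
    define \<rho> where "\<rho> = 2 powr (- \<beta> / (2 * q))"
    have \<rho>: "0 < \<rho>" "\<rho> < 1" using \<beta> q1 by (auto simp: \<rho>_def powr_less_one)
    have "(\<lambda>n. (1 + real k * E) * \<rho> ^ n / (1 - \<rho>)) \<longlonglongrightarrow> (1 + real k * E) * 0 / (1 - \<rho>)"
      using \<rho> by (intro tendsto_intros LIMSEQ_power_zero) auto
    then have "\<forall>\<^sub>F n in sequentially. (1 + real k * E) * \<rho> ^ n / (1 - \<rho>) < e / (4 * C)"
      using e C by (intro order_tendstoD) auto
    moreover have "(\<lambda>n. \<integral>\<omega>. f (discretize n (\<lambda>t. Y t \<omega>)) \<partial>N) \<longlonglongrightarrow> (\<integral>\<omega>. f (to_D (\<lambda>t. Y t \<omega>)) \<partial>N)"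
    proof (rule integral_dominated_convergence[where w="\<lambda>_. K"])
      show "(\<lambda>\<omega>. f (to_D (\<lambda>t. Y t \<omega>))) \<in> borel_measurable N" by (rule measurable_compose[OF Ym fm])
      show "(\<lambda>\<omega>. f (discretize n (\<lambda>t. Y t \<omega>))) \<in> borel_measurable N" for n
        by (rule measurable_compose[OF measurable_discretize[OF cgp_measurable[OF Y]] fm])
      show "AE \<omega> in N. (\<lambda>n. f (discretize n (\<lambda>t. Y t \<omega>))) \<longlonglongrightarrow> f (to_D (\<lambda>t. Y t \<omega>))"
        by (rule AE_I2) (rule isCont_tendsto_compose[OF fc discretize_to_D_tendsto[OF Yc]])
      show "AE \<omega> in N. norm (f (discretize n (\<lambda>t. Y t \<omega>))) \<le> K" for n
        unfolding real_norm_def by (rule AE_I2) (rule K)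
    qed simp
    then have "\<forall>\<^sub>F n in sequentially.
        dist (\<integral>\<omega>. f (discretize n (\<lambda>t. Y t \<omega>)) \<partial>N) (\<integral>\<omega>. f (to_D (\<lambda>t. Y t \<omega>)) \<partial>N) < e/4"
      using e by (intro tendstoD) auto
    ultimately have "\<forall>\<^sub>F n in sequentially. (1 + real k * E) * \<rho> ^ n / (1 - \<rho>) < e / (4 * C) \<and>
        dist (\<integral>\<omega>. f (discretize n (\<lambda>t. Y t \<omega>)) \<partial>N) (\<integral>\<omega>. f (to_D (\<lambda>t. Y t \<omega>)) \<partial>N) < e/4 \<and> n \<ge> k"
      using eventually_ge_at_top[of k] by eventually_elim simp
    then obtain n where n: "(1 + real k * E) * \<rho> ^ n / (1 - \<rho>) < e / (4 * C)"
        "dist (\<integral>\<omega>. f (discretize n (\<lambda>t. Y t \<omega>)) \<partial>N) (\<integral>\<omega>. f (to_D (\<lambda>t. Y t \<omega>)) \<partial>N) < e/4" "n \<ge> k"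
      unfolding eventually_sequentially by blast
    have "((\<lambda>i. \<integral>\<omega>. f (step_path n (\<lambda>j. Z i (real j / 2 ^ n) \<omega>)) \<partial>M) \<longlongrightarrow>
        (\<integral>\<omega>. f (step_path n (\<lambda>j. Y (real j / 2 ^ n) \<omega>)) \<partial>N)) F"
    proof (rule tendsto_expectation_gaussian_process[where g="\<lambda>a. f (step_path n a)", OF M Z Y cov])
      show "\<bar>f (step_path n a)\<bar> \<le> K" for a by (rule K)
      show "\<bar>f (step_path n a) - f (step_path n b)\<bar> \<le> C * (\<Sum>j\<le>n * 2 ^ n. \<bar>a j - b j\<bar>)" for a b
        by (rule order_trans[OF lip mult_left_mono[OF step_path_lipschitz less_imp_le[OF C]]])
    qed auto
    then have "\<forall>\<^sub>F i in F. dist (\<integral>\<omega>. f (discretize n (\<lambda>t. Z i t \<omega>)) \<partial>M) (\<integral>\<omega>. f (discretize n (\<lambda>t. Y t \<omega>)) \<partial>N) < e/4"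
      unfolding discretize_def using e by (intro tendstoD) auto
    then show "\<forall>\<^sub>F i in F. dist (\<integral>\<omega>. f (to_D (\<lambda>t. Z i t \<omega>)) \<partial>M) (\<integral>\<omega>. f (to_D (\<lambda>t. Y t \<omega>)) \<partial>N) < e"
      using Z Zc D0 Zm
    proof eventually_elim
      case (elim i)
      note Zi = elim(2)
      have mom: "integrable M (\<lambda>\<omega>. (Z i s \<omega> - Z i t \<omega>) ^ (2 * q)) \<and>
          (\<integral>\<omega>. (Z i s \<omega> - Z i t \<omega>) ^ (2 * q) \<partial>M) \<le> E * \<bar>s - t\<bar> powr (1 + \<beta>)"
        if st: "s \<in> {0..real k}" "t \<in> {0..real k}" for s t
      proof -
        have st0: "s \<ge> 0" "t \<ge> 0" using st by auto
        note inc = M cgp_increment(1,2)[OF Zi st0]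
        let ?v = "\<integral>\<omega>. (Z i s \<omega> - Z i t \<omega>)\<^sup>2 \<partial>M"
        have "?v \<le> D0 * \<bar>s - t\<bar> powr \<alpha>" using elim(4) st by blast
        also have "\<dots> \<le> D * \<bar>s - t\<bar> powr \<alpha>" by (intro mult_right_mono) (auto simp: D_def)
        finally have v: "?v ^ q \<le> (D * \<bar>s - t\<bar> powr \<alpha>) ^ q" by (intro power_mono) auto
        have "(\<bar>s - t\<bar> powr \<alpha>) ^ q = \<bar>s - t\<bar> powr (1 + \<beta>)"
        proof (cases "s = t")
          case True then show ?thesis using q1 by (simp add: power_0_left)
        next
          case False
          then show ?thesis by (simp add: powr_powr \<beta>_def flip: powr_realpow)
        qed
        then have v: "?v ^ q \<le> D ^ q * \<bar>s - t\<bar> powr (1 + \<beta>)" using v by (simp add: power_mult_distrib)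
        have "(\<integral>\<omega>. (Z i s \<omega> - Z i t \<omega>) ^ (2 * q) \<partial>M) = fact (2 * q) / (2 ^ q * fact q) * ?v ^ q"
          by (rule gaussian_rv_even_moment[OF inc])
        also have "\<dots> \<le> fact (2 * q) / (2 ^ q * fact q) * (D ^ q * \<bar>s - t\<bar> powr (1 + \<beta>))"
          by (intro mult_left_mono v) simp
        finally show ?thesis using gaussian_rv_integrable[OF inc, of q] by (simp add: E_def mult.assoc)
      qed
      have Zmeas: "t \<ge> 0 \<Longrightarrow> Z i t \<in> borel_measurable M" for t by (rule cgp_measurable[OF Zi])
      have Zcad: "\<omega> \<in> space M \<Longrightarrow> cadlag (\<lambda>t. Z i t \<omega>)" for \<omega> using elim(3) by blast
      have "\<bar>(\<integral>\<omega>. f (to_D (\<lambda>t. Z i t \<omega>)) \<partial>M) - (\<integral>\<omega>. f (discretize n (\<lambda>t. Z i t \<omega>)) \<partial>M)\<bar>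
          \<le> C * ((1/2) ^ k + (1 + real k * E) * \<rho> ^ n / (1 - \<rho>))"
        unfolding \<rho>_def
        by (rule M.expectation_discretization_error[OF Zmeas Zcad q1 \<beta> E _ _ n(3) C lip K]) (use mom in auto)
      also have "\<dots> \<le> C * (e / (4 * C) + e / (4 * C))"
        using k n(1) C by (intro mult_left_mono add_mono) auto
      also have "\<dots> = e/2" using C by (simp add: field_simps)
      finally have "\<bar>(\<integral>\<omega>. f (to_D (\<lambda>t. Z i t \<omega>)) \<partial>M) - (\<integral>\<omega>. f (discretize n (\<lambda>t. Z i t \<omega>)) \<partial>M)\<bar> \<le> e/2" .
      then show ?case using elim(1) n(2) unfolding dist_real_def by linarith
    qed
  qed
qed

section \<open>Slowly varying functions\<close>

text \<open>The translate \<open>a + V\<close> still lies in \<open>[0, 2]\<close>, and two disjoint subsets of that interval cannot have total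
measure above \<open>2\<close>.\<close>

lemma measure_lborel_pair_intersect:
  assumes U: "U \<in> sets lborel" "U \<subseteq> {0..2}" "measure lborel U > 3/2"
    and V: "V \<in> sets lborel" "V \<subseteq> {0..1}" "measure lborel V > 1/2"
    and a: "0 \<le> a" "a \<le> (1::real)"
  shows "\<exists>v\<in>V. a + v \<in> U"
proof (rule ccontr)
  assume contra: "\<not> ?thesis"
  define W where "W = (+) a ` V"
  have W: "W = (\<lambda>x. x - a) -` V \<inter> space lborel" by (auto simp: W_def image_iff) (metis add.commute diff_add_cancel)
  have Wm: "W \<in> sets lborel" unfolding W by (rule measurable_sets[OF _ V(1)]) simp
  have "measure lborel W = measure lborel V"
    using measure_translation[of a V] Wm V(1) by (simp add: W_def)
  moreover have disj: "U \<inter> W = {}" using contra by (auto simp: W_def)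
  moreover have fm: "U \<in> fmeasurable lborel" "W \<in> fmeasurable lborel"
  proof -
    have "W \<subseteq> {0..2}" using V(2) a by (auto simp: W_def)
    then show "U \<in> fmeasurable lborel" "W \<in> fmeasurable lborel"
      using U Wm fmeasurableI2[of "{0..2::real}" lborel] by (auto simp: fmeasurable_def)
  qed
  ultimately have "measure lborel (U \<union> W) > 2"
    using U(3) V(3) measure_Un3[OF fm] by simp
  moreover have "measure lborel (U \<union> W) \<le> measure lborel {0..2::real}"
    using U(1,2) Wm V(2) a by (intro measure_mono_fmeasurable) (auto simp: W_def fmeasurable_def)
  ultimately show False by simp
qed

lemma incseq_measure_exceeds:
  fixes A :: "nat \<Rightarrow> real set"
  assumes "\<And>n. A n \<in> sets lborel" "incseq A" "(\<Union>n. A n) = {0..b}" "b > 0" "c < b"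
  shows "\<forall>\<^sub>F n in sequentially. measure lborel (A n) > c"
proof -
  have "(\<lambda>n. measure lborel (A n)) \<longlonglongrightarrow> measure lborel (\<Union>n. A n)"
    by (rule Lim_measure_incseq) (use assms in auto)
  then show ?thesis using assms by (intro order_tendstoD) auto
qed

text \<open>The uniform convergence theorem of regular variation, in additive form.  If uniformity fails along
\<open>x n\<close> with shifts \<open>y n\<close>, then for large \<open>n\<close> most points \<open>v\<close> are good shifts both from \<open>x n\<close> and from
\<open>z n = x n + y n\<close>.  By measure some point is reached from both by a good shift, so \<open>h\<close> differs little
between \<open>x n\<close> and \<open>z n\<close>.\<close>

lemma additive_uniform_convergence:
  fixes h :: "real \<Rightarrow> real"
  assumes meas: "h \<in> borel_measurable borel"
    and lim: "\<And>y. ((\<lambda>x. h (x + y) - h x) \<longlongrightarrow> 0) at_top" and e: "e > 0"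
  shows "\<exists>x0. \<forall>x\<ge>x0. \<forall>y\<in>{0..1}. \<bar>h (x + y) - h x\<bar> < e"
proof (rule ccontr)
  assume "\<not> ?thesis"
  then have "\<forall>n::nat. \<exists>x y. x \<ge> real n \<and> y \<in> {0..1} \<and> \<bar>h (x + y) - h x\<bar> \<ge> e"
    by (metis not_less)
  then obtain x y where xy: "\<And>n::nat. x n \<ge> real n" "\<And>n. y n \<in> {0..1}" "\<And>n. \<bar>h (x n + y n) - h (x n)\<bar> \<ge> e"
    by metis
  define z where "z n = x n + y n" for n
  have z: "z n \<ge> real n" for n using xy(1)[of n] xy(2)[of n] by (simp add: z_def)
  define S where "S w b n = {v \<in> {0..b}. \<forall>m\<ge>n. \<bar>h (w m + v) - h (w m)\<bar> < e/2}" for w :: "nat \<Rightarrow> real" and b :: real and n :: nat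
  have S_sets: "S w b n \<in> sets lborel" for w b n
  proof -
    have "S w b n = {v \<in> space lborel. 0 \<le> v \<and> v \<le> b \<and> (\<forall>m. m \<ge> n \<longrightarrow> \<bar>h (w m + v) - h (w m)\<bar> < e/2)}"
      by (auto simp: S_def)
    also have "\<dots> \<in> sets lborel" using meas by measurable
    finally show ?thesis .
  qed
  have S_sub: "S w b n \<subseteq> {0..b}" for w b n by (auto simp: S_def)
  have big: "\<forall>\<^sub>F n in sequentially. measure lborel (S w b n) > c"
    if w: "\<And>n. w n \<ge> real n" and "b > 0" "c < b" for w b c
  proof (rule incseq_measure_exceeds[where b=b])
    show "S w b n \<in> sets lborel" for n by (rule S_sets)
    show "incseq (S w b)" by (rule incseq_SucI) (auto simp: S_def)
    have wlim: "filterlim w at_top sequentially"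
      by (rule filterlim_at_top_mono[OF filterlim_real_sequentially]) (use w in auto)
    have "\<exists>n. v \<in> S w b n" if "v \<in> {0..b}" for v
    proof -
      have "(\<lambda>n. h (w n + v) - h (w n)) \<longlonglongrightarrow> 0" by (rule filterlim_compose[OF lim wlim])
      then have "\<forall>\<^sub>F n in sequentially. \<bar>h (w n + v) - h (w n)\<bar> < e/2"
        using e by (auto dest!: tendstoD[of _ _ _ "e/2"] simp: dist_real_def)
      then show ?thesis using that by (auto simp: S_def eventually_sequentially)
    qed
    then show "(\<Union>n. S w b n) = {0..b}" by (auto simp: S_def)
  qed (use that in auto)
  have "\<forall>\<^sub>F n in sequentially. measure lborel (S x 2 n) > 3/2 \<and> measure lborel (S z 1 n) > 1/2"
    by (intro eventually_conj big xy(1) z) auto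
  then obtain n where n: "measure lborel (S x 2 n) > 3/2" "measure lborel (S z 1 n) > 1/2"
    unfolding eventually_sequentially by blast
  have y: "0 \<le> y n" "y n \<le> 1" using xy(2)[of n] by auto
  have "\<exists>v\<in>S z 1 n. y n + v \<in> S x 2 n"
    by (rule measure_lborel_pair_intersect[OF S_sets S_sub n(1) S_sets S_sub n(2) y])
  then obtain v where "v \<in> S z 1 n" "y n + v \<in> S x 2 n" by blast
  then have v: "\<bar>h (z n + v) - h (z n)\<bar> < e/2" "\<bar>h (x n + (y n + v)) - h (x n)\<bar> < e/2"
    unfolding S_def by blast+
  have "\<bar>h (z n) - h (x n)\<bar> \<ge> e" using xy(3)[of n] by (simp add: z_def)
  moreover have "x n + (y n + v) = z n + v" by (simp add: z_def)
  then have "\<bar>h (z n + v) - h (x n)\<bar> < e/2" using v(2) by (simp only:)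
  ultimately show False using v(1) by linarith
qed

text \<open>A displacement of length \<open>d\<close> is cut into at most \<open>d + 1\<close> steps of length at most \<open>1\<close>.\<close>

lemma additive_potter_bound:
  fixes h :: "real \<Rightarrow> real"
  assumes meas: "h \<in> borel_measurable borel"
    and lim: "\<And>y. ((\<lambda>x. h (x + y) - h x) \<longlongrightarrow> 0) at_top" and e: "e > 0"
  shows "\<exists>x0. \<forall>x\<ge>x0. \<forall>y\<ge>x0. \<bar>h y - h x\<bar> \<le> e * (\<bar>y - x\<bar> + 1)"
proof -
  obtain x0 where x0: "\<And>x y. x \<ge> x0 \<Longrightarrow> y \<in> {0..1} \<Longrightarrow> \<bar>h (x + y) - h x\<bar> < e"
    using additive_uniform_convergence[OF assms] by blast
  have steps: "\<bar>h (x + y) - h x\<bar> \<le> e * real n" if "x \<ge> x0" "0 \<le> y" "y \<le> real n" for x y n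
    using that(2,3)
  proof (induction n arbitrary: y)
    case 0 then show ?case by simp
  next
    case (Suc n)
    show ?case
    proof (cases "y \<le> 1")
      case True
      then have "\<bar>h (x + y) - h x\<bar> \<le> e * 1" using x0[OF that(1), of y] Suc.prems by simp
      also have "\<dots> \<le> e * real (Suc n)" using e by (intro mult_left_mono) auto
      finally show ?thesis .
    next
      case False
      have "\<bar>h (x + (y - 1)) - h x\<bar> \<le> e * real n" using Suc.prems False by (intro Suc.IH) auto
      moreover have "\<bar>h (x + (y - 1) + 1) - h (x + (y - 1))\<bar> < e" using that(1) False by (intro x0) auto
      ultimately show ?thesis by (simp add: algebra_simps)
    qed
  qed
  have le: "\<bar>h y - h x\<bar> \<le> e * (\<bar>y - x\<bar> + 1)" if "x \<ge> x0" "y \<ge> x" for x y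
  proof -
    have "\<bar>h (x + (y - x)) - h x\<bar> \<le> e * real (nat \<lceil>y - x\<rceil>)"
      using that by (intro steps) (auto simp: of_nat_ceiling)
    also have "real (nat \<lceil>y - x\<rceil>) \<le> \<bar>y - x\<bar> + 1" using that by linarith
    finally show ?thesis using e by simp
  qed
  have "\<bar>h y - h x\<bar> \<le> e * (\<bar>y - x\<bar> + 1)" if "x \<ge> x0" "y \<ge> x0" for x y
    using le[of x y] le[of y x] that by (cases "x \<le> y") (auto simp: abs_minus_commute)
  then show ?thesis by blast
qed

text \<open>For \<open>v\<close> and \<open>w\<close> with bounded quotient this is the uniform convergence theorem, and in general it is
Potter's bound.  It is the additive bound for \<open>h x = ln (L (exp (- x)))\<close>.\<close>

lemma slowly_varying_log_bound:
  assumes L: "slowly_varying_at_0 L" and e: "e > 0"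
  shows "\<exists>d>0. \<forall>v w. 0 < v \<longrightarrow> v \<le> d \<longrightarrow> 0 < w \<longrightarrow> w \<le> d \<longrightarrow> \<bar>ln (L v) - ln (L w)\<bar> \<le> e * (\<bar>ln v - ln w\<bar> + 1)"
proof -
  have Lm: "L \<in> borel_measurable (restrict_space borel {0<..})" and Lpos: "\<And>u. u > 0 \<Longrightarrow> L u > 0"
    and Llim: "\<And>c. c > 0 \<Longrightarrow> ((\<lambda>u. L (c * u) / L u) \<longlongrightarrow> 1) (at_right 0)"
    using L by (auto simp: slowly_varying_at_0_def)
  define h where "h x = ln (L (exp (- x)))" for x
  have "(\<lambda>x::real. exp (- x)) \<in> measurable borel (restrict_space borel {0<..})"
    by (rule measurable_restrict_space2) auto
  from measurable_compose[OF this Lm] have hm: "h \<in> borel_measurable borel"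
    unfolding h_def by measurable
  have "((\<lambda>x. h (x + y) - h x) \<longlongrightarrow> 0) at_top" for y
  proof -
    have "filterlim (\<lambda>x::real. exp (- x)) (nhds 0) at_top"
      by (rule filterlim_compose[OF exp_at_bot filterlim_uminus_at_bot_at_top])
    then have "filterlim (\<lambda>x::real. exp (- x)) (at_right 0) at_top"
      by (rule tendsto_imp_filterlim_at_right) auto
    from filterlim_compose[OF Llim[of "exp (- y)"] this]
    have "((\<lambda>x. L (exp (- y) * exp (- x)) / L (exp (- x))) \<longlongrightarrow> 1) at_top" by simp
    then have "((\<lambda>x. ln (L (exp (- y) * exp (- x)) / L (exp (- x)))) \<longlongrightarrow> ln 1) at_top"
      by (rule tendsto_ln) simp
    also have "(\<lambda>x. ln (L (exp (- y) * exp (- x)) / L (exp (- x)))) = (\<lambda>x. h (x + y) - h x)"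
      unfolding h_def by (rule ext) (simp add: ln_div Lpos less_imp_neq[symmetric] add.commute flip: exp_add)
    finally show ?thesis by simp
  qed
  from additive_potter_bound[OF hm this e] obtain x0
    where x0: "\<And>x y. x \<ge> x0 \<Longrightarrow> y \<ge> x0 \<Longrightarrow> \<bar>h y - h x\<bar> \<le> e * (\<bar>y - x\<bar> + 1)" by blast
  have "\<bar>ln (L v) - ln (L w)\<bar> \<le> e * (\<bar>ln v - ln w\<bar> + 1)"
    if "0 < v" "v \<le> exp (- x0)" "0 < w" "w \<le> exp (- x0)" for v w
  proof -
    have "x0 \<le> - ln v" "x0 \<le> - ln w" using that by (metis exp_gt_zero ln_exp ln_le_cancel_iff minus_le_iff neg_le_iff_le minus_minus)+
    from x0[OF this(2,1)] show ?thesis using that by (simp add: h_def abs_minus_commute)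
  qed
  then show ?thesis by (intro exI[of _ "exp (- x0)"]) auto
qed

text \<open>The factor \<open>c u\<close> is compared with its limit \<open>c0\<close> by the logarithmic bound, and then \<open>c0\<close> is the fixed
factor in the definition of slow variation.\<close>

lemma slowly_varying_ratio_tendsto:
  assumes L: "slowly_varying_at_0 L" and c: "(c \<longlongrightarrow> c0) (at_right 0)" "c0 > 0"
  shows "((\<lambda>u. L (c u * u) / L u) \<longlongrightarrow> 1) (at_right 0)"
proof -
  have Lpos: "\<And>u. u > 0 \<Longrightarrow> L u > 0" and Llim: "((\<lambda>u. L (c0 * u) / L u) \<longlongrightarrow> 1) (at_right 0)"
    using L c(2) by (auto simp: slowly_varying_at_0_def)
  have pos: "\<forall>\<^sub>F u::real in at_right 0. u > 0" by (rule eventually_at_right_less)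
  have u0: "((\<lambda>u::real. u) \<longlongrightarrow> 0) (at_right 0)" by (rule tendsto_ident_at)
  have diff: "((\<lambda>u. ln (L (c u * u)) - ln (L (c0 * u))) \<longlongrightarrow> 0) (at_right 0)"
  proof (rule tendstoI)
    fix e :: real assume e: "e > 0"
    obtain d where d: "d > 0" "\<And>v w. 0 < v \<Longrightarrow> v \<le> d \<Longrightarrow> 0 < w \<Longrightarrow> w \<le> d \<Longrightarrow>
        \<bar>ln (L v) - ln (L w)\<bar> \<le> e/3 * (\<bar>ln v - ln w\<bar> + 1)"
      using slowly_varying_log_bound[OF L, of "e/3"] e by auto
    have "((\<lambda>u. c u * u) \<longlongrightarrow> c0 * 0) (at_right 0)" by (intro tendsto_mult c u0)
    then have 1: "\<forall>\<^sub>F u in at_right 0. c u * u < d" using d by (intro order_tendstoD) auto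
    have "((\<lambda>u. c0 * u) \<longlongrightarrow> c0 * 0) (at_right 0)" by (intro tendsto_mult tendsto_const u0)
    then have 2: "\<forall>\<^sub>F u in at_right 0. c0 * u < d" using d by (intro order_tendstoD) auto
    have 3: "\<forall>\<^sub>F u in at_right 0. c u > 0" using c by (rule order_tendstoD)
    have "((\<lambda>u. ln (c u) - ln c0) \<longlongrightarrow> ln c0 - ln c0) (at_right 0)" using c by (intro tendsto_intros) auto
    then have 4: "\<forall>\<^sub>F u in at_right 0. dist (ln (c u) - ln c0) 0 < 1" by (intro tendstoD) auto
    show "\<forall>\<^sub>F u in at_right 0. dist (ln (L (c u * u)) - ln (L (c0 * u))) 0 < e"
      using 1 2 3 4 pos
    proof eventually_elim
      case (elim u)
      have "\<bar>ln (L (c u * u)) - ln (L (c0 * u))\<bar> \<le> e/3 * (\<bar>ln (c u * u) - ln (c0 * u)\<bar> + 1)"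
        using elim c(2) by (intro d(2)) auto
      also have "ln (c u * u) - ln (c0 * u) = ln (c u) - ln c0" using elim c(2) by (simp add: ln_mult)
      also have "e/3 * (\<bar>ln (c u) - ln c0\<bar> + 1) \<le> e/3 * 2" using elim e by (intro mult_left_mono) auto
      finally show ?case using e by simp
    qed
  qed
  have "((\<lambda>u. exp (ln (L (c u * u)) - ln (L (c0 * u))) * (L (c0 * u) / L u)) \<longlongrightarrow> exp 0 * 1) (at_right 0)"
    by (intro tendsto_mult tendsto_exp diff Llim)
  then have lim: "((\<lambda>u. exp (ln (L (c u * u)) - ln (L (c0 * u))) * (L (c0 * u) / L u)) \<longlongrightarrow> 1) (at_right 0)" by simp
  have 3: "\<forall>\<^sub>F u in at_right 0. c u > 0" using c by (rule order_tendstoD)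
  show ?thesis
  proof (rule Lim_transform_eventually[OF lim])
    show "\<forall>\<^sub>F u in at_right 0. exp (ln (L (c u * u)) - ln (L (c0 * u))) * (L (c0 * u) / L u) = L (c u * u) / L u"
      using 3 pos
    proof eventually_elim
      case (elim u)
      then have "L (c u * u) > 0" "L (c0 * u) > 0" using Lpos c(2) by auto
      then show ?case by (simp add: exp_diff)
    qed
  qed
qed

text \<open>Half of the exponent \<open>\<kappa>\<close> is given up to absorb \<open>L\<close>.  Factors \<open>c\<close> between \<open>1\<close> and \<open>\<Lambda>\<close> are covered by the
constant, through \<open>\<bar>ln c\<bar> \<le> 2 * ln \<Lambda> - ln c\<close>.\<close>

lemma regularly_varying_ratio_le:
  fixes \<kappa> \<Lambda> :: real
  assumes L: "slowly_varying_at_0 L" and \<kappa>: "\<kappa> > 0" and \<Lambda>: "\<Lambda> \<ge> 1"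
  shows "\<exists>C. \<forall>\<^sub>F u in at_right 0. \<forall>c. 0 < c \<longrightarrow> c \<le> \<Lambda> \<longrightarrow>
    (c * u) powr \<kappa> * L (c * u) / (u powr \<kappa> * L u) \<le> C * c powr (\<kappa>/2)"
proof -
  have Lpos: "\<And>u. u > 0 \<Longrightarrow> L u > 0" using L by (auto simp: slowly_varying_at_0_def)
  obtain d where d: "d > 0" "\<And>v w. 0 < v \<Longrightarrow> v \<le> d \<Longrightarrow> 0 < w \<Longrightarrow> w \<le> d \<Longrightarrow>
      \<bar>ln (L v) - ln (L w)\<bar> \<le> \<kappa>/2 * (\<bar>ln v - ln w\<bar> + 1)"
    using slowly_varying_log_bound[OF L, of "\<kappa>/2"] \<kappa> by auto
  define C where "C = exp (\<kappa>/2 * (2 * ln \<Lambda> + 1))"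
  have "d / \<Lambda> > 0" using d \<Lambda> by simp
  then have "\<forall>\<^sub>F u in at_right 0. u \<in> {0<..<d / \<Lambda>}" by (rule eventually_at_right_real)
  then have "\<forall>\<^sub>F u in at_right 0. \<forall>c. 0 < c \<longrightarrow> c \<le> \<Lambda> \<longrightarrow>
    (c * u) powr \<kappa> * L (c * u) / (u powr \<kappa> * L u) \<le> C * c powr (\<kappa>/2)"
  proof eventually_elim
    case (elim u)
    then have u: "u > 0" "\<Lambda> * u < d" using \<Lambda> by (auto simp: field_simps)
    have "(c * u) powr \<kappa> * L (c * u) / (u powr \<kappa> * L u) \<le> C * c powr (\<kappa>/2)" if c: "0 < c" "c \<le> \<Lambda>" for c
    proof -
      have "c * u \<le> \<Lambda> * u" using c u by (intro mult_right_mono) auto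
      then have cu: "0 < c * u" "c * u \<le> d" using c u(1) mult_pos_pos[of c u] u(2) by linarith+
      have "1 * u \<le> \<Lambda> * u" using \<Lambda> u by (intro mult_right_mono) auto
      then have ud: "u \<le> d" using u(2) by linarith
      have "\<bar>ln (L (c * u)) - ln (L u)\<bar> \<le> \<kappa>/2 * (\<bar>ln (c * u) - ln u\<bar> + 1)"
        by (rule d(2)[OF cu u(1) ud])
      also have "ln (c * u) - ln u = ln c" using c u by (simp add: ln_mult)
      also have "\<kappa>/2 * (\<bar>ln c\<bar> + 1) \<le> \<kappa>/2 * (2 * ln \<Lambda> - ln c + 1)"
      proof -
        have "ln c \<le> ln \<Lambda>" "0 \<le> ln \<Lambda>" using c \<Lambda> by auto
        then show ?thesis using \<kappa> by (intro mult_left_mono) auto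
      qed
      finally have "ln (L (c * u)) - ln (L u) \<le> \<kappa>/2 * (2 * ln \<Lambda> + 1) + - \<kappa>/2 * ln c" by (simp add: algebra_simps)
      then have "exp (ln (L (c * u)) - ln (L u)) \<le> exp (\<kappa>/2 * (2 * ln \<Lambda> + 1) + - \<kappa>/2 * ln c)" by simp
      moreover have "exp (ln (L (c * u)) - ln (L u)) = L (c * u) / L u"
        using Lpos[of u] Lpos[OF cu(1)] u by (simp add: exp_diff)
      moreover have "exp (\<kappa>/2 * (2 * ln \<Lambda> + 1) + - \<kappa>/2 * ln c) = C * c powr (- \<kappa>/2)"
        unfolding exp_add C_def powr_def using c by simp
      ultimately have "L (c * u) / L u \<le> C * c powr (- \<kappa>/2)" by (simp only:)
      then have "c powr \<kappa> * (L (c * u) / L u) \<le> c powr \<kappa> * (C * c powr (- \<kappa>/2))"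
        by (intro mult_left_mono) auto
      also have "\<dots> = C * c powr (\<kappa>/2)" by (simp flip: powr_add)
      also have "c powr \<kappa> * (L (c * u) / L u) = (c * u) powr \<kappa> * L (c * u) / (u powr \<kappa> * L u)"
        using u c by (simp add: powr_mult)
      finally show ?thesis .
    qed
    then show ?case by blast
  qed
  then show ?thesis by blast
qed

section \<open>Fractional Brownian motion as the tangent process\<close>

lemma gaussian_rv_cong:
  assumes "\<And>\<omega>. \<omega> \<in> space M \<Longrightarrow> Y \<omega> = Y' \<omega>"
  shows "gaussian_rv M Y = gaussian_rv M Y'"
proof -
  have 1: "Y \<in> borel_measurable M \<longleftrightarrow> Y' \<in> borel_measurable M" using assms by (rule measurable_cong)
  have 2: "(AE \<omega> in M. Y \<omega> = \<mu>) = (AE \<omega> in M. Y' \<omega> = \<mu>)" for \<mu>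
    by (rule AE_cong) (use assms in simp)
  have "Y \<in> measurable M lborel \<longleftrightarrow> Y' \<in> measurable M lborel" using 1 by simp
  moreover have "distr M lborel Y = distr M lborel Y'" using assms by (intro distr_cong) auto
  ultimately have 3: "distributed M lborel Y f \<longleftrightarrow> distributed M lborel Y' f" for f
    by (simp add: distributed_def)
  show ?thesis unfolding gaussian_rv_def 1 2 3 ..
qed

lemma gaussian_rv_scale:
  assumes M: "prob_space M" and \<xi>: "distributed M lborel \<xi> std_normal_density"
  shows "gaussian_rv M (\<lambda>\<omega>. a * \<xi> \<omega>)"
proof -
  interpret prob_space M by (rule M)
  have m: "(\<lambda>\<omega>. a * \<xi> \<omega>) \<in> borel_measurable M" using distributed_measurable[OF \<xi>] by simp
  show ?thesis
  proof (cases "a = 0")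
    case True then show ?thesis by (auto simp: gaussian_rv_def)
  next
    case False
    have "distributed M lborel (\<lambda>\<omega>. 0 + a * \<xi> \<omega>) (normal_density (0 + a * 0) (\<bar>a\<bar> * 1))"
      by (rule normal_density_affine) (use \<xi> False in auto)
    then have "distributed M lborel (\<lambda>\<omega>. a * \<xi> \<omega>) (normal_density 0 \<bar>a\<bar>)" by simp
    then show ?thesis using m False unfolding gaussian_rv_def by (metis zero_less_abs_iff)
  qed
qed

text \<open>The degenerate case \<open>H = 1\<close>, where the covariance \<open>s * t\<close> is the fractional covariance formula
read at \<open>H = 1\<close>.  So all Hurst indices can be treated alike.\<close>

lemma centered_gaussian_process_linear:
  assumes M: "prob_space M" and \<xi>: "distributed M lborel \<xi> std_normal_density"
    and B: "\<And>t \<omega>. t \<ge> 0 \<Longrightarrow> \<omega> \<in> space M \<Longrightarrow> B t \<omega> = t * \<xi> \<omega>"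
  shows "centered_gaussian_process M B"
    and "s \<ge> 0 \<Longrightarrow> t \<ge> 0 \<Longrightarrow> (\<integral>\<omega>. B s \<omega> * B t \<omega> \<partial>M) = s * t"
proof -
  interpret prob_space M by (rule M)
  have mean: "(\<integral>\<omega>. \<xi> \<omega> \<partial>M) = 0"
    using distributed_integral[OF \<xi>, of "\<lambda>x. x"] integral_normal_moment_nz_1[of 1 0] by simp
  have sq: "(\<integral>\<omega>. (\<xi> \<omega>)\<^sup>2 \<partial>M) = 1"
    using distributed_integral[OF \<xi>, of "\<lambda>x. x\<^sup>2"] integral_std_normal_moment_even[of 1] by simp
  show "centered_gaussian_process M B"
    unfolding centered_gaussian_process_def
  proof (intro conjI M allI impI)
    fix I :: "real set" and a :: "real \<Rightarrow> real" assume I: "finite I \<and> I \<subseteq> {0..}"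
    have "gaussian_rv M (\<lambda>\<omega>. (\<Sum>t\<in>I. a t * t) * \<xi> \<omega>)" by (rule gaussian_rv_scale[OF M \<xi>])
    also have "gaussian_rv M (\<lambda>\<omega>. (\<Sum>t\<in>I. a t * t) * \<xi> \<omega>) = gaussian_rv M (\<lambda>\<omega>. \<Sum>t\<in>I. a t * B t \<omega>)"
    proof (rule gaussian_rv_cong)
      fix \<omega> assume \<omega>: "\<omega> \<in> space M"
      show "(\<Sum>t\<in>I. a t * t) * \<xi> \<omega> = (\<Sum>t\<in>I. a t * B t \<omega>)"
        unfolding sum_distrib_right using I \<omega> by (intro sum.cong) (auto simp: B)
    qed
    finally show "gaussian_rv M (\<lambda>\<omega>. \<Sum>t\<in>I. a t * B t \<omega>)" .
  next
    fix t :: real assume "t \<ge> 0"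
    then have "(\<integral>\<omega>. B t \<omega> \<partial>M) = (\<integral>\<omega>. t * \<xi> \<omega> \<partial>M)"
      by (intro Bochner_Integration.integral_cong) (auto simp: B)
    then show "(\<integral>\<omega>. B t \<omega> \<partial>M) = 0" by (simp add: mean)
  qed
  assume "s \<ge> 0" "t \<ge> 0"
  then have "(\<integral>\<omega>. B s \<omega> * B t \<omega> \<partial>M) = (\<integral>\<omega>. (s * t) * (\<xi> \<omega>)\<^sup>2 \<partial>M)"
    by (intro Bochner_Integration.integral_cong) (auto simp: B power2_eq_square)
  then show "(\<integral>\<omega>. B s \<omega> * B t \<omega> \<partial>M) = s * t" by (simp add: sq)
qed

lemma is_fBm_properties:
  assumes "is_fBm N H B"
  shows "centered_gaussian_process N B"
    and "s \<ge> 0 \<Longrightarrow> t \<ge> 0 \<Longrightarrow>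
      (\<integral>\<omega>. B s \<omega> * B t \<omega> \<partial>N) = (s powr (2*H) + t powr (2*H) - \<bar>t - s\<bar> powr (2*H)) / 2"
    and "\<omega> \<in> space N \<Longrightarrow> continuous_on {0..} (\<lambda>t. B t \<omega>)"
proof -
  have "centered_gaussian_process N B \<and>
    (\<forall>s\<ge>0. \<forall>t\<ge>0. (\<integral>\<omega>. B s \<omega> * B t \<omega> \<partial>N) = (s powr (2*H) + t powr (2*H) - \<bar>t - s\<bar> powr (2*H)) / 2) \<and>
    (\<forall>\<omega>\<in>space N. continuous_on {0..} (\<lambda>t. B t \<omega>))"
  proof (cases "H = 1")
    case True
    then obtain \<xi> where N: "prob_space N" and \<xi>: "distributed N lborel \<xi> std_normal_density"
      and B: "\<And>t \<omega>. t \<ge> 0 \<Longrightarrow> \<omega> \<in> space N \<Longrightarrow> B t \<omega> = t * \<xi> \<omega>"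
      using assms by (auto simp: is_fBm_def)
    note lin = centered_gaussian_process_linear[OF N \<xi> B]
    have "(s powr (2*H) + t powr (2*H) - \<bar>t - s\<bar> powr (2*H)) / 2 = s * t" if "s \<ge> 0" "t \<ge> 0" for s t
      using that True by (simp add: powr_numeral power2_eq_square algebra_simps)
    moreover have "continuous_on {0..} (\<lambda>t. B t \<omega>)" if "\<omega> \<in> space N" for \<omega>
    proof -
      have "continuous_on {0..} (\<lambda>t. t * \<xi> \<omega>)" by (intro continuous_intros)
      then show ?thesis by (rule continuous_on_eq) (use that B in auto)
    qed
    ultimately show ?thesis using lin by simp
  next
    case False
    then show ?thesis using assms by (simp add: is_fBm_def)
  qed
  then show "centered_gaussian_process N B"
    "s \<ge> 0 \<Longrightarrow> t \<ge> 0 \<Longrightarrow> (\<integral>\<omega>. B s \<omega> * B t \<omega> \<partial>N) = (s powr (2*H) + t powr (2*H) - \<bar>t - s\<bar> powr (2*H)) / 2"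
    "\<omega> \<in> space N \<Longrightarrow> continuous_on {0..} (\<lambda>t. B t \<omega>)" by blast+
qed

lemma continuous_imp_cadlag:
  assumes "continuous_on {0..} x"
  shows "cadlag x"
  unfolding cadlag_def
proof (intro conjI allI impI)
  have lim: "(x \<longlongrightarrow> x t) (at t within {0..})" if "t \<ge> 0" for t
    using assms that by (simp add: continuous_on_def)
  show "(x \<longlongrightarrow> x t) (at_right t)" if "t \<ge> 0" for t
    using that by (intro tendsto_within_subset[OF lim]) auto
  show "\<exists>l. (x \<longlongrightarrow> l) (at_left t)" if "t > 0" for t
  proof -
    have "at t within {0..} = at t" using that by (intro at_within_interior) auto
    then have "(x \<longlongrightarrow> x t) (at t)" using lim[of t] that by simp
    then have "(x \<longlongrightarrow> x t) (at_left t)" by (rule tendsto_within_subset) simp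
    then show ?thesis ..
  qed
qed

lemma cadlag_affine_time:
  assumes "cadlag x" "t \<ge> 0" "u > 0"
  shows "cadlag (\<lambda>\<tau>. (a - x (t + u * \<tau>)) / c)"
proof -
  have lim: "((\<lambda>\<tau>. t + u * \<tau>) \<longlongrightarrow> t + u * s) (at s within S)" for s S by (intro tendsto_intros)
  have right: "filterlim (\<lambda>\<tau>. t + u * \<tau>) (at_right (t + u * s)) (at_right s)" for s
  proof (rule tendsto_imp_filterlim_at_right[OF lim])
    show "\<forall>\<^sub>F \<tau> in at_right s. t + u * s < t + u * \<tau>"
      using eventually_at_right_less[of s] by eventually_elim (use assms in auto)
  qed
  have left: "filterlim (\<lambda>\<tau>. t + u * \<tau>) (at_left (t + u * s)) (at_left s)" for s
  proof (rule tendsto_imp_filterlim_at_left[OF lim])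
    show "\<forall>\<^sub>F \<tau> in at_left s. t + u * \<tau> < t + u * s"
      unfolding eventually_at_filter using assms by auto
  qed
  have nn: "t + u * s \<ge> 0" if "s \<ge> 0" for s using that assms by simp
  have pos: "t + u * s > 0" if "s > 0" for s using that assms by (simp add: add_nonneg_pos)
  show ?thesis unfolding cadlag_def
  proof (intro conjI allI impI)
    fix s :: real assume "s \<ge> 0"
    then have "(x \<longlongrightarrow> x (t + u * s)) (at_right (t + u * s))" using assms(1) nn by (simp add: cadlag_def)
    from filterlim_compose[OF this right]
    show "((\<lambda>\<tau>. (a - x (t + u * \<tau>)) / c) \<longlongrightarrow> (a - x (t + u * s)) / c) (at_right s)"
      unfolding divide_inverse by (intro tendsto_intros)
  next
    fix s :: real assume "s > 0"
    then obtain l where "(x \<longlongrightarrow> l) (at_left (t + u * s))" using assms(1) pos unfolding cadlag_def by blast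
    from filterlim_compose[OF this left]
    have "((\<lambda>\<tau>. (a - x (t + u * \<tau>)) / c) \<longlongrightarrow> (a - l) / c) (at_left s)"
      unfolding divide_inverse by (intro tendsto_intros)
    then show "\<exists>l. ((\<lambda>\<tau>. (a - x (t + u * \<tau>)) / c) \<longlongrightarrow> l) (at_left s)" ..
  qed
qed

lemma centered_gaussian_process_scale:
  assumes "centered_gaussian_process M X"
  shows "centered_gaussian_process M (\<lambda>t \<omega>. c * X t \<omega>)"
  unfolding centered_gaussian_process_def
proof (intro conjI cgp_prob_space[OF assms] allI impI)
  fix I :: "real set" and a assume "finite I \<and> I \<subseteq> {0..}"
  then have "gaussian_rv M (\<lambda>\<omega>. \<Sum>t\<in>I. (a t * c) * X t \<omega>)"
    using cgp_finite_combination[OF assms, of I "\<lambda>t. a t * c"] by simp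
  then show "gaussian_rv M (\<lambda>\<omega>. \<Sum>t\<in>I. a t * (c * X t \<omega>))" by (simp add: mult.assoc)
qed (simp add: cgp_mean[OF assms])

lemma centered_gaussian_process_rescaled_increment:
  assumes X: "centered_gaussian_process M X" and t: "t \<ge> 0" "u \<ge> 0"
  shows "centered_gaussian_process M (\<lambda>\<tau> \<omega>. (X t \<omega> - X (t + u * \<tau>) \<omega>) / c)"
  unfolding centered_gaussian_process_def
proof (intro conjI cgp_prob_space[OF X] allI impI)
  fix I :: "real set" and a assume I: "finite I \<and> I \<subseteq> {0..}"
  \<comment> \<open>The index \<open>None\<close> stands for the base point \<open>t\<close>, which occurs in every summand.\<close>
  define r where "r k = (case k of None \<Rightarrow> t | Some \<tau> \<Rightarrow> t + u * \<tau>)" for k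
  define b where "b k = (case k of None \<Rightarrow> (\<Sum>\<tau>\<in>I. a \<tau> / c) | Some \<tau> \<Rightarrow> - (a \<tau> / c))" for k
  have "gaussian_rv M (\<lambda>\<omega>. \<Sum>k\<in>insert None (Some ` I). b k * X (r k) \<omega>)"
    by (rule cgp_combination(1)[OF X]) (use I t in \<open>auto simp: r_def\<close>)
  also have "(\<lambda>\<omega>. \<Sum>k\<in>insert None (Some ` I). b k * X (r k) \<omega>) = (\<lambda>\<omega>. \<Sum>\<tau>\<in>I. a \<tau> * ((X t \<omega> - X (t + u * \<tau>) \<omega>) / c))"
  proof
    fix \<omega>
    have "(\<Sum>k\<in>insert None (Some ` I). b k * X (r k) \<omega>) = (\<Sum>\<tau>\<in>I. a \<tau> / c) * X t \<omega> + (\<Sum>\<tau>\<in>I. - (a \<tau> / c) * X (t + u * \<tau>) \<omega>)"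
      using I by (simp add: sum.reindex r_def b_def)
    also have "\<dots> = (\<Sum>\<tau>\<in>I. a \<tau> * ((X t \<omega> - X (t + u * \<tau>) \<omega>) / c))"
      unfolding sum_distrib_right sum.distrib[symmetric]
      by (intro sum.cong) (auto simp: diff_divide_distrib right_diff_distrib)
    finally show "(\<Sum>k\<in>insert None (Some ` I). b k * X (r k) \<omega>) = (\<Sum>\<tau>\<in>I. a \<tau> * ((X t \<omega> - X (t + u * \<tau>) \<omega>) / c))" .
  qed
  finally show "gaussian_rv M (\<lambda>\<omega>. \<Sum>\<tau>\<in>I. a \<tau> * ((X t \<omega> - X (t + u * \<tau>) \<omega>) / c))" .
next
  fix \<tau> :: real assume "\<tau> \<ge> 0"
  then show "(\<integral>\<omega>. (X t \<omega> - X (t + u * \<tau>) \<omega>) / c \<partial>M) = 0"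
    using t cgp_increment(2)[OF X, of t "t + u * \<tau>"] by simp
qed

theorem theorem1:
  fixes \<gamma> \<sigma> \<kappa> :: real and L l :: "real \<Rightarrow> real"
    and M :: "'a measure" and X :: "real \<Rightarrow> 'a \<Rightarrow> real"
    and N :: "'b measure" and B :: "real \<Rightarrow> 'b \<Rightarrow> real"
  assumes "0 < \<gamma>" "\<gamma> < 1" "0 < \<sigma>" "0 < \<kappa>" "\<kappa> \<le> 1"
    and "slowly_varying_at_0 L"
    and "l 0 = 1"
    and "\<And>u. u > 0 \<Longrightarrow> l u = (1 + (1 + u) powr (2*\<gamma>) - (u powr \<kappa> * L u)^2) / 2"
    and "centered_gaussian_process M X"
    and "\<And>\<omega>. \<omega> \<in> space M \<Longrightarrow> cadlag (\<lambda>t. X t \<omega>)"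
    and "\<And>\<omega>. \<omega> \<in> space M \<Longrightarrow> X 0 \<omega> = 0"
    and "\<And>s t. s > 0 \<Longrightarrow> t > 0 \<Longrightarrow>
           (\<integral>\<omega>. X s \<omega> * X t \<omega> \<partial>M) = \<sigma>^2 * (min s t) powr (2*\<gamma>) * l (\<bar>s - t\<bar> / min s t)"
    and "is_fBm N \<kappa> B"
  shows "\<forall>t>0. converges_weakly
           M (\<lambda>u \<omega>. to_D (\<lambda>\<tau>. (X t \<omega> - X (t + u * \<tau>) \<omega>) / (u powr \<kappa> * L u))) (at_right 0)
           N (\<lambda>\<omega>. to_D (\<lambda>\<tau>. \<sigma> * t powr (\<gamma> - \<kappa>) * B \<tau> \<omega>))"
proof (intro allI impI)
  fix t :: real assume t: "t > 0"
  note L = assms(6) and X = assms(9) and cov = assms(12) and B = assms(13)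
  define \<psi> where "\<psi> u = u powr \<kappa> * L u" for u
  define c where "c = \<sigma> * t powr (\<gamma> - \<kappa>)"
  have Lpos: "u > 0 \<Longrightarrow> L u > 0" for u using L by (simp add: slowly_varying_at_0_def)
  have \<psi>pos: "u > 0 \<Longrightarrow> \<psi> u > 0" for u using Lpos by (simp add: \<psi>_def)
  let ?Z = "\<lambda>u \<tau> \<omega>. (X t \<omega> - X (t + u * \<tau>) \<omega>) / \<psi> u"
  have upos: "\<forall>\<^sub>F u::real in at_right 0. u > 0" by (rule eventually_at_right_less)

  \<comment> \<open>The first two terms of \<open>l\<close> cancel the variances, and only \<open>\<psi>\<close> survives.\<close>
  have incX: "(\<integral>\<omega>. (X s \<omega> - X r \<omega>)\<^sup>2 \<partial>M) = \<sigma>\<^sup>2 * s powr (2*\<gamma>) * (\<psi> ((r - s) / s))\<^sup>2"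
    if sr: "0 < s" "s < r" for s r
  proof -
    have sq: "(\<integral>\<omega>. (X v \<omega>)\<^sup>2 \<partial>M) = \<sigma>\<^sup>2 * v powr (2*\<gamma>)" if "v > 0" for v
      using cov[OF that that] assms(7) by (simp add: power2_eq_square)
    have "(\<integral>\<omega>. X s \<omega> * X r \<omega> \<partial>M) = \<sigma>\<^sup>2 * s powr (2*\<gamma>) * l ((r - s) / s)"
      using cov[of s r] sr by simp
    also have "l ((r - s) / s) = (1 + (1 + (r - s) / s) powr (2*\<gamma>) - (\<psi> ((r - s) / s))\<^sup>2) / 2"
      using assms(8)[of "(r - s) / s"] sr by (simp add: \<psi>_def)
    also have "1 + (r - s) / s = r / s" using sr by (simp add: field_simps)
    also have "(r / s) powr (2*\<gamma>) = r powr (2*\<gamma>) / s powr (2*\<gamma>)" using sr by (simp add: powr_divide)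
    finally have X_prod: "(\<integral>\<omega>. X s \<omega> * X r \<omega> \<partial>M) =
        \<sigma>\<^sup>2 * s powr (2*\<gamma>) * ((1 + r powr (2*\<gamma>) / s powr (2*\<gamma>) - (\<psi> ((r - s) / s))\<^sup>2) / 2)" .
    have "2 * (v * p * ((1 + q / p - w) / 2)) = v * p + v * q - v * p * w" if "p > 0" for v p q w :: real
      using that by (simp add: field_simps)
    then have pr: "2 * (\<integral>\<omega>. X s \<omega> * X r \<omega> \<partial>M) =
        \<sigma>\<^sup>2 * s powr (2*\<gamma>) + \<sigma>\<^sup>2 * r powr (2*\<gamma>) - \<sigma>\<^sup>2 * s powr (2*\<gamma>) * (\<psi> ((r - s) / s))\<^sup>2"
      unfolding X_prod using sr by simp
    have "(\<integral>\<omega>. (X s \<omega> - X r \<omega>)\<^sup>2 \<partial>M) = (\<integral>\<omega>. (X s \<omega>)\<^sup>2 \<partial>M) + (\<integral>\<omega>. (X r \<omega>)\<^sup>2 \<partial>M) - 2 * (\<integral>\<omega>. X s \<omega> * X r \<omega> \<partial>M)"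
      using sr by (intro cgp_increment(3)[OF X]) auto
    then show ?thesis using sq[of s] sq[of r] sr pr by simp
  qed

  have incZ: "(\<integral>\<omega>. (?Z u a \<omega> - ?Z u b \<omega>)\<^sup>2 \<partial>M) =
      \<sigma>\<^sup>2 * (t + u * a) powr (2*\<gamma>) * (\<psi> ((b - a) / (t + u * a) * u) / \<psi> u)\<^sup>2"
    if "u > 0" "0 \<le> a" "a < b" for u a b
  proof -
    define s where "s = t + u * a"
    define r where "r = t + u * b"
    have sr: "0 < s" "s < r" using that t by (auto simp: s_def r_def add_pos_nonneg)
    have arg: "(r - s) / s = (b - a) / s * u" by (simp add: s_def r_def algebra_simps)
    have "(?Z u a \<omega> - ?Z u b \<omega>)\<^sup>2 = (X s \<omega> - X r \<omega>)\<^sup>2 / (\<psi> u)\<^sup>2" for \<omega>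
    proof -
      have "?Z u a \<omega> - ?Z u b \<omega> = - ((X s \<omega> - X r \<omega>) / \<psi> u)"
        by (simp add: s_def r_def diff_divide_distrib)
      then show ?thesis by (simp only: power2_minus power_divide)
    qed
    then have "(\<integral>\<omega>. (?Z u a \<omega> - ?Z u b \<omega>)\<^sup>2 \<partial>M) = (\<integral>\<omega>. (X s \<omega> - X r \<omega>)\<^sup>2 \<partial>M) / (\<psi> u)\<^sup>2" by simp
    also have "(\<integral>\<omega>. (X s \<omega> - X r \<omega>)\<^sup>2 \<partial>M) / (\<psi> u)\<^sup>2 = \<sigma>\<^sup>2 * s powr (2*\<gamma>) * (\<psi> ((b - a) / s * u) / \<psi> u)\<^sup>2"
      unfolding incX[OF sr] arg by (simp add: power_divide)
    finally show ?thesis by (simp add: s_def)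
  qed

  have inc_lim_less: "((\<lambda>u. \<integral>\<omega>. (?Z u a \<omega> - ?Z u b \<omega>)\<^sup>2 \<partial>M) \<longlongrightarrow> c\<^sup>2 * (b - a) powr (2*\<kappa>)) (at_right 0)"
    if ab: "0 \<le> a" "a < b" for a b
  proof -
    define q where "q u = (b - a) / (t + u * a)" for u
    have s: "((\<lambda>u. t + u * a) \<longlongrightarrow> t + 0 * a) (at_right 0)" by (intro tendsto_intros)
    then have s: "((\<lambda>u. t + u * a) \<longlongrightarrow> t) (at_right 0)" by simp
    have q: "(q \<longlongrightarrow> (b - a) / t) (at_right 0)"
      unfolding q_def using t by (intro tendsto_divide tendsto_const s) auto
    have q0: "(b - a) / t > 0" using ab t by simp
    have ratio: "((\<lambda>u. L (q u * u) / L u) \<longlongrightarrow> 1) (at_right 0)"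
      by (rule slowly_varying_ratio_tendsto[OF L q q0])
    have "((\<lambda>u. \<sigma>\<^sup>2 * (t + u * a) powr (2*\<gamma>) * (q u powr \<kappa> * (L (q u * u) / L u))\<^sup>2) \<longlongrightarrow>
        \<sigma>\<^sup>2 * t powr (2*\<gamma>) * (((b - a) / t) powr \<kappa> * 1)\<^sup>2) (at_right 0)"
      by (intro tendsto_mult tendsto_power tendsto_const tendsto_powr s q ratio) (use t q0 in auto)
    also have "\<sigma>\<^sup>2 * t powr (2*\<gamma>) * (((b - a) / t) powr \<kappa> * 1)\<^sup>2 = c\<^sup>2 * (b - a) powr (2*\<kappa>)"
    proof -
      have "(x powr p)\<^sup>2 = x powr (2 * p)" for x p :: real
        by (simp add: power2_eq_square flip: powr_add)
      then show ?thesis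
        using ab t by (simp add: c_def power_mult_distrib powr_divide powr_diff power_divide field_simps)
    qed
    finally show ?thesis
    proof (rule Lim_transform_eventually)
      show "\<forall>\<^sub>F u in at_right 0. \<sigma>\<^sup>2 * (t + u * a) powr (2*\<gamma>) * (q u powr \<kappa> * (L (q u * u) / L u))\<^sup>2
          = (\<integral>\<omega>. (?Z u a \<omega> - ?Z u b \<omega>)\<^sup>2 \<partial>M)"
        using upos
      proof eventually_elim
        case (elim u)
        have "q u > 0" using ab t elim by (auto simp: q_def add_pos_nonneg)
        then have "\<psi> (q u * u) / \<psi> u = q u powr \<kappa> * (L (q u * u) / L u)"
          using elim by (simp add: \<psi>_def powr_mult)
        then show ?case using incZ[OF elim ab] by (simp add: q_def)
      qed
    qed
  qed
  have inc_lim: "((\<lambda>u. \<integral>\<omega>. (?Z u a \<omega> - ?Z u b \<omega>)\<^sup>2 \<partial>M) \<longlongrightarrow> c\<^sup>2 * \<bar>b - a\<bar> powr (2*\<kappa>)) (at_right 0)"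
    if ab: "0 \<le> a" "0 \<le> b" for a b
  proof -
    consider "a < b" | "b < a" | "a = b" by linarith
    then show ?thesis
    proof cases
      case 1 then show ?thesis using inc_lim_less[of a b] ab by simp
    next
      case 2 then show ?thesis using inc_lim_less[of b a] ab by (simp add: power2_commute)
    next
      case 3 then show ?thesis by simp
    qed
  qed

  have CZ: "centered_gaussian_process M (?Z u)" if "u > 0" for u
    by (rule centered_gaussian_process_rescaled_increment[OF X]) (use t that in auto)
  have CY: "centered_gaussian_process N (\<lambda>\<tau> \<omega>. c * B \<tau> \<omega>)"
    by (rule centered_gaussian_process_scale[OF is_fBm_properties(1)[OF B]])
  have Z0: "?Z u 0 \<omega> = 0" for u \<omega> by simp

  have "converges_weakly M (\<lambda>u \<omega>. to_D (\<lambda>\<tau>. ?Z u \<tau> \<omega>)) (at_right 0) N (\<lambda>\<omega>. to_D (\<lambda>\<tau>. c * B \<tau> \<omega>))"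
  proof (rule gaussian_process_converges_weakly[OF cgp_prob_space[OF X] _ _ CY _ _ assms(4)])
    show "\<forall>\<^sub>F u in at_right 0. centered_gaussian_process M (?Z u)"
      using upos by eventually_elim (rule CZ)
    show "\<forall>\<^sub>F u in at_right 0. \<forall>\<omega>\<in>space M. cadlag (\<lambda>\<tau>. ?Z u \<tau> \<omega>)"
      using upos
    proof eventually_elim
      case (elim u)
      show ?case by (intro ballI cadlag_affine_time[OF assms(10) less_imp_le[OF t] elim])
    qed
    show "cadlag (\<lambda>\<tau>. c * B \<tau> \<omega>)" if "\<omega> \<in> space N" for \<omega>
      by (intro continuous_imp_cadlag continuous_intros is_fBm_properties(3)[OF B that])
  next
    fix a b :: real assume ab: "a \<ge> 0" "b \<ge> 0"
    \<comment> \<open>Both processes vanish at time \<open>0\<close>, so polarization recovers the covariances from the increments.\<close>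
    have "((\<lambda>u. ((\<integral>\<omega>. (?Z u a \<omega> - ?Z u 0 \<omega>)\<^sup>2 \<partial>M) + (\<integral>\<omega>. (?Z u b \<omega> - ?Z u 0 \<omega>)\<^sup>2 \<partial>M)
          - (\<integral>\<omega>. (?Z u a \<omega> - ?Z u b \<omega>)\<^sup>2 \<partial>M)) / 2) \<longlongrightarrow>
        (c\<^sup>2 * \<bar>0 - a\<bar> powr (2*\<kappa>) + c\<^sup>2 * \<bar>0 - b\<bar> powr (2*\<kappa>) - c\<^sup>2 * \<bar>b - a\<bar> powr (2*\<kappa>)) / 2) (at_right 0)"
      by (intro tendsto_divide tendsto_diff tendsto_add inc_lim ab order_refl tendsto_const) simp
    also have "(c\<^sup>2 * \<bar>0 - a\<bar> powr (2*\<kappa>) + c\<^sup>2 * \<bar>0 - b\<bar> powr (2*\<kappa>) - c\<^sup>2 * \<bar>b - a\<bar> powr (2*\<kappa>)) / 2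
        = c\<^sup>2 * (\<integral>\<omega>. B a \<omega> * B b \<omega> \<partial>N)"
      unfolding is_fBm_properties(2)[OF B ab] using ab by (simp add: algebra_simps)
    also have "\<dots> = (\<integral>\<omega>. (c * B a \<omega>) * (c * B b \<omega>) \<partial>N)"
    proof -
      have "(c * B a \<omega>) * (c * B b \<omega>) = c\<^sup>2 * (B a \<omega> * B b \<omega>)" for \<omega>
        by (simp add: power2_eq_square mult_ac)
      then show ?thesis by (simp only: integral_mult_right_zero)
    qed
    finally show "((\<lambda>u. \<integral>\<omega>. ?Z u a \<omega> * ?Z u b \<omega> \<partial>M) \<longlongrightarrow> (\<integral>\<omega>. (c * B a \<omega>) * (c * B b \<omega>) \<partial>N)) (at_right 0)"
    proof (rule Lim_transform_eventually)
      show "\<forall>\<^sub>F u in at_right 0. ((\<integral>\<omega>. (?Z u a \<omega> - ?Z u 0 \<omega>)\<^sup>2 \<partial>M) + (\<integral>\<omega>. (?Z u b \<omega> - ?Z u 0 \<omega>)\<^sup>2 \<partial>M)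
          - (\<integral>\<omega>. (?Z u a \<omega> - ?Z u b \<omega>)\<^sup>2 \<partial>M)) / 2 = (\<integral>\<omega>. ?Z u a \<omega> * ?Z u b \<omega> \<partial>M)"
        using upos
      proof eventually_elim
        case (elim u)
        have "(x + y - (x + y - 2 * z)) / 2 = z" for x y z :: real by simp
        then show ?case unfolding cgp_increment(3)[OF CZ[OF elim] ab] Z0 diff_zero .
      qed
    qed
  next
    fix k :: nat
    \<comment> \<open>The factors \<open>q = (b - a) / (t + u * a)\<close> are at most \<open>k / t\<close>, so Potter's bound is applied on \<open>(0, \<Lambda>]\<close>.\<close>
    define \<Lambda> where "\<Lambda> = max 1 (real k / t)"
    obtain C where C: "\<forall>\<^sub>F u in at_right 0. \<forall>q. 0 < q \<longrightarrow> q \<le> \<Lambda> \<longrightarrow> \<psi> (q * u) / \<psi> u \<le> C * q powr (\<kappa>/2)"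
      using regularly_varying_ratio_le[OF L assms(4), of \<Lambda>] by (auto simp: \<Lambda>_def \<psi>_def)
    define D where "D = \<sigma>\<^sup>2 * (t + real k) powr (2*\<gamma>) * (C * (1 / t) powr (\<kappa>/2))\<^sup>2"
    have D0: "D \<ge> 0" by (simp add: D_def)
    have "\<forall>\<^sub>F u::real in at_right 0. u \<in> {0<..<1}" by (rule eventually_at_right_real) simp
    with C have "\<forall>\<^sub>F u in at_right 0. \<forall>a\<in>{0..real k}. \<forall>b\<in>{0..real k}.
        (\<integral>\<omega>. (?Z u a \<omega> - ?Z u b \<omega>)\<^sup>2 \<partial>M) \<le> D * \<bar>a - b\<bar> powr \<kappa>"
    proof eventually_elim
      case (elim u)
      then have u: "0 < u" "u < 1" by auto
      have less: "(\<integral>\<omega>. (?Z u a \<omega> - ?Z u b \<omega>)\<^sup>2 \<partial>M) \<le> D * \<bar>a - b\<bar> powr \<kappa>"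
        if ab: "0 \<le> a" "a < b" "b \<le> real k" for a b
      proof -
        define s where "s = t + u * a"
        define q where "q = (b - a) / s"
        have "u * a \<le> 1 * real k" using u ab by (intro mult_mono) auto
        then have s: "t \<le> s" "s \<le> t + real k" using u ab by (auto simp: s_def)
        have q: "0 < q" "q \<le> (b - a) / t" using s t ab by (auto simp: q_def intro!: divide_left_mono)
        have "(b - a) / t \<le> real k / t" using ab t by (intro divide_right_mono) auto
        then have q\<Lambda>: "q \<le> \<Lambda>" using q by (simp add: \<Lambda>_def)
        have r0: "0 \<le> \<psi> (q * u) / \<psi> u" using \<psi>pos[of "q * u"] \<psi>pos[of u] q u by simp
        have r: "\<psi> (q * u) / \<psi> u \<le> C * q powr (\<kappa>/2)" using elim(1) q q\<Lambda> by blast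
        have "0 \<le> C * q powr (\<kappa>/2)" using r0 r by linarith
        then have C0: "C \<ge> 0" using q by (simp add: zero_le_mult_iff)
        have "q powr (\<kappa>/2) \<le> ((b - a) / t) powr (\<kappa>/2)"
          using q assms(4) by (intro powr_mono2) auto
        then have "C * q powr (\<kappa>/2) \<le> C * ((b - a) / t) powr (\<kappa>/2)" by (intro mult_left_mono C0)
        with r have "\<psi> (q * u) / \<psi> u \<le> C * ((b - a) / t) powr (\<kappa>/2)" by linarith
        then have "(\<psi> (q * u) / \<psi> u)\<^sup>2 \<le> (C * ((b - a) / t) powr (\<kappa>/2))\<^sup>2" by (intro power_mono r0)
        moreover have "s powr (2*\<gamma>) \<le> (t + real k) powr (2*\<gamma>)" using s t assms(1) by (intro powr_mono2) auto
        ultimately have "\<sigma>\<^sup>2 * s powr (2*\<gamma>) * (\<psi> (q * u) / \<psi> u)\<^sup>2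
            \<le> \<sigma>\<^sup>2 * (t + real k) powr (2*\<gamma>) * (C * ((b - a) / t) powr (\<kappa>/2))\<^sup>2"
          by (intro mult_mono mult_left_mono) auto
        also have "\<dots> = D * ((b - a) powr (\<kappa>/2))\<^sup>2"
          using ab t by (simp add: D_def powr_divide power_mult_distrib power_divide)
        also have "((b - a) powr (\<kappa>/2))\<^sup>2 = \<bar>a - b\<bar> powr \<kappa>"
          using ab by (simp add: power2_eq_square flip: powr_add)
        finally show ?thesis using incZ[OF u(1) ab(1,2)] by (simp add: q_def s_def)
      qed
      show ?case
      proof (intro ballI)
        fix a b assume ab: "a \<in> {0..real k}" "b \<in> {0..real k}"
        consider "a < b" | "b < a" | "a = b" by linarith
        then show "(\<integral>\<omega>. (?Z u a \<omega> - ?Z u b \<omega>)\<^sup>2 \<partial>M) \<le> D * \<bar>a - b\<bar> powr \<kappa>"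
        proof cases
          case 1 then show ?thesis using less[of a b] ab by simp
        next
          case 2
          then show ?thesis using less[of b a] ab by (simp add: power2_commute abs_minus_commute)
        next
          case 3 then show ?thesis by simp
        qed
      qed
    qed
    then show "\<exists>C. \<forall>\<^sub>F u in at_right 0. \<forall>a\<in>{0..real k}. \<forall>b\<in>{0..real k}.
        (\<integral>\<omega>. (?Z u a \<omega> - ?Z u b \<omega>)\<^sup>2 \<partial>M) \<le> C * \<bar>a - b\<bar> powr \<kappa>"
      by (rule exI[of _ D])
  qed
  then show "converges_weakly
           M (\<lambda>u \<omega>. to_D (\<lambda>\<tau>. (X t \<omega> - X (t + u * \<tau>) \<omega>) / (u powr \<kappa> * L u))) (at_right 0)
           N (\<lambda>\<omega>. to_D (\<lambda>\<tau>. \<sigma> * t powr (\<gamma> - \<kappa>) * B \<tau> \<omega>))"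
    unfolding \<psi>_def c_def .
qed

end
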